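(* Let $T>0$ be fixed, $\Omega=(a,b)$, and let $u_0,u_1$ be real-valued initial data independent of $\varepsilon\in(0,1]$. Let $u=u(x,t)$ be the solution of the nonlinear Klein--Gordon equation $$\partial_{tt}u-\partial_{xx}u+u+\varepsilon^2u^3=0,\quad a<x<b,\ t>0,\qquad u(x,0)=u_0(x),\quad \partial_tu(x,0)=u_1(x),$$ with periodic boundary conditions $u(a,t)=u(b,t)$, $\partial_xu(a,t)=\partial_xu(b,t)$, and assume that up to the time $T_\varepsilon=T/\varepsilon^2$ it satisfies, for an integer $m\ge1$, $$\|u\|_{L^\infty([0,T_\varepsilon];H^{m+1})}\lesssim 1,\qquad \|\partial_tu\|_{L^\infty([0,T_\varepsilon];H^{m})}\lesssim 1 .$$ Let $u^{[n]},v^{[n]}$ be the Strang splitting approximations (defined in the context) with time step $\tau>0$, and let $t_n=n\tau$. Then for $0<\tau_0\le1$ sufficiently small and independent of $\varepsilon$, when $$0<\tau<\alpha\,\frac{\pi(b-a)\tau_0}{2\sqrt{\tau_0^2(b-a)^2+4\pi^2(1+\tau_0^2)}}$$ for a fixed constant $\alpha\in(0,1)$, the following improved uniform error bounds hold: $$\|u(\cdot,t_n)-u^{[n]}\|_1+\|\partial_tu(\cdot,t_n)-v^{[n]}\|\lesssim \varepsilon^2\tau^2+\tau_0^{m+1},\qquad 0\le n\le \frac{T/\varepsilon^2}{\tau}.$$ In particular, if the exact solution is sufficiently smooth, e.g. $u,\partial_tu\in H^\infty$, the last term $\tau_0^{m+1}$ decays exponentially fast ($\sim e^{-c/\tau_0}$)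 and could be ignored practically for small enough $\tau_0$, where the improved uniform error bounds for sufficiently small $\tau$ could be $$\|u(\cdot,t_n)-u^{[n]}\|_1+\|\partial_tu(\cdot,t_n)-v^{[n]}\|\lesssim \varepsilon^2\tau^2,\qquad 0\le n\le \frac{T/\varepsilon^2}{\tau}.$$
   Context: Notation: $A\lesssim B$ means that there is a generic constant $C>0$ independent of the mesh size, the time step $\tau$, $\varepsilon$ and $\tau_0$ such that $|A|\le CB$. The number $\tau_0$ is a free parameter introduced in the analysis. Let $\mu_l=\frac{2\pi l}{b-a}$ for $l\in\mathbb Z$. For $u(x)=\sum_{l\in\mathbb Z}\widehat u_l e^{i\mu_l(x-a)}$, the space $H^m=H^m(\Omega)$ is the set of $u\in L^2(\Omega)$ with finite norm $\|u\|_m$, $\|u\|_m^2=\sum_{l\in\mathbb Z}(1+\mu_l^2)^m|\widehat u_l|^2$; $\|\cdot\|=\|\cdot\|_0$ is the $L^2$ norm, and $H^\infty=\bigcap_m H^m$. The operators $\langle\nabla\rangle=\sqrt{1-\Delta}$, $\langle\nabla\rangle^{-1}$ and $e^{it\langle\nabla\rangle}$ act as Fourier multipliers: they multiply the coefficient $\widehat u_l$ by $\sqrt{1+\mu_l^2}$, $1/\sqrt{1+\mu_l^2}$ and $e^{it\sqrt{1+\mu_l^2}}$, respectively. Strang splitting (semi-discretization in time): let $F(\phi)=i\langle\nabla\rangle^{-1}G(\phi)$ with $G(\phi)=\frac18(\phi+\overline\phi)^3$. Set $\psi^{[0]}=u_0-i\langle\nabla\rangle^{-1}u_1$ and, for $n\ge0$,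 $$\psi^{[n+1]}=e^{i\tau\langle\nabla\rangle}\psi^{[n]}+\varepsilon^2\tau\,e^{i\frac{\tau}{2}\langle\nabla\rangle}F\!\left(e^{i\frac{\tau}{2}\langle\nabla\rangle}\psi^{[n]}\right),$$ and $$u^{[n]}=\tfrac12\left(\psi^{[n]}+\overline{\psi^{[n]}}\right),\qquad v^{[n]}=\tfrac i2\langle\nabla\rangle\left(\psi^{[n]}-\overline{\psi^{[n]}}\right).$$
   Formalization: In the "in particular" part, H^∞ gives a remainder τ0^k for every k; e^{-c/τ0} is claimed only for uniformly analytic u, ∂_t u; the pure ε²τ² bound holds for small τ with τ^N ≤ ε² (any N), or e^{-κ/τ} ≤ ε² if analytic, as uniformity in ε fails at resonant steps. *)

theory Defs
  imports "HOL-Analysis.Analysis"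
begin

text \<open>
  Functions on \<open>\<Omega> = (a,b)\<close> are total functions on the reals of which only the values on
  \<open>[a,b]\<close> are used. Integrals are with respect to \<^const>\<open>lebesgue\<close> (complete), so that a.e.
  modifications never matter.
\<close>

definition square_integrable :: "real \<Rightarrow> real \<Rightarrow> (real \<Rightarrow> 'a::{banach, second_countable_topology}) \<Rightarrow> bool" where
  "square_integrable a b f \<longleftrightarrow>
     set_borel_measurable lebesgue {a..b} f \<and>
     set_integrable lebesgue {a..b} (\<lambda>x. (norm (f x))\<^sup>2)"

definition mu :: "real \<Rightarrow> real \<Rightarrow> int \<Rightarrow> real" where
  "mu a b l = 2 * pi * of_int l / (b - a)"

definition fcoeff :: "real \<Rightarrow> real \<Rightarrow> (real \<Rightarrow> complex) \<Rightarrow> int \<Rightarrow> complex" where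
  "fcoeff a b u l =
     (LINT x:{a..b}|lebesgue. u x * exp (- (\<i> * of_real (mu a b l * (x - a))))) / of_real (b - a)"

definition hspace :: "real \<Rightarrow> real \<Rightarrow> nat \<Rightarrow> (real \<Rightarrow> complex) set" where
  "hspace a b m = {u. square_integrable a b u \<and>
     (\<lambda>l. (1 + (mu a b l)\<^sup>2) ^ m * (cmod (fcoeff a b u l))\<^sup>2) summable_on UNIV}"

text \<open>The infinite sum is \<open>0\<close> if it diverges, so \<open>hnorm a b m u\<close> is meaningful only for
  \<open>u \<in> hspace a b m\<close>; all bounds below are accompanied by this membership. For \<open>m = 0\<close> it is
  the \<open>L\<^sup>2\<close> norm for the normalised measure \<open>dx / (b - a)\<close>.\<close>

definition hnorm :: "real \<Rightarrow> real \<Rightarrow> nat \<Rightarrow> (real \<Rightarrow> complex) \<Rightarrow> real" where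
  "hnorm a b m u =
     sqrt (\<Sum>\<^sub>\<infinity>l. (1 + (mu a b l)\<^sup>2) ^ m * (cmod (fcoeff a b u l))\<^sup>2)"

definition hspace_inf :: "real \<Rightarrow> real \<Rightarrow> (real \<Rightarrow> complex) set" where
  "hspace_inf a b = (\<Inter>m. hspace a b m)"

text \<open>Periodic functions that extend analytically to a complex strip: exponentially weighted
  Fourier coefficients, with squared norm at most \<open>K\<close>.\<close>

definition analytic_ball :: "real \<Rightarrow> real \<Rightarrow> real \<Rightarrow> real \<Rightarrow> (real \<Rightarrow> complex) set" where
  "analytic_ball a b \<rho> K = {u. square_integrable a b u \<and>
     (\<lambda>l. exp (2 * \<rho> * \<bar>mu a b l\<bar>) * (cmod (fcoeff a b u l))\<^sup>2) summable_on UNIV \<and>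
     (\<Sum>\<^sub>\<infinity>l. exp (2 * \<rho> * \<bar>mu a b l\<bar>) * (cmod (fcoeff a b u l))\<^sup>2) \<le> K}"

text \<open>The Fourier multiplier with symbol \<open>\<sigma>\<close>, as a pointwise absolutely convergent series. This
  applies because below it only acts on functions for which \<open>\<sigma> l\<close> times the \<open>l\<close>-th coefficient is
  absolutely summable: \<open>\<psi>\<^sup>[\<^sup>n\<^sup>] \<in> H\<^sup>2\<close>, hence \<open>\<langle>\<nabla>\<rangle>\<psi>\<^sup>[\<^sup>n\<^sup>] \<in> H\<^sup>1\<close>, and \<open>H\<^sup>1\<close> functions of one variable have
  absolutely summable coefficients.\<close>

definition fmult :: "real \<Rightarrow> real \<Rightarrow> (int \<Rightarrow> complex) \<Rightarrow> (real \<Rightarrow> complex) \<Rightarrow> real \<Rightarrow> complex" where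
  "fmult a b \<sigma> u x =
     (\<Sum>\<^sub>\<infinity>l. \<sigma> l * fcoeff a b u l * exp (\<i> * of_real (mu a b l * (x - a))))"

definition japanese :: "real \<Rightarrow> real \<Rightarrow> (real \<Rightarrow> complex) \<Rightarrow> real \<Rightarrow> complex" where
  "japanese a b = fmult a b (\<lambda>l. of_real (sqrt (1 + (mu a b l)\<^sup>2)))"

definition japanese_inv :: "real \<Rightarrow> real \<Rightarrow> (real \<Rightarrow> complex) \<Rightarrow> real \<Rightarrow> complex" where
  "japanese_inv a b = fmult a b (\<lambda>l. of_real (1 / sqrt (1 + (mu a b l)\<^sup>2)))"

definition exp_japanese :: "real \<Rightarrow> real \<Rightarrow> real \<Rightarrow> (real \<Rightarrow> complex) \<Rightarrow> real \<Rightarrow> complex" where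
  "exp_japanese a b t = fmult a b (\<lambda>l. exp (\<i> * of_real (t * sqrt (1 + (mu a b l)\<^sup>2))))"

definition nonlin_G :: "(real \<Rightarrow> complex) \<Rightarrow> real \<Rightarrow> complex" where
  "nonlin_G \<phi> x = (\<phi> x + cnj (\<phi> x)) ^ 3 / 8"

definition nonlin_F :: "real \<Rightarrow> real \<Rightarrow> (real \<Rightarrow> complex) \<Rightarrow> real \<Rightarrow> complex" where
  "nonlin_F a b \<phi> x = \<i> * japanese_inv a b (nonlin_G \<phi>) x"

fun strang_psi :: "real \<Rightarrow> real \<Rightarrow> real \<Rightarrow> real \<Rightarrow> (real \<Rightarrow> real) \<Rightarrow> (real \<Rightarrow> real) \<Rightarrow> nat \<Rightarrow> real \<Rightarrow> complex" where
  "strang_psi a b \<epsilon> \<tau> u0 u1 0 =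
     (\<lambda>x. of_real (u0 x) - \<i> * japanese_inv a b (\<lambda>y. of_real (u1 y)) x)"
| "strang_psi a b \<epsilon> \<tau> u0 u1 (Suc n) =
     (let \<psi> = strang_psi a b \<epsilon> \<tau> u0 u1 n in
      (\<lambda>x. exp_japanese a b \<tau> \<psi> x
         + of_real (\<epsilon>\<^sup>2 * \<tau>) *
             exp_japanese a b (\<tau> / 2) (nonlin_F a b (exp_japanese a b (\<tau> / 2) \<psi>)) x))"

definition strang_u :: "real \<Rightarrow> real \<Rightarrow> real \<Rightarrow> real \<Rightarrow> (real \<Rightarrow> real) \<Rightarrow> (real \<Rightarrow> real) \<Rightarrow> nat \<Rightarrow> real \<Rightarrow> complex" where
  "strang_u a b \<epsilon> \<tau> u0 u1 n x =
     (strang_psi a b \<epsilon> \<tau> u0 u1 n x + cnj (strang_psi a b \<epsilon> \<tau> u0 u1 n x)) / 2"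

definition strang_v :: "real \<Rightarrow> real \<Rightarrow> real \<Rightarrow> real \<Rightarrow> (real \<Rightarrow> real) \<Rightarrow> (real \<Rightarrow> real) \<Rightarrow> nat \<Rightarrow> real \<Rightarrow> complex" where
  "strang_v a b \<epsilon> \<tau> u0 u1 n x =
     \<i> / 2 * japanese a b
       (\<lambda>y. strang_psi a b \<epsilon> \<tau> u0 u1 n y - cnj (strang_psi a b \<epsilon> \<tau> u0 u1 n y)) x"

text \<open>Derivative at time \<open>t\<close> (one-sided at the endpoints of \<open>S\<close>) of an \<open>L\<^sup>2\<close>-valued function of time.\<close>

definition has_L2_derivative ::
    "real \<Rightarrow> real \<Rightarrow> (real \<Rightarrow> real \<Rightarrow> real) \<Rightarrow> (real \<Rightarrow> real) \<Rightarrow> real \<Rightarrow> real set \<Rightarrow> bool" where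
  "has_L2_derivative a b f f' t S \<longleftrightarrow>
     (\<forall>s\<in>S. square_integrable a b (f s)) \<and> square_integrable a b f' \<and>
     ((\<lambda>s. LINT x:{a..b}|lebesgue. ((f s x - f t x) / (s - t) - f' x)\<^sup>2) \<longlongrightarrow> 0) (at t within S)"

text \<open>Strong solutions on \<open>[0,Tend]\<close>: \<open>u t\<close> is the function \<open>u(\<sqdot>,t)\<close> and \<open>ut t\<close> is
  \<open>\<partial>\<^sub>t u(\<sqdot>,t)\<close>. For data in \<open>H\<^sup>2 \<times> H\<^sup>1\<close> (the case \<open>m = 1\<close>), \<open>\<partial>\<^sub>t\<^sub>t u\<close> and \<open>\<partial>\<^sub>x\<^sub>x u\<close> are in general
  only in \<open>L\<^sup>2\<close>: time derivatives are taken in \<open>L\<^sup>2\<close>, \<open>ux t\<close> is absolutely continuous with density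
  \<open>uxx t\<close>, and the equation holds almost everywhere.\<close>

definition nkg_solution ::
    "real \<Rightarrow> real \<Rightarrow> real \<Rightarrow> real \<Rightarrow> (real \<Rightarrow> real) \<Rightarrow> (real \<Rightarrow> real) \<Rightarrow>
     (real \<Rightarrow> real \<Rightarrow> real) \<Rightarrow> (real \<Rightarrow> real \<Rightarrow> real) \<Rightarrow> bool" where
  "nkg_solution a b \<epsilon> Tend u0 u1 u ut \<longleftrightarrow>
     (\<forall>x\<in>{a..b}. u 0 x = u0 x \<and> ut 0 x = u1 x) \<and>
     (\<exists>utt ux uxx. \<forall>t\<in>{0..Tend}.
        has_L2_derivative a b u (ut t) t {0..Tend} \<and>
        has_L2_derivative a b ut (utt t) t {0..Tend} \<and>
        square_integrable a b (uxx t) \<and>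
        (\<forall>x\<in>{a..b}. (u t has_real_derivative ux t x) (at x within {a..b}) \<and>
                     ux t x = ux t a + (LINT y:{a..x}|lebesgue. uxx t y)) \<and>
        u t a = u t b \<and> ux t a = ux t b \<and>
        (AE x in lebesgue. x \<in> {a<..<b} \<longrightarrow>
            utt t x - uxx t x + u t x + \<epsilon>\<^sup>2 * (u t x) ^ 3 = 0))"

definition step_bound :: "real \<Rightarrow> real \<Rightarrow> real \<Rightarrow> real" where
  "step_bound a b \<tau>0 =
     pi * (b - a) * \<tau>0 / (2 * sqrt (\<tau>0\<^sup>2 * (b - a)\<^sup>2 + 4 * pi\<^sup>2 * (1 + \<tau>0\<^sup>2)))"

definition strang_error_le ::
    "real \<Rightarrow> real \<Rightarrow> real \<Rightarrow> real \<Rightarrow> real \<Rightarrow> (real \<Rightarrow> real) \<Rightarrow> (real \<Rightarrow> real) \<Rightarrow>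
     (real \<Rightarrow> real \<Rightarrow> real) \<Rightarrow> (real \<Rightarrow> real \<Rightarrow> real) \<Rightarrow> real \<Rightarrow> bool" where
  "strang_error_le a b T \<epsilon> \<tau> u0 u1 u ut B \<longleftrightarrow>
     (\<forall>n::nat. real n \<le> (T / \<epsilon>\<^sup>2) / \<tau> \<longrightarrow>
        (let eu = (\<lambda>x. of_real (u (real n * \<tau>) x) - strang_u a b \<epsilon> \<tau> u0 u1 n x);
             ev = (\<lambda>x. of_real (ut (real n * \<tau>) x) - strang_v a b \<epsilon> \<tau> u0 u1 n x)
         in eu \<in> hspace a b 1 \<and> ev \<in> hspace a b 0 \<and>
            hnorm a b 1 eu + hnorm a b 0 ev \<le> B))"

end

(* In Fourier variables psi = u - i <D>^{-1} u_t satisfies psi_t = i <D> psi + i eps^2 <D>^{-1} u^3, and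
   phi(t) = exp(-i t <D>) psi(t) moves only by O(eps^2) per unit of time. For phi the scheme is the
   midpoint rule, and three errors arise in each step. Replacing the solution by the linear flow costs
   O(eps^4 tau^3), because the Duhamel kernel sin(<D> s) / <D> vanishes at s = 0. Discarding the
   frequencies above 1 / (3 tau0) costs eps^2 tau times the tail of psi. The quadrature error of
   the remaining finite trigonometric sum is O(eps^2 tau^3) per step and not summable as it stands, but
   its phases exp(i t_n theta) have tau |theta| < 2 pi by the step restriction, so the geometric sums
   are bounded; summation by parts against the slowly varying phi then gives O(eps^2 tau^2) over all
   T / (eps^2 tau) steps. A discrete Gronwall argument in H^1 closes the estimate. *)
theory Submission
  imports Defs
begin

section \<open>Bounded sequences and convolutions\<close>

text \<open>The estimate closes in H^1 because <D>^{-1} restores one derivative: for \<beta> times a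
  coefficient of phi the right-hand side is the bare cubic term, which is Lipschitz in l^2 on balls
  of H^1, as H^1 coefficients are absolutely summable in one dimension. The same derivative pays for
  the quadrature: its error on a phase \<theta> is O(\<tau>^2 |\<theta>|), and |\<theta>| is at most
  twice the sum of the weights of the three incoming frequencies, so one factor is measured in H^1
  and the others in l^1. No constant depends on the cutoff; \<tau>0 enters only through the
  discarded tail and the step restriction, where a phase combines four weights of frequencies up to
  1/\<tau>0. The Lipschitz constant requires a bounded numerical solution, which is known only once
  the error is: the argument assumes that the final bound is at most 1, and small \<tau>0 ensures
  this. Time derivatives of solutions are available coefficient by coefficient only, so increments
  are controlled by a mean value inequality instead of integrals in time.\<close>

definition l1b :: "('i \<Rightarrow> complex) \<Rightarrow> real \<Rightarrow> bool" where
  "l1b f B \<longleftrightarrow> (\<forall>A. finite A \<longrightarrow> (\<Sum>l\<in>A. cmod (f l)) \<le> B)"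

text \<open>Bounding all finite partial sums makes membership in l^2 and the norm estimate one
  statement, free of the default value that a divergent infinite sum would take. \<open>l1b\<close>
  has the same purpose.\<close>

definition l2b :: "('i \<Rightarrow> complex) \<Rightarrow> real \<Rightarrow> bool" where
  "l2b f B \<longleftrightarrow> (\<forall>A. finite A \<longrightarrow> L2_set (\<lambda>l. cmod (f l)) A \<le> B)"

lemma l1bD: "l1b f B \<Longrightarrow> finite A \<Longrightarrow> (\<Sum>l\<in>A. cmod (f l)) \<le> B"
  by (simp add: l1b_def)

lemma l2bD: "l2b f B \<Longrightarrow> finite A \<Longrightarrow> L2_set (\<lambda>l. cmod (f l)) A \<le> B"
  by (simp add: l2b_def)

lemma l1b_nonneg: "l1b f B \<Longrightarrow> 0 \<le> B"
  using l1bD[of f B "{}"] by simp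

lemma l2b_nonneg: "l2b f B \<Longrightarrow> 0 \<le> B"
  using l2bD[of f B "{}"] by simp

lemma l2b_mono: "l2b f A \<Longrightarrow> A \<le> B \<Longrightarrow> l2b f B"
  unfolding l2b_def by fastforce

lemma l1b_dominated: "l1b g B \<Longrightarrow> (\<And>l. cmod (f l) \<le> cmod (g l)) \<Longrightarrow> l1b f B"
  unfolding l1b_def by (meson order_trans sum_mono)

lemma l2b_dominated: "l2b g B \<Longrightarrow> (\<And>l. cmod (f l) \<le> cmod (g l)) \<Longrightarrow> l2b f B"
  unfolding l2b_def by (meson L2_set_mono norm_ge_zero order_trans)

lemma l2b_pointwise: "l2b f B \<Longrightarrow> cmod (f l) \<le> B"
  using l2bD[of f B "{l}"] by simp

lemma l2b_zero: "0 \<le> B \<Longrightarrow> l2b (\<lambda>_. 0) B"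
  by (simp add: l2b_def L2_set_def)

lemma l1b_add: assumes "l1b f A" "l1b g B" shows "l1b (\<lambda>l. f l + g l) (A + B)"
  unfolding l1b_def
proof (intro allI impI)
  fix F :: "'a set" assume F: "finite F"
  have "(\<Sum>l\<in>F. cmod (f l + g l)) \<le> (\<Sum>l\<in>F. cmod (f l)) + (\<Sum>l\<in>F. cmod (g l))"
    unfolding sum.distrib[symmetric] by (intro sum_mono norm_triangle_ineq)
  then show "(\<Sum>l\<in>F. cmod (f l + g l)) \<le> A + B"
    using l1bD[OF assms(1) F] l1bD[OF assms(2) F] by linarith
qed

lemma l2b_add: assumes "l2b f A" "l2b g B" shows "l2b (\<lambda>l. f l + g l) (A + B)"
  unfolding l2b_def
proof (intro allI impI)
  fix F :: "'a set" assume F: "finite F"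
  have "L2_set (\<lambda>l. cmod (f l + g l)) F \<le> L2_set (\<lambda>l. cmod (f l) + cmod (g l)) F"
    by (intro L2_set_mono norm_triangle_ineq) auto
  also have "\<dots> \<le> L2_set (\<lambda>l. cmod (f l)) F + L2_set (\<lambda>l. cmod (g l)) F"
    by (rule L2_set_triangle_ineq)
  finally show "L2_set (\<lambda>l. cmod (f l + g l)) F \<le> A + B"
    using l2bD[OF assms(1) F] l2bD[OF assms(2) F] by linarith
qed

lemma l1b_scale: assumes "l1b f B" "\<And>l. cmod (g l) \<le> c * cmod (f l)" "0 \<le> c" shows "l1b g (c * B)"
  unfolding l1b_def
proof (intro allI impI)
  fix F :: "'a set" assume F: "finite F"
  have "(\<Sum>l\<in>F. cmod (g l)) \<le> c * (\<Sum>l\<in>F. cmod (f l))"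
    unfolding sum_distrib_left by (intro sum_mono assms)
  then show "(\<Sum>l\<in>F. cmod (g l)) \<le> c * B"
    using mult_left_mono[OF l1bD[OF assms(1) F] assms(3)] by linarith
qed

lemma l2b_scale: assumes "l2b f B" "\<And>l. cmod (g l) \<le> c * cmod (f l)" "0 \<le> c" shows "l2b g (c * B)"
  unfolding l2b_def
proof (intro allI impI)
  fix F :: "'a set" assume F: "finite F"
  have "L2_set (\<lambda>l. cmod (g l)) F \<le> c * L2_set (\<lambda>l. cmod (f l)) F"
    unfolding L2_set_right_distrib[OF assms(3)] by (intro L2_set_mono assms) auto
  then show "L2_set (\<lambda>l. cmod (g l)) F \<le> c * B"
    using mult_left_mono[OF l2bD[OF assms(1) F] assms(3)] by linarith
qed

lemma l2b_uminus: "l2b f B \<Longrightarrow> l2b (\<lambda>l. - f l) B"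
  by (simp add: l2b_def)

lemma l1b_diff: "l1b f A \<Longrightarrow> l1b g B \<Longrightarrow> l1b (\<lambda>l. f l - g l) (A + B)"
  using l1b_add[of f A "\<lambda>l. - g l" B] by (simp add: l1b_def)

lemma l2b_diff: "l2b f A \<Longrightarrow> l2b g B \<Longrightarrow> l2b (\<lambda>l. f l - g l) (A + B)"
  using l2b_add[of f A "\<lambda>l. - g l" B] by (simp add: l2b_def)

lemma l2b_sum:
  assumes "finite I" "\<And>i. i \<in> I \<Longrightarrow> l2b (f i) (B i)"
  shows "l2b (\<lambda>l. \<Sum>i\<in>I. f i l) (\<Sum>i\<in>I. B i)"
  using assms by (induction I) (auto intro!: l2b_zero l2b_add)

lemma l1b_reindex: assumes "l1b f B" "inj h" shows "l1b (\<lambda>l. f (h l)) B"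
  unfolding l1b_def
proof (intro allI impI)
  fix F :: "'b set" assume F: "finite F"
  have "(\<Sum>l\<in>F. cmod (f (h l))) = (\<Sum>l\<in>h ` F. cmod (f l))"
    using assms(2) by (subst sum.reindex) (auto intro: inj_on_subset)
  then show "(\<Sum>l\<in>F. cmod (f (h l))) \<le> B" using l1bD[OF assms(1)] F by simp
qed

lemma l2b_reindex: assumes "l2b f B" "inj h" shows "l2b (\<lambda>l. f (h l)) B"
  unfolding l2b_def
proof (intro allI impI)
  fix F :: "'b set" assume F: "finite F"
  have "L2_set (\<lambda>l. cmod (f (h l))) F = L2_set (\<lambda>l. cmod (f l)) (h ` F)"
    using assms(2) by (simp add: L2_set_def sum.reindex inj_on_subset)
  then show "L2_set (\<lambda>l. cmod (f (h l))) F \<le> B" using l2bD[OF assms(1)] F by simp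
qed

lemma l1b_iff_abs_summable: "(\<lambda>l. cmod (f l)) summable_on UNIV \<longleftrightarrow> (\<exists>B. l1b f B)"
  unfolding Infinite_Sum.abs_summable_iff_bdd_above l1b_def bdd_above_def by auto

lemma l1b_abs_summable: "l1b f B \<Longrightarrow> (\<lambda>l. cmod (f l)) summable_on UNIV"
  using l1b_iff_abs_summable by blast

lemma l2b_of_l1b: assumes "l1b f B" shows "l2b f B"
  unfolding l2b_def
proof (intro allI impI)
  fix F :: "'a set" assume F: "finite F"
  show "L2_set (\<lambda>l. cmod (f l)) F \<le> B"
    using L2_set_le_sum[of F "\<lambda>l. cmod (f l)"] l1bD[OF assms F] by simp
qed

lemma l2b_summable:
  assumes "l2b f B"
  shows "(\<lambda>l. (cmod (f l))\<^sup>2) summable_on UNIV" "(\<Sum>\<^sub>\<infinity>l. (cmod (f l))\<^sup>2) \<le> B\<^sup>2"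
proof -
  have *: "(\<Sum>l\<in>F. (cmod (f l))\<^sup>2) \<le> B\<^sup>2" if "finite F" for F
    using l2bD[OF assms that] l2b_nonneg[OF assms] unfolding L2_set_def
    by (metis real_sqrt_le_iff real_sqrt_abs abs_of_nonneg)
  show s: "(\<lambda>l. (cmod (f l))\<^sup>2) summable_on UNIV"
    by (rule nonneg_bdd_above_summable_on) (auto intro!: bdd_aboveI * )
  show "(\<Sum>\<^sub>\<infinity>l. (cmod (f l))\<^sup>2) \<le> B\<^sup>2"
    by (rule infsum_le_finite_sums[OF s]) (use * in auto)
qed

lemma l2b_of_summable:
  assumes "(\<lambda>l. (cmod (f l))\<^sup>2) summable_on UNIV"
  shows "l2b f (sqrt (\<Sum>\<^sub>\<infinity>l. (cmod (f l))\<^sup>2))"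
  unfolding l2b_def L2_set_def
  by (auto intro!: real_sqrt_le_mono finite_sum_le_infsum assms)

lemma l2b_mult_l1b: assumes "l2b f A" "l2b g B" shows "l1b (\<lambda>l. f l * g l) (A * B)"
  unfolding l1b_def
proof (intro allI impI)
  fix F :: "'a set" assume F: "finite F"
  have "(\<Sum>l\<in>F. cmod (f l * g l)) \<le> L2_set (\<lambda>l. cmod (f l)) F * L2_set (\<lambda>l. cmod (g l)) F"
    using L2_set_mult_ineq[of "\<lambda>l. cmod (f l)" "\<lambda>l. cmod (g l)" F] by (simp add: norm_mult)
  also have "\<dots> \<le> A * B"
    by (intro mult_mono l2bD assms F l2b_nonneg[OF assms(1)]) auto
  finally show "(\<Sum>l\<in>F. cmod (f l * g l)) \<le> A * B" .
qed

text \<open>Mean value inequality in $\ell^2$; testing the increment against itself reduces it to the real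
  mean value theorem, so the derivative need not be integrable in time.\<close>

lemma l2b_mvt:
  fixes F :: "real \<Rightarrow> 'i \<Rightarrow> complex"
  assumes st: "s \<le> t"
    and D: "\<And>r l. s \<le> r \<Longrightarrow> r \<le> t \<Longrightarrow> ((\<lambda>r. F r l) has_vector_derivative F' r l) (at r within {s..t})"
    and B: "\<And>r. s \<le> r \<Longrightarrow> r \<le> t \<Longrightarrow> l2b (F' r) B"
  shows "l2b (\<lambda>l. F t l - F s l) (B * (t - s))"
  unfolding l2b_def
proof (intro allI impI)
  fix A :: "'i set" assume A: "finite A"
  define c where "c l = F t l - F s l" for l
  define d where "d = L2_set (\<lambda>l. cmod (c l)) A"
  define h where "h r = (\<Sum>l\<in>A. Re (cnj (c l) * F r l))" for r
  define h' where "h' r = (\<Sum>l\<in>A. Re (cnj (c l) * F' r l))" for r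
  have d0: "0 \<le> d" by (simp add: d_def)
  have h: "(h has_real_derivative h' r) (at r within {s..t})" if "s \<le> r" "r \<le> t" for r
    unfolding h_def h'_def has_real_derivative_iff_has_vector_derivative
    by (intro has_vector_derivative_sum bounded_linear.has_vector_derivative[OF bounded_linear_Re]
        has_vector_derivative_mult_right D that)
  have "\<exists>x\<in>{s..t}. h t - h s = (\<lambda>v. v * h' x) (t - s)"
    by (rule mvt_very_simple[OF st])
      (use h in \<open>auto simp: has_field_derivative_def mult_commute_abs\<close>)
  then obtain x where x: "s \<le> x" "x \<le> t" "h t - h s = (t - s) * h' x" by auto
  have "h t - h s = (\<Sum>l\<in>A. (cmod (c l))\<^sup>2)"
    unfolding h_def sum_subtractf[symmetric]
  proof (rule sum.cong[OF refl])
    fix l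
    have "Re (cnj (c l) * F t l) - Re (cnj (c l) * F s l) = Re (cnj (c l) * c l)"
      by (simp add: c_def algebra_simps)
    also have "\<dots> = (cmod (c l))\<^sup>2" by (metis mult.commute complex_norm_square Re_complex_of_real)
    finally show "Re (cnj (c l) * F t l) - Re (cnj (c l) * F s l) = (cmod (c l))\<^sup>2" .
  qed
  also have "\<dots> = d\<^sup>2" unfolding d_def L2_set_def by (simp add: sum_nonneg)
  finally have dd: "d\<^sup>2 = (t - s) * h' x" using x by simp
  have "h' x \<le> (\<Sum>l\<in>A. \<bar>cmod (c l)\<bar> * \<bar>cmod (F' x l)\<bar>)"
    unfolding h'_def
    by (intro sum_mono order_trans[OF complex_Re_le_cmod]) (simp add: norm_mult)
  also have "\<dots> \<le> d * L2_set (\<lambda>l. cmod (F' x l)) A"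
    unfolding d_def by (rule L2_set_mult_ineq)
  also have "\<dots> \<le> d * B" by (intro mult_left_mono l2bD B x A d0)
  finally have "d\<^sup>2 \<le> (t - s) * (d * B)" unfolding dd using st by (intro mult_left_mono) auto
  then have "d * d \<le> d * (B * (t - s))" by (simp add: power2_eq_square algebra_simps)
  moreover have "0 \<le> B * (t - s)" using l2b_nonneg[OF B[of s]] st by simp
  ultimately have "d \<le> B * (t - s)" using d0 by (cases "d = 0") auto
  then show "L2_set (\<lambda>l. cmod (F t l - F s l)) A \<le> B * (t - s)" by (simp add: d_def c_def)
qed

definition conv :: "(int \<Rightarrow> complex) \<Rightarrow> (int \<Rightarrow> complex) \<Rightarrow> int \<Rightarrow> complex" where
  "conv f g l = (\<Sum>\<^sub>\<infinity>k. f k * g (l - k))"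

definition conv3 :: "(int \<Rightarrow> complex) \<Rightarrow> int \<Rightarrow> complex" where
  "conv3 f = conv f (conv f f)"

lemma conv_commute: "conv f g = conv g f"
proof
  fix l
  have "conv g f l = (\<Sum>\<^sub>\<infinity>k. g (l - k) * f (l - (l - k)))"
    unfolding conv_def
    by (rule infsum_reindex_bij_witness[of _ "\<lambda>k. l - k" "\<lambda>k. l - k"]) auto
  then show "conv f g l = conv g f l" by (simp add: conv_def mult.commute)
qed

lemma conv_summable:
  assumes "l1b f A" "l2b g B"
  shows "(\<lambda>k. cmod (f k * g (l - k))) summable_on UNIV"
proof -
  have "l1b (\<lambda>k. f k * g (l - k)) (B * A)"
    by (rule l1b_scale[OF assms(1)])
      (auto simp: norm_mult mult.commute[of B] l2b_nonneg[OF assms(2)]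
        intro!: mult_left_mono l2b_pointwise[OF assms(2)])
  then show ?thesis by (rule l1b_abs_summable)
qed

lemma conv_tendsto:
  assumes "l1b f A" "l2b g B"
  shows "((\<lambda>F. \<Sum>k\<in>F. f k * g (l - k)) \<longlongrightarrow> conv f g l) (finite_subsets_at_top UNIV)"
  unfolding conv_def by (rule infsum_tendsto[OF abs_summable_summable[OF conv_summable[OF assms]]])

text \<open>Minkowski: a partial sum over k is a finite combination of translates of g, each with
  the l^2 bound of g. The outer index set stays finite while the partial sums converge.\<close>

lemma young_l2:
  assumes f: "l1b f A" and g: "l2b g B"
  shows "l2b (conv f g) (A * B)"
  unfolding l2b_def
proof (intro allI impI)
  fix S :: "int set" assume S: "finite S"
  have lim: "((\<lambda>F. L2_set (\<lambda>l. cmod (\<Sum>k\<in>F. f k * g (l - k))) S)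
      \<longlongrightarrow> L2_set (\<lambda>l. cmod (conv f g l)) S) (finite_subsets_at_top UNIV)"
    unfolding L2_set_def by (intro tendsto_intros conv_tendsto[OF f g])
  have "L2_set (\<lambda>l. cmod (\<Sum>k\<in>F. f k * g (l - k))) S \<le> A * B" if F: "finite F" for F
  proof -
    have "l2b (\<lambda>l. \<Sum>k\<in>F. f k * g (l - k)) (\<Sum>k\<in>F. cmod (f k) * B)"
      proof (intro l2b_sum F)
      fix k
      show "l2b (\<lambda>l. f k * g (l - k)) (cmod (f k) * B)"
        by (rule l2b_scale[OF l2b_reindex[OF g, of "\<lambda>l. l - k"]]) (auto simp: norm_mult inj_def)
    qed
    then have "L2_set (\<lambda>l. cmod (\<Sum>k\<in>F. f k * g (l - k))) S \<le> (\<Sum>k\<in>F. cmod (f k)) * B"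
      using l2bD[OF _ S] by (simp add: sum_distrib_right)
    also have "\<dots> \<le> A * B" by (intro mult_right_mono l1bD[OF f F] l2b_nonneg[OF g])
    finally show ?thesis .
  qed
  then show "L2_set (\<lambda>l. cmod (conv f g l)) S \<le> A * B"
    by (intro tendsto_upperbound[OF lim]) (auto simp: eventually_finite_subsets_at_top)
qed

lemma young_l1:
  assumes f: "l1b f A" and g: "l1b g B"
  shows "l1b (conv f g) (A * B)"
  unfolding l1b_def
proof (intro allI impI)
  fix S :: "int set" assume S: "finite S"
  have lim: "((\<lambda>F. \<Sum>l\<in>S. cmod (\<Sum>k\<in>F. f k * g (l - k)))
      \<longlongrightarrow> (\<Sum>l\<in>S. cmod (conv f g l))) (finite_subsets_at_top UNIV)"
    by (intro tendsto_intros conv_tendsto[OF f l2b_of_l1b[OF g]])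
  have "(\<Sum>l\<in>S. cmod (\<Sum>k\<in>F. f k * g (l - k))) \<le> A * B" if F: "finite F" for F
  proof -
    have "(\<Sum>l\<in>S. cmod (\<Sum>k\<in>F. f k * g (l - k))) \<le> (\<Sum>l\<in>S. \<Sum>k\<in>F. cmod (f k) * cmod (g (l - k)))"
      by (intro sum_mono order_trans[OF norm_sum]) (simp add: norm_mult)
    also have "\<dots> = (\<Sum>k\<in>F. cmod (f k) * (\<Sum>l\<in>S. cmod (g (l - k))))"
      by (subst sum.swap) (simp add: sum_distrib_left)
    also have "\<dots> \<le> (\<Sum>k\<in>F. cmod (f k) * B)"
      by (intro sum_mono mult_left_mono l1bD[OF l1b_reindex[OF g]] S) (auto simp: inj_def)
    also have "\<dots> \<le> A * B"
      unfolding sum_distrib_right[symmetric] by (intro mult_right_mono l1bD[OF f F] l1b_nonneg[OF g])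
    finally show ?thesis .
  qed
  then show "(\<Sum>l\<in>S. cmod (conv f g l)) \<le> A * B"
    by (intro tendsto_upperbound[OF lim]) (auto simp: eventually_finite_subsets_at_top)
qed

lemma young_l2': "l2b f A \<Longrightarrow> l1b g B \<Longrightarrow> l2b (conv f g) (A * B)"
  using young_l2[of g B f A] by (simp add: conv_commute[of f g] mult.commute)

lemma conv_diff_right:
  assumes "l1b f A" "l2b g B" "l2b h C"
  shows "conv f (\<lambda>l. g l - h l) l = conv f g l - conv f h l"
proof -
  have "conv f (\<lambda>l. g l - h l) l = (\<Sum>\<^sub>\<infinity>k. f k * g (l - k) - f k * h (l - k))"
    by (simp add: conv_def right_diff_distrib)
  also have "\<dots> = conv f g l - conv f h l"
    unfolding conv_def
    using infsum_add[OF abs_summable_summable[OF conv_summable[OF assms(1,2)]]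
        summable_on_uminus[THEN iffD2, OF abs_summable_summable[OF conv_summable[OF assms(1,3)]]], of l l]
    by (simp add: infsum_uminus)
  finally show ?thesis .
qed

lemma conv_diff_left:
  assumes "l1b f A" "l2b g B" "l2b h C"
  shows "conv (\<lambda>l. g l - h l) f l = conv g f l - conv h f l"
  using conv_diff_right[OF assms] by (simp add: conv_commute)

lemma l1b_conv3: "l1b f A \<Longrightarrow> l1b (conv3 f) (A ^ 3)"
  unfolding conv3_def power3_eq_cube mult.assoc by (intro young_l1)

lemma l2b_conv3: "l1b f A \<Longrightarrow> l2b f B \<Longrightarrow> l2b (conv3 f) (A\<^sup>2 * B)"
  unfolding conv3_def power2_eq_square mult.assoc by (intro young_l2)

text \<open>Replacing one factor at a time, fff - ggg = (f-g)ff + g(f-g)f + gg(f-g) for convolution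
  products. Each term has the difference in l^2 and two factors in l^1, so no H^1 bound on the
  difference is required.\<close>

lemma conv3_diff:
  assumes f: "l1b f A" and g: "l1b g A" and d: "l2b (\<lambda>l. f l - g l) D"
  shows "l2b (\<lambda>l. conv3 f l - conv3 g l) (3 * A\<^sup>2 * D)"
proof -
  note f2 = l2b_of_l1b[OF f] and g2 = l2b_of_l1b[OF g]
  note ff = young_l1[OF f f] and gg = young_l1[OF g g] and gf = young_l1[OF g f]
  have "conv3 f l - conv3 g l
      = conv (\<lambda>l. f l - g l) (conv f f) l + conv g (conv (\<lambda>l. f l - g l) f) l
        + conv g (conv g (\<lambda>l. f l - g l)) l" for l
  proof -
    have 1: "conv (\<lambda>l. f l - g l) (conv f f) l = conv f (conv f f) l - conv g (conv f f) l"
      by (rule conv_diff_left[OF ff f2 g2])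
    have "conv (\<lambda>l. f l - g l) f = (\<lambda>l. conv f f l - conv g f l)"
      by (rule ext, rule conv_diff_left[OF f f2 g2])
    then have 2: "conv g (conv (\<lambda>l. f l - g l) f) l = conv g (conv f f) l - conv g (conv g f) l"
      using conv_diff_right[OF g l2b_of_l1b[OF ff] l2b_of_l1b[OF gf]] by simp
    have "conv g (\<lambda>l. f l - g l) = (\<lambda>l. conv g f l - conv g g l)"
      by (rule ext, rule conv_diff_right[OF g f2 g2])
    then have 3: "conv g (conv g (\<lambda>l. f l - g l)) l = conv g (conv g f) l - conv g (conv g g) l"
      using conv_diff_right[OF g l2b_of_l1b[OF gf] l2b_of_l1b[OF gg]] by simp
    show ?thesis unfolding conv3_def 1 2 3 by simp
  qed
  moreover have "l2b (\<lambda>l. conv (\<lambda>l. f l - g l) (conv f f) l + conv g (conv (\<lambda>l. f l - g l) f) l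
        + conv g (conv g (\<lambda>l. f l - g l)) l) (D * (A * A) + A * (D * A) + A * (A * D))"
    by (intro l2b_add young_l2'[OF d ff] young_l2[OF g] young_l2'[OF d f] d)
  ultimately show ?thesis by (simp add: power2_eq_square algebra_simps)
qed

lemma conv_finite_support:
  assumes S: "finite S" and f: "\<And>l. l \<notin> S \<Longrightarrow> f l = 0"
  shows "conv f g l = (\<Sum>k\<in>S. f k * g (l - k))"
proof -
  have "conv f g l = (\<Sum>\<^sub>\<infinity>k\<in>S. f k * g (l - k))"
    unfolding conv_def by (rule infsum_cong_neutral) (auto simp: f)
  then show ?thesis using S by simp
qed

text \<open>The sum over triples p + q + r = l is the form in which a phase depending on all four
  frequencies can be attached to each term.\<close>

lemma conv_conv_finite_support:
  assumes S: "finite S" and f: "\<And>l. l \<notin> S \<Longrightarrow> f l = 0" and g: "\<And>l. l \<notin> S \<Longrightarrow> g l = 0"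
    and h: "\<And>l. l \<notin> S \<Longrightarrow> h l = 0"
  shows "conv f (conv g h) l = (\<Sum>p\<in>S. \<Sum>q\<in>S. \<Sum>r\<in>S. if p + q + r = l then f p * g q * h r else 0)"
proof -
  have *: "(\<Sum>r\<in>S. if p + q + r = l then f p * g q * h r else 0) = f p * (g q * h (l - p - q))" for p q
  proof -
    have "(\<Sum>r\<in>S. if p + q + r = l then f p * g q * h r else 0)
        = (\<Sum>r\<in>S. if r = l - p - q then f p * g q * h r else 0)"
      by (intro sum.cong refl if_cong) auto
    also have "\<dots> = (if l - p - q \<in> S then f p * g q * h (l - p - q) else 0)"
      using S by (simp add: sum.delta)
    finally show ?thesis using h by simp
  qed
  show ?thesis
    unfolding * by (simp add: conv_finite_support[OF S f] conv_finite_support[OF S g] sum_distrib_left)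
qed

section \<open>Oscillatory sums\<close>

text \<open>An antiderivative of e^{i s \<theta>} in s. For \<theta> = 0 it is not the limit of the
  other case, but only differences in s at a fixed \<theta> occur.\<close>

definition osc :: "real \<Rightarrow> real \<Rightarrow> complex" where
  "osc s \<theta> = (if \<theta> = 0 then of_real s else exp (\<i> * of_real (s * \<theta>)) / (\<i> * of_real \<theta>))"

lemma osc_deriv: "((\<lambda>s. osc s \<theta>) has_vector_derivative exp (\<i> * of_real (s * \<theta>))) (at s within A)"
proof (cases "\<theta> = 0")
  case True
  then show ?thesis unfolding osc_def by (auto intro!: derivative_eq_intros simp: has_vector_derivative_def scaleR_conv_of_real fun_eq_iff)
next
  case False
  have "((\<lambda>s. exp (of_real s * (\<i> * of_real \<theta>)) / (\<i> * of_real \<theta>)) has_vector_derivative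
      (of_real 1 * (\<i> * of_real \<theta>)) * exp (of_real s * (\<i> * of_real \<theta>)) / (\<i> * of_real \<theta>)) (at s within A)"
    by (intro has_vector_derivative_divide field_vector_diff_chain_within[unfolded o_def]
        has_vector_derivative_mult_left has_vector_derivative_of_real)
      (auto intro!: derivative_eq_intros)
  then show ?thesis using False by (simp add: osc_def mult_ac)
qed

text \<open>The integral of e^{i s \<theta>} over the first n steps minus its midpoint sum. It is
  accumulated over the steps so that it can serve as the summed factor in a summation by
  parts.\<close>

definition quad_err :: "real \<Rightarrow> nat \<Rightarrow> real \<Rightarrow> complex" where
  "quad_err \<tau> n \<theta> = osc (real n * \<tau>) \<theta> - osc 0 \<theta>
     - of_real \<tau> * (\<Sum>k<n. exp (\<i> * of_real ((real k + 1 / 2) * \<tau> * \<theta>)))"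

lemma abs_sin_minus_self: fixes x :: real shows "\<bar>sin x - x\<bar> \<le> \<bar>x\<bar> ^ 3 / 6"
proof -
  have "\<bar>sin x - (\<Sum>m<3. sin_coeff m * x ^ m)\<bar> \<le> inverse (fact 3) * \<bar>x\<bar> ^ 3"
    by (rule Maclaurin_sin_bound)
  then show ?thesis by (simp add: sin_coeff_def eval_nat_numeral)
qed

text \<open>sin x / x stays away from 0 as long as |x| stays away from pi: Taylor's formula handles
  |x| \<le> 1, and a positive minimum on a compact interval handles the rest. The constant depends
  on \<alpha> alone.\<close>

lemma abs_sin_ge:
  fixes \<alpha> :: real assumes "0 < \<alpha>" "\<alpha> < 1"
  obtains c where "c > 0" "\<And>x. \<bar>x\<bar> \<le> pi * \<alpha> \<Longrightarrow> c * \<bar>x\<bar> \<le> \<bar>sin x\<bar>"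
proof -
  have pa: "pi * \<alpha> < pi" using assms by simp
  have small: "x / 2 \<le> sin x" if "0 \<le> x" "x \<le> 1" for x :: real
  proof -
    have "\<bar>sin x - x\<bar> \<le> x ^ 3 / 6" using abs_sin_minus_self[of x] that by simp
    moreover have "x ^ 3 \<le> x" using that power_le_one[of x 2] mult_right_mono[of "x * x" 1 x]
      by (simp add: power3_eq_cube power2_eq_square)
    ultimately show ?thesis using that by linarith
  qed
  \<comment> \<open>If pi \<alpha> < 1 this range is empty and any positive m serves.\<close>
  obtain m where m: "m > 0" "\<And>x. 1 \<le> x \<Longrightarrow> x \<le> pi * \<alpha> \<Longrightarrow> m \<le> sin x"
  proof (cases "1 \<le> pi * \<alpha>")
    case True
    have "\<exists>x\<in>{1..pi * \<alpha>}. \<forall>y\<in>{1..pi * \<alpha>}. sin x \<le> sin y"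
      using True by (intro continuous_attains_inf) (auto intro!: continuous_intros)
    then obtain x where "x \<in> {1..pi * \<alpha>}" "\<forall>y\<in>{1..pi * \<alpha>}. sin x \<le> sin y" by blast
    moreover from this(1) have "0 < x" "x < pi" using pa unfolding atLeastAtMost_iff by linarith+
    ultimately show ?thesis using that[of "sin x"] sin_gt_zero by auto
  qed (use that[of 1] in auto)
  define c where "c = min (1 / 2) (m / pi)"
  have pos: "c * x \<le> sin x" if "0 \<le> x" "x \<le> pi * \<alpha>" for x
  proof (cases "x \<le> 1")
    case True
    have "c \<le> 1 / 2" unfolding c_def by (rule min.cobounded1)
    then have "c * x \<le> 1 / 2 * x" using that by (intro mult_right_mono)
    then show ?thesis using small[OF that(1) True] by simp
  next
    case False
    have "x \<le> pi" using that pa by linarith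
    then have "c * x \<le> m / pi * pi" using that m by (intro mult_mono) (auto simp: c_def)
    then show ?thesis using m(2)[of x] False that by simp
  qed
  show ?thesis
  proof (rule that[of c])
    show "c > 0" using m by (simp add: c_def)
    fix x :: real assume x: "\<bar>x\<bar> \<le> pi * \<alpha>"
    then show "c * \<bar>x\<bar> \<le> \<bar>sin x\<bar>" using pos[of "\<bar>x\<bar>"] by (cases "0 \<le> x") auto
  qed
qed

text \<open>The accumulated midpoint error for an oscillation $e^{is\theta}$ does not grow with the number
  of steps: it is a geometric sum of ratio $e^{i\tau\theta}$, which stays away from $1$ relative to
  $\tau|\theta|$ because $\tau|\theta|\le 2\pi\alpha<2\pi$.\<close>

lemma quad_err_bound:
  fixes \<alpha> :: real assumes "0 < \<alpha>" "\<alpha> < 1"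
  obtains C where "C > 0"
    "\<And>\<tau> \<theta> n. 0 < \<tau> \<Longrightarrow> \<tau> * \<bar>\<theta>\<bar> \<le> 2 * pi * \<alpha> \<Longrightarrow> cmod (quad_err \<tau> n \<theta>) \<le> C * \<tau>\<^sup>2 * \<bar>\<theta>\<bar>"
proof -
  obtain c where c: "c > 0" "\<And>x. \<bar>x\<bar> \<le> pi * \<alpha> \<Longrightarrow> c * \<bar>x\<bar> \<le> \<bar>sin x\<bar>"
    using abs_sin_ge[OF assms] by blast
  show ?thesis
  proof (rule that[of "1 / c"])
    show "1 / c > 0" using c by simp
    fix \<tau> \<theta> :: real and n
    assume tau: "0 < \<tau>" and th: "\<tau> * \<bar>\<theta>\<bar> \<le> 2 * pi * \<alpha>"
    show "cmod (quad_err \<tau> n \<theta>) \<le> 1 / c * \<tau>\<^sup>2 * \<bar>\<theta>\<bar>"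
    proof (cases "\<theta> = 0")
      case True
      then show ?thesis by (simp add: quad_err_def osc_def)
    next
      case False
      define x where "x = \<tau> * \<theta> / 2"
      have x: "\<bar>x\<bar> \<le> pi * \<alpha>" using th tau by (simp add: x_def abs_mult)
      have x0: "x \<noteq> 0" using False tau by (simp add: x_def)
      have sx: "c * \<bar>x\<bar> \<le> \<bar>sin x\<bar>" by (rule c(2)[OF x])
      have s0: "sin x \<noteq> 0" using sx c(1) x0 by (auto simp: mult_le_0_iff)
      define S where "S = (\<Sum>k<n. exp (\<i> * of_real ((real k + 1 / 2) * \<tau> * \<theta>)))"
      \<comment> \<open>Multiplying by 2 i sin x, with x half the phase advance of one step, turns
        each midpoint value into the difference of the values at the two ends of the step.\<close>
      have tel: "exp (\<i> * of_real ((real k + 1 / 2) * \<tau> * \<theta>)) * (2 * \<i> * of_real (sin x))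
         = exp (\<i> * of_real (real (Suc k) * \<tau> * \<theta>)) - exp (\<i> * of_real (real k * \<tau> * \<theta>))" for k
      proof -
        have e1: "2 * \<i> * of_real (sin x) = exp (\<i> * of_real x) - exp (- (\<i> * of_real x))"
          by (simp add: sin_of_real[symmetric] sin_exp_eq)
        have a1: "\<i> * of_real ((real k + 1 / 2) * \<tau> * \<theta>) + \<i> * of_real x = \<i> * of_real (real (Suc k) * \<tau> * \<theta>)"
          unfolding distrib_left[symmetric] of_real_add[symmetric] x_def by (simp add: field_simps)
        have a2: "\<i> * of_real ((real k + 1 / 2) * \<tau> * \<theta>) + - (\<i> * of_real x) = \<i> * of_real (real k * \<tau> * \<theta>)"
          by (simp add: x_def field_simps)
        show ?thesis unfolding e1 right_diff_distrib exp_add[symmetric] a1 a2 ..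
      qed
      define Z where "Z = exp (\<i> * of_real (real n * \<tau> * \<theta>)) - 1"
      have "S * (2 * \<i> * of_real (sin x)) = Z"
        unfolding S_def sum_distrib_right tel Z_def
        by (subst sum_lessThan_telescope) simp
      then have S: "S = Z / (2 * \<i> * of_real (sin x))" using s0 by (simp add: field_simps)
      have "quad_err \<tau> n \<theta> = Z / (\<i> * of_real \<theta>) - of_real \<tau> * S"
        using False by (simp add: quad_err_def osc_def S_def Z_def diff_divide_distrib)
      also have "\<dots> = Z / \<i> * of_real (1 / \<theta> - \<tau> / (2 * sin x))"
        unfolding S using False s0 by (simp add: field_simps)
      finally have "cmod (quad_err \<tau> n \<theta>) = cmod Z * \<bar>1 / \<theta> - \<tau> / (2 * sin x)\<bar>"
        by (simp only: norm_mult norm_divide norm_of_real) simp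
      \<comment> \<open>This form exposes sin x - x, which is cubic in x: against the quadratic
        denominator x sin x it leaves one factor |x|, that is, one factor \<tau> |\<theta>|.\<close>
      also have "1 / \<theta> - \<tau> / (2 * sin x) = \<tau> / 2 * ((sin x - x) / (x * sin x))"
        using False s0 x0 tau by (simp add: x_def field_simps)
      also have "\<bar>\<dots>\<bar> = \<tau> / 2 * (\<bar>sin x - x\<bar> / (\<bar>x\<bar> * \<bar>sin x\<bar>))"
        using tau by (simp add: abs_mult)
      finally have q: "cmod (quad_err \<tau> n \<theta>) = cmod Z * (\<tau> / 2 * (\<bar>sin x - x\<bar> / (\<bar>x\<bar> * \<bar>sin x\<bar>)))" .
      have Z: "cmod Z \<le> 2" unfolding Z_def by (rule order_trans[OF norm_triangle_ineq4]) simp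
      have "\<bar>sin x - x\<bar> \<le> \<bar>x\<bar> ^ 3"
        using abs_sin_minus_self[of x] zero_le_power[OF abs_ge_zero, of x 3] by linarith
      then have "\<bar>sin x - x\<bar> / (\<bar>x\<bar> * \<bar>sin x\<bar>) \<le> \<bar>x\<bar> ^ 3 / (\<bar>x\<bar> * (c * \<bar>x\<bar>))"
        using x0 s0 c(1) by (intro frac_le mult_left_mono sx mult_pos_pos) auto
      also have "\<dots> = \<bar>x\<bar> / c" using x0 c(1) by (simp add: power3_eq_cube field_simps)
      finally have "cmod (quad_err \<tau> n \<theta>) \<le> 2 * (\<tau> / 2 * (\<bar>x\<bar> / c))"
        unfolding q using tau c(1) Z by (intro mult_mono) auto
      also have "\<dots> \<le> 1 / c * \<tau>\<^sup>2 * \<bar>\<theta>\<bar>"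
        using tau c(1) by (simp add: x_def abs_mult power2_eq_square field_simps)
      finally show ?thesis .
    qed
  qed
qed

text \<open>The coefficients of the real part: complex conjugation of a function reflects and
  conjugates its coefficients.\<close>

definition rp :: "(int \<Rightarrow> complex) \<Rightarrow> int \<Rightarrow> complex" where
  "rp f l = (f l + cnj (f (- l))) / 2"

lemma rp_diff: "rp (\<lambda>l. f l - g l) l = rp f l - rp g l"
  by (simp add: rp_def field_simps)

lemma l1b_rp: assumes "l1b f B" shows "l1b (rp f) B"
proof -
  have "l1b (\<lambda>l. cnj (f (- l))) B"
    by (rule l1b_dominated[OF l1b_reindex[OF assms, of uminus]]) auto
  then have "l1b (\<lambda>l. (f l + cnj (f (- l))) / 2) (1 / 2 * (B + B))"
    by (rule l1b_scale[OF l1b_add[OF assms]]) (auto simp: norm_divide)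
  then show ?thesis by (simp add: rp_def[abs_def])
qed

lemma l2b_rp: assumes "l2b f B" shows "l2b (rp f) B"
proof -
  have "l2b (\<lambda>l. cnj (f (- l))) B"
    by (rule l2b_dominated[OF l2b_reindex[OF assms, of uminus]]) auto
  then have "l2b (\<lambda>l. (f l + cnj (f (- l))) / 2) (1 / 2 * (B + B))"
    by (rule l2b_scale[OF l2b_add[OF assms]]) (auto simp: norm_divide)
  then show ?thesis by (simp add: rp_def[abs_def])
qed

section \<open>Truncation to low frequencies and splitting by the sign of the phase\<close>

definition trunc :: "int \<Rightarrow> (int \<Rightarrow> complex) \<Rightarrow> int \<Rightarrow> complex" where
  "trunc n f l = (if \<bar>l\<bar> \<le> n then f l else 0)"

definition sg :: "bool \<Rightarrow> real" where "sg \<sigma> = (if \<sigma> then 1 else - 1)"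

text \<open>Since the weight is even, the linear flow multiplies f l by e^{i s \<beta>} and the
  reflected conjugate by e^{-i s \<beta>}. The flag \<sigma> selects one of these two parts of the
  truncated real part, with \<open>sg \<sigma>\<close> the sign of its phase.\<close>

definition amp :: "int \<Rightarrow> (int \<Rightarrow> complex) \<Rightarrow> bool \<Rightarrow> int \<Rightarrow> complex" where
  "amp n f \<sigma> l = (if \<bar>l\<bar> \<le> n then (if \<sigma> then f l else cnj (f (- l))) / 2 else 0)"

lemma amp_diff: "amp n (\<lambda>l. f l - g l) \<sigma> l = amp n f \<sigma> l - amp n g \<sigma> l"
  by (simp add: amp_def diff_divide_distrib)

text \<open>Abstracts from \<beta> l = sqrt (1 + \<mu>_l^2). Subadditivity distributes the weight of
  a product over its factors; square summability of 1 / \<beta> is the one-dimensional Sobolev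
  embedding, with constant K.\<close>

locale weights =
  fixes \<beta> :: "int \<Rightarrow> real" and K :: real
  assumes beta_ge_1: "1 \<le> \<beta> l"
    and beta_triangle: "\<beta> (j + k) \<le> \<beta> j + \<beta> k"
    and beta_minus: "\<beta> (- l) = \<beta> l"
    and l2b_inverse: "l2b (\<lambda>l. of_real (1 / \<beta> l)) K"
begin

lemma beta_pos: "0 < \<beta> l" using beta_ge_1[of l] by linarith

lemma beta_neq_0 [simp]: "\<beta> l \<noteq> 0" using beta_pos[of l] by simp

lemma abs_beta [simp]: "\<bar>\<beta> l\<bar> = \<beta> l" using beta_pos[of l] by simp

definition h1b :: "(int \<Rightarrow> complex) \<Rightarrow> real \<Rightarrow> bool" where
  "h1b f B \<longleftrightarrow> l2b (\<lambda>l. of_real (\<beta> l) * f l) B"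

lemma h1b_nonneg: "h1b f B \<Longrightarrow> 0 \<le> B"
  unfolding h1b_def by (rule l2b_nonneg)

lemma h1b_mono: "h1b f A \<Longrightarrow> A \<le> B \<Longrightarrow> h1b f B"
  unfolding h1b_def by (rule l2b_mono)

lemma h1b_l2b: assumes "h1b f B" shows "l2b f B"
  by (rule l2b_dominated[OF assms[unfolded h1b_def]])
    (use beta_ge_1 in \<open>auto simp: norm_mult mult_le_cancel_right1\<close>)

text \<open>Cauchy-Schwarz with f = (1 / \<beta>) (\<beta> f).\<close>

lemma h1b_l1b: assumes "h1b f B" shows "l1b f (K * B)"
  using l2b_mult_l1b[OF l2b_inverse assms[unfolded h1b_def]] by simp

lemma h1b_dominated: "h1b g B \<Longrightarrow> (\<And>l. cmod (f l) \<le> cmod (g l)) \<Longrightarrow> h1b f B"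
  unfolding h1b_def by (erule l2b_dominated) (auto simp: norm_mult intro!: mult_left_mono less_imp_le[OF beta_pos])

lemma h1b_diff: "h1b f A \<Longrightarrow> h1b g B \<Longrightarrow> h1b (\<lambda>l. f l - g l) (A + B)"
  unfolding h1b_def right_diff_distrib by (rule l2b_diff)

lemma h1b_reflect: assumes "h1b f B" shows "h1b (\<lambda>l. cnj (f (- l))) B"
  unfolding h1b_def
  by (rule l2b_dominated[OF l2b_reindex[OF assms[unfolded h1b_def], of uminus]])
    (auto simp: norm_mult beta_minus)

lemma h1b_amp: assumes "h1b f B" shows "h1b (amp n f \<sigma>) B"
proof (cases \<sigma>)
  case True
  show ?thesis by (rule h1b_dominated[OF assms]) (auto simp: amp_def True norm_divide)
next
  case False
  show ?thesis by (rule h1b_dominated[OF h1b_reflect[OF assms]]) (auto simp: amp_def False norm_divide)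
qed

section \<open>The linear flow, the rotated nonlinearity and trilinear sums with a phase
  kernel\<close>

definition lin :: "real \<Rightarrow> (int \<Rightarrow> complex) \<Rightarrow> int \<Rightarrow> complex" where
  "lin s f l = exp (\<i> * of_real (s * \<beta> l)) * f l"

lemma norm_lin [simp]: "cmod (lin s f l) = cmod (f l)"
  by (simp add: lin_def norm_mult)

lemma lin_lin: "lin s (lin t f) = lin (s + t) f"
  by (rule ext) (simp add: lin_def exp_add[symmetric] algebra_simps)

lemma lin_0: "lin 0 f = f"
  by (rule ext) (simp add: lin_def)

lemma lin_diff: "lin s (\<lambda>l. f l - g l) l = lin s f l - lin s g l"
  by (simp add: lin_def algebra_simps)

text \<open>The cubic term in the frame that rotates with the linear flow, without the factor i
  \<epsilon>^2 / \<beta>. For frozen f all its time dependence is oscillatory.\<close>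

definition nl :: "real \<Rightarrow> (int \<Rightarrow> complex) \<Rightarrow> int \<Rightarrow> complex" where
  "nl s f = lin (- s) (conv3 (rp (lin s f)))"

text \<open>The rotations are isometries and taking real parts is a contraction, so this is
  \<open>conv3_diff\<close> with the l^1 bounds K R supplied by the embedding.\<close>

lemma nl_lipschitz:
  assumes f: "h1b f R" and g: "h1b g R" and d: "l2b (\<lambda>l. f l - g l) D"
  shows "l2b (\<lambda>l. nl s f l - nl s g l) (3 * (K * R)\<^sup>2 * D)"
proof -
  have *: "l1b (rp (lin s h)) (K * R)" if "h1b h R" for h
    by (rule l1b_rp[OF l1b_dominated[OF h1b_l1b[OF that]]]) simp
  have "l2b (rp (lin s (\<lambda>l. f l - g l))) D"
    by (rule l2b_rp[OF l2b_dominated[OF d]]) simp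
  then have "l2b (\<lambda>l. rp (lin s f) l - rp (lin s g) l) D"
    unfolding lin_diff[abs_def] rp_diff[abs_def] .
  from conv3_diff[OF *[OF f] *[OF g] this]
  show ?thesis unfolding nl_def lin_diff[symmetric] by (rule l2b_dominated) simp
qed

text \<open>The kernel \<kappa> is left free because three are used: e^{i s \<theta>} gives the
  truncated nonlinearity, \<open>osc s\<close> its antiderivative in time, and
  \<open>quad_err \<tau> k\<close> the accumulated midpoint error. Inputs are cut at n, so the
  output frequency reaches 3n.\<close>

definition tri :: "int \<Rightarrow> (real \<Rightarrow> complex) \<Rightarrow> bool \<Rightarrow> bool \<Rightarrow> bool \<Rightarrow>
    (int \<Rightarrow> complex) \<Rightarrow> (int \<Rightarrow> complex) \<Rightarrow> (int \<Rightarrow> complex) \<Rightarrow> int \<Rightarrow> complex" where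
  "tri n \<kappa> \<rho> \<sigma> \<upsilon> f g h l = (\<Sum>p\<in>{- n..n}. \<Sum>q\<in>{- n..n}. \<Sum>r\<in>{- n..n}.
     if p + q + r = l then \<kappa> (sg \<rho> * \<beta> p + sg \<sigma> * \<beta> q + sg \<upsilon> * \<beta> r - \<beta> l) * (f p * g q * h r) else 0)"

definition trilin :: "int \<Rightarrow> (real \<Rightarrow> complex) \<Rightarrow> (bool \<Rightarrow> int \<Rightarrow> complex) \<Rightarrow> (bool \<Rightarrow> int \<Rightarrow> complex) \<Rightarrow>
    (bool \<Rightarrow> int \<Rightarrow> complex) \<Rightarrow> int \<Rightarrow> complex" where
  "trilin n \<kappa> f g h l = (\<Sum>\<rho>\<in>UNIV. \<Sum>\<sigma>\<in>UNIV. \<Sum>\<upsilon>\<in>UNIV. tri n \<kappa> \<rho> \<sigma> \<upsilon> (f \<rho>) (g \<sigma>) (h \<upsilon>) l)"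

lemma trilin_diff_kernel:
  "trilin n (\<lambda>\<theta>. \<kappa> \<theta> - \<kappa>' \<theta>) f g h l = trilin n \<kappa> f g h l - trilin n \<kappa>' f g h l"
  unfolding trilin_def tri_def sum_subtractf[symmetric]
  by (intro sum.cong refl) (simp add: left_diff_distrib)

lemma trilin_scale_kernel:
  "trilin n (\<lambda>\<theta>. c * \<kappa> \<theta>) f g h l = c * trilin n \<kappa> f g h l"
  unfolding trilin_def tri_def sum_distrib_left
  by (intro sum.cong refl) simp

lemma trilin_deriv:
  assumes "\<And>\<theta>. ((\<lambda>s. \<kappa> s \<theta>) has_vector_derivative \<kappa>' \<theta>) (at s within A)"
  shows "((\<lambda>s. trilin n (\<kappa> s) f g h l) has_vector_derivative trilin n \<kappa>' f g h l) (at s within A)"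
  unfolding trilin_def tri_def
proof (intro has_vector_derivative_sum)
  fix p q r \<rho> \<sigma> \<upsilon>
  show "((\<lambda>s. if p + q + r = l then \<kappa> s (sg \<rho> * \<beta> p + sg \<sigma> * \<beta> q + sg \<upsilon> * \<beta> r - \<beta> l) * (f \<rho> p * g \<sigma> q * h \<upsilon> r) else 0)
    has_vector_derivative (if p + q + r = l then \<kappa>' (sg \<rho> * \<beta> p + sg \<sigma> * \<beta> q + sg \<upsilon> * \<beta> r - \<beta> l) * (f \<rho> p * g \<sigma> q * h \<upsilon> r) else 0))
    (at s within A)"
    by (auto intro!: has_vector_derivative_mult_left assms)
qed

lemma trilin_diff3:
  "trilin n \<kappa> f f f l - trilin n \<kappa> g g g l =
     trilin n \<kappa> (\<lambda>\<sigma> l. f \<sigma> l - g \<sigma> l) f f l + trilin n \<kappa> g (\<lambda>\<sigma> l. f \<sigma> l - g \<sigma> l) f l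
     + trilin n \<kappa> g g (\<lambda>\<sigma> l. f \<sigma> l - g \<sigma> l) l"
  unfolding trilin_def tri_def sum_subtractf[symmetric] sum.distrib[symmetric]
  by (intro sum.cong refl) (simp add: algebra_simps)

text \<open>By subadditivity |\<theta>| \<le> 2 (\<beta> p + \<beta> q + \<beta> r), so the factor
  |\<theta>| in the kernel bound becomes a weight on one of the three inputs. Each of the three
  resulting convolutions has the weighted factor in l^2 and the others in l^1, whence 2c times 3 K^2
  F G H. The bound B is required up to 3n because it is applied to the output frequency too; it
  keeps \<theta> in the range where \<kappa> is controlled.\<close>

lemma tri_bound:
  assumes n: "\<And>l. \<bar>l\<bar> \<le> 3 * n \<Longrightarrow> \<beta> l \<le> B"
    and \<kappa>: "\<And>\<theta>. \<bar>\<theta>\<bar> \<le> 4 * B \<Longrightarrow> cmod (\<kappa> \<theta>) \<le> c * \<bar>\<theta>\<bar>"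
    and c: "0 \<le> c" and F: "h1b f F" and G: "h1b g G" and H: "h1b h H"
  shows "l2b (tri n \<kappa> \<rho> \<sigma> \<upsilon> f g h) (6 * c * K\<^sup>2 * F * G * H)"
proof -
  define S where "S = {- n..n}"
  define z where "z u l = (complex_of_real (if l \<in> S then cmod (u l) else 0))" for u and l :: int
  define w where "w u l = of_real (\<beta> l) * z u l" for u l
  have z1: "l1b (z u) (K * X)" if "h1b u X" for u X
    by (rule l1b_dominated[OF h1b_l1b[OF that]]) (simp add: z_def)
  have w2: "l2b (w u) X" if "h1b u X" for u X
    by (rule l2b_dominated[OF that[unfolded h1b_def]])
      (auto simp: z_def w_def norm_mult intro!: mult_nonneg_nonneg less_imp_le[OF beta_pos])
  \<comment> \<open>A nonnegative majorant built from moduli, so that its own modulus equals the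
    triple sum T with which the terms are compared.\<close>
  define W where "W l = of_real (2 * c) * (conv (w f) (conv (z g) (z h)) l + conv (z f) (conv (w g) (z h)) l
      + conv (z f) (conv (z g) (w h)) l)" for l
  have "l2b W (2 * c * (F * (K * G * (K * H)) + K * F * (G * (K * H)) + K * F * (K * G * H)))"
    unfolding W_def
    by (rule l2b_scale[OF l2b_add[OF l2b_add[OF young_l2'[OF w2[OF F] young_l1[OF z1[OF G] z1[OF H]]]
        young_l2[OF z1[OF F] young_l2'[OF w2[OF G] z1[OF H]]]] young_l2[OF z1[OF F] young_l2[OF z1[OF G] w2[OF H]]]]])
      (use c in \<open>auto simp: norm_mult\<close>)
  then have W: "l2b W (6 * c * K\<^sup>2 * F * G * H)" by (simp add: power2_eq_square algebra_simps)
  show ?thesis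
  proof (rule l2b_dominated[OF W])
    fix l
    define T where "T = (\<Sum>p\<in>S. \<Sum>q\<in>S. \<Sum>r\<in>S. if p + q + r = l
      then 2 * c * (\<beta> p + \<beta> q + \<beta> r) * (cmod (f p) * cmod (g q) * cmod (h r)) else 0)"
    have S: "finite S" by (simp add: S_def)
    have s: "z u l = 0" "w u l = 0" if "l \<notin> S" for u l using that by (auto simp: z_def w_def)
    define Q where "Q u v x = (\<Sum>p\<in>S. \<Sum>q\<in>S. \<Sum>r\<in>S. if p + q + r = l then u p * v q * x r else 0)"
      for u v x :: "int \<Rightarrow> complex"
    have Q1: "conv (w f) (conv (z g) (z h)) l = Q (w f) (z g) (z h)"
      and Q2: "conv (z f) (conv (w g) (z h)) l = Q (z f) (w g) (z h)"
      and Q3: "conv (z f) (conv (z g) (w h)) l = Q (z f) (z g) (w h)"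
      unfolding Q_def by (rule conv_conv_finite_support; simp add: S s)+
    have WT: "W l = of_real T"
      unfolding W_def T_def Q1 Q2 Q3 Q_def
        sum.distrib[symmetric] sum_distrib_left of_real_sum
      by (intro sum.cong refl) (simp add: z_def w_def algebra_simps)
    have "cmod (tri n \<kappa> \<rho> \<sigma> \<upsilon> f g h l) \<le> T"
      unfolding tri_def T_def S_def[symmetric]
    proof (intro order_trans[OF norm_sum] sum_mono)
      fix p q r assume pqr: "p \<in> S" "q \<in> S" "r \<in> S"
      show "cmod (if p + q + r = l then \<kappa> (sg \<rho> * \<beta> p + sg \<sigma> * \<beta> q + sg \<upsilon> * \<beta> r - \<beta> l) * (f p * g q * h r) else 0)
        \<le> (if p + q + r = l then 2 * c * (\<beta> p + \<beta> q + \<beta> r) * (cmod (f p) * cmod (g q) * cmod (h r)) else 0)"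
      proof (cases "p + q + r = l")
        case True
        define \<theta> where "\<theta> = sg \<rho> * \<beta> p + sg \<sigma> * \<beta> q + sg \<upsilon> * \<beta> r - \<beta> l"
        have sg: "\<bar>sg s * \<beta> k\<bar> = \<beta> k" for s k by (simp add: sg_def)
        have tl: "\<beta> l \<le> \<beta> p + \<beta> q + \<beta> r"
          using beta_triangle[of "p + q" r] beta_triangle[of p q] True by simp
        have t: "\<bar>\<theta>\<bar> \<le> \<beta> p + \<beta> q + \<beta> r + \<beta> l"
          unfolding \<theta>_def using sg[of \<rho> p] sg[of \<sigma> q] sg[of \<upsilon> r] beta_pos[of l] by linarith
        have "\<beta> p \<le> B" "\<beta> q \<le> B" "\<beta> r \<le> B" "\<beta> l \<le> B"
          using pqr True by (auto intro!: n simp: S_def)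
        then have "cmod (\<kappa> \<theta>) \<le> c * \<bar>\<theta>\<bar>" using t by (intro \<kappa>) linarith
        also have "\<bar>\<theta>\<bar> \<le> 2 * (\<beta> p + \<beta> q + \<beta> r)" using t tl by (simp del: abs_beta)
        then have "c * \<bar>\<theta>\<bar> \<le> c * (2 * (\<beta> p + \<beta> q + \<beta> r))" using c by (rule mult_left_mono)
        finally have "cmod (\<kappa> \<theta>) \<le> 2 * c * (\<beta> p + \<beta> q + \<beta> r)" by (simp add: algebra_simps)
        then show ?thesis using True
          by (simp add: \<theta>_def[symmetric] norm_mult mult_right_mono)
      qed simp
    qed
    then show "cmod (tri n \<kappa> \<rho> \<sigma> \<upsilon> f g h l) \<le> cmod (W l)" unfolding WT by simp
  qed
qed

text \<open>48 is 6 times the number of sign patterns.\<close>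

lemma trilin_bound:
  assumes n: "\<And>l. \<bar>l\<bar> \<le> 3 * n \<Longrightarrow> \<beta> l \<le> B"
    and \<kappa>: "\<And>\<theta>. \<bar>\<theta>\<bar> \<le> 4 * B \<Longrightarrow> cmod (\<kappa> \<theta>) \<le> c * \<bar>\<theta>\<bar>"
    and c: "0 \<le> c" and F: "\<And>\<sigma>. h1b (f \<sigma>) F" and G: "\<And>\<sigma>. h1b (g \<sigma>) G" and H: "\<And>\<sigma>. h1b (h \<sigma>) H"
  shows "l2b (trilin n \<kappa> f g h) (48 * c * K\<^sup>2 * F * G * H)"
proof -
  have "l2b (\<lambda>l. \<Sum>\<rho>\<in>UNIV. \<Sum>\<sigma>\<in>UNIV. \<Sum>\<upsilon>\<in>UNIV. tri n \<kappa> \<rho> \<sigma> \<upsilon> (f \<rho>) (g \<sigma>) (h \<upsilon>) l)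
      (\<Sum>\<rho>\<in>(UNIV::bool set). \<Sum>\<sigma>\<in>(UNIV::bool set). \<Sum>\<upsilon>\<in>(UNIV::bool set). 6 * c * K\<^sup>2 * F * G * H)"
    by (intro l2b_sum tri_bound[where B = B] n \<kappa> c F G H) auto
  also have "(\<Sum>\<rho>\<in>(UNIV::bool set). \<Sum>\<sigma>\<in>(UNIV::bool set). \<Sum>\<upsilon>\<in>(UNIV::bool set). 6 * c * K\<^sup>2 * F * G * H)
      = 48 * c * K\<^sup>2 * F * G * H" by simp
  finally show ?thesis unfolding trilin_def[abs_def] .
qed

text \<open>Each real part is a sum of two rotating amplitudes; multiplying out the cube and the
  outer rotation collects all phases into one exponential e^{i s \<theta>} per frequency triple and
  sign pattern.\<close>

lemma nl_trunc:
  "nl s (trunc n f) l = trilin n (\<lambda>\<theta>. exp (\<i> * of_real (s * \<theta>))) (amp n f) (amp n f) (amp n f) l"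
proof -
  define R where "R = rp (lin s (trunc n f))"
  define S where "S = {- n..n}"
  have S: "finite S" by (simp add: S_def)
  have R: "R p = (\<Sum>\<sigma>\<in>UNIV. exp (\<i> * of_real (s * (sg \<sigma> * \<beta> p))) * amp n f \<sigma> p)" for p
    by (auto simp: R_def rp_def lin_def trunc_def amp_def UNIV_bool sg_def beta_minus exp_cnj add_divide_distrib)
  have R0: "R p = 0" if "p \<notin> S" for p
    using that by (auto simp: R amp_def S_def UNIV_bool)
  have "nl s (trunc n f) l = exp (- (\<i> * of_real (s * \<beta> l))) *
     (\<Sum>p\<in>S. \<Sum>q\<in>S. \<Sum>r\<in>S. if p + q + r = l then R p * R q * R r else 0)"
    unfolding nl_def lin_def conv3_def R_def[symmetric, unfolded lin_def[abs_def]]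
    by (subst conv_conv_finite_support[OF S R0 R0 R0]) simp_all
  also have "\<dots> = (\<Sum>p\<in>S. \<Sum>q\<in>S. \<Sum>r\<in>S. \<Sum>\<rho>\<in>UNIV. \<Sum>\<sigma>\<in>UNIV. \<Sum>\<upsilon>\<in>UNIV. if p + q + r = l
      then exp (\<i> * of_real (s * (sg \<rho> * \<beta> p + sg \<sigma> * \<beta> q + sg \<upsilon> * \<beta> r - \<beta> l))) *
        (amp n f \<rho> p * amp n f \<sigma> q * amp n f \<upsilon> r) else 0)"
    unfolding sum_distrib_left
  proof (intro sum.cong refl)
    fix p q r
    have e: "exp (\<i> * of_real (s * (x + y + w - v))) = exp (- (\<i> * of_real (s * v))) *
      (exp (\<i> * of_real (s * x)) * exp (\<i> * of_real (s * y)) * exp (\<i> * of_real (s * w)))" for x y w v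
      unfolding exp_add[symmetric] by (simp add: algebra_simps)
    show "exp (- (\<i> * of_real (s * \<beta> l))) * (if p + q + r = l then R p * R q * R r else 0) =
      (\<Sum>\<rho>\<in>UNIV. \<Sum>\<sigma>\<in>UNIV. \<Sum>\<upsilon>\<in>UNIV. if p + q + r = l
        then exp (\<i> * of_real (s * (sg \<rho> * \<beta> p + sg \<sigma> * \<beta> q + sg \<upsilon> * \<beta> r - \<beta> l))) *
        (amp n f \<rho> p * amp n f \<sigma> q * amp n f \<upsilon> r) else 0)"
      unfolding R e by (simp add: UNIV_bool algebra_simps)
  qed
  also have "\<dots> = trilin n (\<lambda>\<theta>. exp (\<i> * of_real (s * \<theta>))) (amp n f) (amp n f) (amp n f) l"
    unfolding trilin_def tri_def S_def[symmetric] by (simp add: UNIV_bool sum.distrib[symmetric])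
  finally show ?thesis .
qed

end

section \<open>The splitting error in Fourier coefficients\<close>

text \<open>U and V stand for the coefficients of u and its time derivative, e for \<epsilon>^2, and
  the symmetries express that both are real-valued. Differentiability is pointwise in l; uniformity
  in l comes from the bounds by way of \<open>l2b_mvt\<close>.\<close>

locale kg_flow = weights +
  fixes U V :: "real \<Rightarrow> int \<Rightarrow> complex" and e Te M :: real
  assumes e_nonneg: "0 \<le> e"
    and deriv_U: "\<And>t l. 0 \<le> t \<Longrightarrow> t \<le> Te \<Longrightarrow>
      ((\<lambda>t. U t l) has_vector_derivative V t l) (at t within {0..Te})"
    and deriv_V: "\<And>t l. 0 \<le> t \<Longrightarrow> t \<le> Te \<Longrightarrow>
      ((\<lambda>t. V t l) has_vector_derivative - of_real ((\<beta> l)\<^sup>2) * U t l - of_real e * conv3 (U t) l) (at t within {0..Te})"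
    and sym_U: "\<And>t l. 0 \<le> t \<Longrightarrow> t \<le> Te \<Longrightarrow> U t (- l) = cnj (U t l)"
    and sym_V: "\<And>t l. 0 \<le> t \<Longrightarrow> t \<le> Te \<Longrightarrow> V t (- l) = cnj (V t l)"
    and bound_U: "\<And>t. 0 \<le> t \<Longrightarrow> t \<le> Te \<Longrightarrow> h1b (U t) M"
    and bound_V: "\<And>t. 0 \<le> t \<Longrightarrow> t \<le> Te \<Longrightarrow> l2b (V t) M"
begin

definition psi :: "real \<Rightarrow> int \<Rightarrow> complex" where
  "psi t l = U t l - \<i> * V t l / of_real (\<beta> l)"

definition phi :: "real \<Rightarrow> int \<Rightarrow> complex" where
  "phi t = lin (- t) (psi t)"

text \<open>The right-hand side is the cosine and sine propagator of the free equation: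
  \<open>rp (lin s (phi r))\<close> is the state of the solution at time r carried to time s by the
  linear flow.\<close>

lemma rp_lin_phi:
  assumes r: "0 \<le> r" "r \<le> Te"
  shows "rp (lin s (phi r)) l
    = of_real (cos (\<beta> l * (s - r))) * U r l + of_real (sin (\<beta> l * (s - r)) / \<beta> l) * V r l"
proof -
  define x where "x = (s - r) * \<beta> l"
  have "rp (lin s (phi r)) l = (exp (\<i> * of_real x) * (U r l - \<i> * V r l / of_real (\<beta> l))
      + exp (- (\<i> * of_real x)) * (U r l + \<i> * V r l / of_real (\<beta> l))) / 2"
    unfolding phi_def lin_lin
    by (simp add: rp_def lin_def psi_def beta_minus sym_U[OF r] sym_V[OF r] exp_cnj x_def)
  also have "exp (\<i> * of_real x) = of_real (cos x) + \<i> * of_real (sin x)"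
    by (simp add: exp_Euler cos_of_real sin_of_real)
  also have "exp (- (\<i> * of_real x)) = of_real (cos x) - \<i> * of_real (sin x)"
    using exp_Euler[of "- of_real x"] by (simp add: cos_of_real sin_of_real)
  also have "((of_real (cos x) + \<i> * of_real (sin x)) * (U r l - \<i> * V r l / of_real (\<beta> l))
      + (of_real (cos x) - \<i> * of_real (sin x)) * (U r l + \<i> * V r l / of_real (\<beta> l))) / 2
      = of_real (cos x) * U r l + of_real (sin x / \<beta> l) * V r l"
  proof -
    have "((a + \<i> * b) * (u - \<i> * w) + (a - \<i> * b) * (u + \<i> * w)) / 2 = a * u + b * w" for a b u w :: complex
      by (simp add: algebra_simps)
    from this[of _ _ _ "V r l / of_real (\<beta> l)"] show ?thesis by simp
  qed
  finally show ?thesis by (simp add: x_def mult.commute)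
qed

lemma rp_phi: "0 \<le> t \<Longrightarrow> t \<le> Te \<Longrightarrow> rp (lin t (phi t)) = U t"
  by (rule ext) (simp add: rp_lin_phi)

lemma bound_psi: assumes t: "0 \<le> t" "t \<le> Te" shows "h1b (psi t) (2 * M)"
proof -
  have "h1b (\<lambda>l. \<i> * V t l / of_real (\<beta> l)) M"
    unfolding h1b_def by (rule l2b_dominated[OF bound_V[OF t]]) (simp add: norm_mult norm_divide)
  from h1b_diff[OF bound_U[OF t] this] show ?thesis by (simp add: psi_def[abs_def])
qed

lemma bound_phi: "0 \<le> t \<Longrightarrow> t \<le> Te \<Longrightarrow> h1b (phi t) (2 * M)"
  unfolding phi_def by (rule h1b_dominated[OF bound_psi]) auto

lemma nl_phi: "0 \<le> t \<Longrightarrow> t \<le> Te \<Longrightarrow> nl t (phi t) = lin (- t) (conv3 (U t))"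
  by (simp add: nl_def rp_phi)

definition cubic_bound :: real where "cubic_bound = (K * M)\<^sup>2 * M"

lemma bound_conv3_U: "0 \<le> t \<Longrightarrow> t \<le> Te \<Longrightarrow> l2b (conv3 (U t)) cubic_bound"
  unfolding cubic_bound_def by (rule l2b_conv3[OF h1b_l1b h1b_l2b]; rule bound_U)

text \<open>The rotation removes the linear part of the system, and the weight cancels the smoothing
  1 / \<beta> of the nonlinearity; this makes \<beta> times phi the natural unknown.\<close>

lemma deriv_phi:
  assumes t: "0 \<le> t" "t \<le> Te"
  shows "((\<lambda>t. of_real (\<beta> l) * phi t l) has_vector_derivative \<i> * of_real e * nl t (phi t) l) (at t within {0..Te})"
proof -
  define E where "E t = exp (of_real t * (- (\<i> * of_real (\<beta> l))))" for t
  have E: "(E has_vector_derivative of_real 1 * (- (\<i> * of_real (\<beta> l))) * E t) (at t within {0..Te})"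
    unfolding E_def
    by (intro field_vector_diff_chain_within[unfolded o_def] has_vector_derivative_mult_left
        has_vector_derivative_of_real) (auto intro!: derivative_eq_intros)
  have "((\<lambda>t. E t * (of_real (\<beta> l) * U t l - \<i> * V t l)) has_vector_derivative
      E t * (of_real (\<beta> l) * V t l - \<i> * (- of_real ((\<beta> l)\<^sup>2) * U t l - of_real e * conv3 (U t) l))
      + of_real 1 * (- (\<i> * of_real (\<beta> l))) * E t * (of_real (\<beta> l) * U t l - \<i> * V t l)) (at t within {0..Te})"
    by (intro has_vector_derivative_mult E has_vector_derivative_diff has_vector_derivative_mult_right
        deriv_U deriv_V t)
  also have "E t * (of_real (\<beta> l) * V t l - \<i> * (- of_real ((\<beta> l)\<^sup>2) * U t l - of_real e * conv3 (U t) l))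
      + of_real 1 * (- (\<i> * of_real (\<beta> l))) * E t * (of_real (\<beta> l) * U t l - \<i> * V t l)
      = \<i> * of_real e * nl t (phi t) l"
    by (simp add: nl_phi[OF t] lin_def E_def power2_eq_square algebra_simps)
  finally show ?thesis
    by (simp add: phi_def lin_def psi_def E_def right_diff_distrib mult_ac)
qed

lemma deriv_within_subinterval:
  "(f has_vector_derivative f') (at r within {0..Te}) \<Longrightarrow> 0 \<le> s \<Longrightarrow> t \<le> Te \<Longrightarrow>
   (f has_vector_derivative f') (at r within {s..t})"
  by (erule has_vector_derivative_within_subset) auto

lemma phi_increment:
  assumes "0 \<le> s" "s \<le> t" "t \<le> Te"
  shows "h1b (\<lambda>l. phi t l - phi s l) (e * cubic_bound * (t - s))"
  unfolding h1b_def right_diff_distrib[where 'a = complex]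
proof (rule l2b_mvt[OF assms(2)])
  fix r l assume r: "s \<le> r" "r \<le> t"
  show "((\<lambda>r. of_real (\<beta> l) * phi r l) has_vector_derivative \<i> * of_real e * nl r (phi r) l) (at r within {s..t})"
    using assms r by (intro deriv_within_subinterval[OF deriv_phi]) auto
next
  fix r assume r: "s \<le> r" "r \<le> t"
  show "l2b (\<lambda>l. \<i> * of_real e * nl r (phi r) l) (e * cubic_bound)"
    by (rule l2b_scale[OF bound_conv3_U[of r]])
      (use assms r e_nonneg in \<open>auto simp: nl_phi norm_mult\<close>)
qed

text \<open>The solution deviates from the linear flow only at second order in the time increment, because
  the Duhamel kernel $\sin(\beta(s-r))/\beta$ vanishes at $s=r$.\<close>

lemma linear_flow_deviation:
  assumes rs: "0 \<le> r" "r \<le> s" "s \<le> Te"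
  shows "l2b (\<lambda>l. rp (lin s (phi s)) l - rp (lin s (phi r)) l) (e * (s - r)\<^sup>2 * cubic_bound)"
proof -
  \<comment> \<open>The starting time r is varied at fixed s. In its derivative all terms linear in
    U and V cancel, which leaves the Duhamel integrand \<open>h'\<close> without any integration in
    time.\<close>
  define h where "h r l = of_real (cos (\<beta> l * (s - r))) * U r l + of_real (sin (\<beta> l * (s - r)) / \<beta> l) * V r l" for r l
  define h' where "h' q l = - (of_real (e * (sin (\<beta> l * (s - q)) / \<beta> l)) * conv3 (U q) l)" for q l
  have "l2b (\<lambda>l. h s l - h r l) (e * (s - r) * cubic_bound * (s - r))"
  proof (rule l2b_mvt[OF rs(2), where F = h and F' = h'])
    fix q l assume q: "r \<le> q" "q \<le> s"
    then have qT: "0 \<le> q" "q \<le> Te" using rs by auto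
    have c: "((\<lambda>q. complex_of_real (cos (\<beta> l * (s - q)))) has_vector_derivative
        of_real (sin (\<beta> l * (s - q)) * \<beta> l)) (at q within {r..s})"
      by (intro has_vector_derivative_of_real) (auto intro!: derivative_eq_intros)
    have sn: "((\<lambda>q. complex_of_real (sin (\<beta> l * (s - q)) / \<beta> l)) has_vector_derivative
        of_real (- cos (\<beta> l * (s - q)))) (at q within {r..s})"
      by (intro has_vector_derivative_of_real) (auto intro!: derivative_eq_intros)
    have "((\<lambda>q. h q l) has_vector_derivative
        (of_real (cos (\<beta> l * (s - q))) * V q l + of_real (sin (\<beta> l * (s - q)) * \<beta> l) * U q l)
        + (of_real (sin (\<beta> l * (s - q)) / \<beta> l) * (- of_real ((\<beta> l)\<^sup>2) * U q l - of_real e * conv3 (U q) l)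
          + of_real (- cos (\<beta> l * (s - q))) * V q l)) (at q within {r..s})"
      unfolding h_def
      by (intro has_vector_derivative_add has_vector_derivative_mult c sn
          deriv_within_subinterval[OF deriv_U] deriv_within_subinterval[OF deriv_V] qT rs)
    then show "((\<lambda>q. h q l) has_vector_derivative h' q l) (at q within {r..s})"
      by (simp add: h'_def power2_eq_square field_simps)
  next
    fix q assume q: "r \<le> q" "q \<le> s"
    then have qT: "0 \<le> q" "q \<le> Te" using rs by auto
    show "l2b (h' q) (e * (s - r) * cubic_bound)"
    proof (rule l2b_scale[OF bound_conv3_U[OF qT]])
      fix l
      have "\<bar>sin (\<beta> l * (s - q))\<bar> \<le> \<beta> l * (s - q)"
        using abs_sin_x_le_abs_x[of "\<beta> l * (s - q)"] q beta_pos[of l] by (simp add: abs_mult)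
      also have "\<dots> \<le> \<beta> l * (s - r)" using q beta_pos[of l] by (intro mult_left_mono) auto
      finally have "\<bar>sin (\<beta> l * (s - q))\<bar> / \<beta> l \<le> s - r"
        using beta_pos[of l] by (simp add: divide_le_eq mult.commute)
      then have "e * (\<bar>sin (\<beta> l * (s - q))\<bar> / \<beta> l) * cmod (conv3 (U q) l) \<le> e * (s - r) * cmod (conv3 (U q) l)"
        using e_nonneg by (intro mult_right_mono mult_left_mono) auto
      then show "cmod (h' q l) \<le> e * (s - r) * cmod (conv3 (U q) l)"
        using e_nonneg by (simp add: h'_def norm_mult norm_divide)
    qed (use rs e_nonneg in auto)
  qed
  then show ?thesis
    using rs by (simp add: rp_lin_phi h_def power2_eq_square mult_ac)
qed

text \<open>The mean value inequality is applied to the difference between the true increment and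
  that generated by the amplitudes frozen at time t and truncated. Its derivative is a difference of
  two values of \<open>nl\<close>, to which the departure from the linear flow contributes e
  \<tau>^2 and the discarded frequencies \<eta>.\<close>

lemma step_error:
  assumes t: "0 \<le> t" "t + \<tau> \<le> Te" "0 \<le> \<tau>"
    and tail: "l2b (\<lambda>l. phi t l - trunc n (phi t) l) \<eta>"
  defines "F \<equiv> amp n (phi t)"
  shows "l2b (\<lambda>l. of_real (\<beta> l) * (phi (t + \<tau>) l - phi t l)
      - \<i> * of_real e * (trilin n (osc (t + \<tau>)) F F F l - trilin n (osc t) F F F l))
    (3 * (K * (2 * M))\<^sup>2 * e * \<tau> * (e * \<tau>\<^sup>2 * cubic_bound + \<eta>))"
proof -
  define X where "X s l = of_real (\<beta> l) * phi s l - \<i> * of_real e * trilin n (osc s) F F F l" for s l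
  define X' where "X' s l = \<i> * of_real e * (nl s (phi s) l - nl s (trunc n (phi t)) l)" for s l
  have htr: "h1b (trunc n f) B" if "h1b f B" for f B
    by (rule h1b_dominated[OF that]) (simp add: trunc_def)
  have l1: "l1b (rp (lin s f)) (K * B)" if "h1b f B" for s f B
    by (rule l1b_rp[OF l1b_dominated[OF h1b_l1b[OF that]]]) simp
  have "l2b (\<lambda>l. X (t + \<tau>) l - X t l)
      (e * (3 * (K * (2 * M))\<^sup>2 * (e * \<tau>\<^sup>2 * cubic_bound + \<eta>)) * (t + \<tau> - t))"
  proof (rule l2b_mvt[where F' = X'])
    fix s l assume s: "t \<le> s" "s \<le> t + \<tau>"
    show "((\<lambda>r. X r l) has_vector_derivative X' s l) (at s within {t..t + \<tau>})"
      unfolding X_def X'_def right_diff_distrib F_def nl_trunc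
      using s t by (intro has_vector_derivative_diff deriv_within_subinterval[OF deriv_phi]
          has_vector_derivative_mult_right trilin_deriv osc_deriv) auto
  next
    fix s assume s: "t \<le> s" "s \<le> t + \<tau>"
    then have sT: "0 \<le> s" "s \<le> Te" using t by auto
    have tT: "t \<le> Te" using t by simp
    have "l2b (rp (lin s (\<lambda>l. phi t l - trunc n (phi t) l))) \<eta>"
      by (rule l2b_rp[OF l2b_dominated[OF tail]]) simp
    then have 1: "l2b (\<lambda>l. rp (lin s (phi t)) l - rp (lin s (trunc n (phi t))) l) \<eta>"
      unfolding lin_diff[abs_def] rp_diff[abs_def] .
    have 2: "e * (s - t)\<^sup>2 * cubic_bound \<le> e * \<tau>\<^sup>2 * cubic_bound"
      using s e_nonneg l2b_nonneg[OF bound_conv3_U[OF sT]]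
      by (intro mult_right_mono mult_left_mono power_mono) auto
    have "l2b (\<lambda>l. rp (lin s (phi s)) l - rp (lin s (trunc n (phi t))) l) (e * \<tau>\<^sup>2 * cubic_bound + \<eta>)"
      using l2b_add[OF l2b_mono[OF linear_flow_deviation[OF t(1) s(1) sT(2)] 2] 1] by simp
    from conv3_diff[OF l1[OF bound_phi[OF sT]] l1[OF htr[OF bound_phi[OF t(1) tT]]] this]
    have "l2b (\<lambda>l. nl s (phi s) l - nl s (trunc n (phi t)) l)
        (3 * (K * (2 * M))\<^sup>2 * (e * \<tau>\<^sup>2 * cubic_bound + \<eta>))"
      unfolding nl_def lin_diff[symmetric] by (rule l2b_dominated) simp
    then show "l2b (X' s) (e * (3 * (K * (2 * M))\<^sup>2 * (e * \<tau>\<^sup>2 * cubic_bound + \<eta>)))"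
      by (rule l2b_scale) (use e_nonneg in \<open>auto simp: X'_def norm_mult\<close>)
  qed (use t in auto)
  then show ?thesis by (simp add: X_def algebra_simps)
qed

text \<open>The summands are, in order: the boundary term of the summation by parts, its sum of
  amplitude differences (3 times 48), the departure from the linear flow, and the tail. The tail
  counts twice, in the exact increment and in the midpoint value, hence 6 instead of 3.\<close>

definition defect_const :: "real \<Rightarrow> real \<Rightarrow> real" where
  "defect_const T C = 48 * C * K\<^sup>2 * (2 * M) ^ 3 + 144 * C * K\<^sup>2 * (2 * M)\<^sup>2 * cubic_bound * T
     + 3 * (K * (2 * M))\<^sup>2 * cubic_bound * T + 6 * (K * (2 * M))\<^sup>2 * T"

text \<open>The Lipschitz constant of \<open>nl\<close> on the ball of radius 2M + 1: the exact phi
  has norm at most 2M, and the error is kept below 1.\<close>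

definition growth_const :: real where "growth_const = 3 * (K * (2 * M + 1))\<^sup>2"

text \<open>Summation by parts in the step index: the frozen amplitudes vary by $O(\varepsilon^2\tau)$ per step
  while the accumulated kernel stays $O(\tau^2)$.\<close>

lemma accumulated_quadrature:
  assumes m: "real m * \<tau> \<le> Te" and tau: "0 < \<tau>" and eT: "e * Te \<le> T" and C: "0 \<le> C"
    and n: "\<And>l. \<bar>l\<bar> \<le> 3 * n \<Longrightarrow> \<beta> l \<le> B"
    and quad: "\<And>\<theta> k. \<bar>\<theta>\<bar> \<le> 4 * B \<Longrightarrow> cmod (quad_err \<tau> k \<theta>) \<le> C * \<tau>\<^sup>2 * \<bar>\<theta>\<bar>"
  defines "F \<equiv> \<lambda>k. amp n (phi (real k * \<tau>))"
  shows "l2b (\<lambda>l. \<i> * of_real e * (\<Sum>k<m. trilin n (quad_err \<tau> (Suc k)) (F k) (F k) (F k) l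
      - trilin n (quad_err \<tau> k) (F k) (F k) (F k) l))
    ((48 * C * K\<^sup>2 * (2 * M) ^ 3 + 144 * C * K\<^sup>2 * (2 * M)\<^sup>2 * cubic_bound * T) * (e * \<tau>\<^sup>2))"
proof -
  define A where "A k f l = trilin n (quad_err \<tau> k) f f f l" for k f l
  have kT: "real k * \<tau> \<le> Te" if "k \<le> m" for k
    using that m tau by (meson mult_right_mono of_nat_mono order_trans less_imp_le)
  have F: "h1b (F k \<sigma>) (2 * M)" if "k \<le> m" for k \<sigma>
    unfolding F_def using kT[OF that] tau by (intro h1b_amp bound_phi) auto
  have c: "0 \<le> C * \<tau>\<^sup>2" using C by simp
  have tb: "l2b (trilin n (quad_err \<tau> k) f g h) (48 * (C * \<tau>\<^sup>2) * K\<^sup>2 * X * Y * Z)"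
    if "\<And>\<sigma>. h1b (f \<sigma>) X" "\<And>\<sigma>. h1b (g \<sigma>) Y" "\<And>\<sigma>. h1b (h \<sigma>) Z" for k f g h X Y Z
    by (rule trilin_bound[where B = B]; fact n quad c that)
  have T0: "A 0 f l = 0" for f l
  proof -
    have "quad_err \<tau> 0 = (\<lambda>\<theta>. 0)" by (simp add: quad_err_def fun_eq_iff)
    then show ?thesis by (simp add: A_def trilin_def tri_def cong: if_cong)
  qed
  \<comment> \<open>The lower boundary term is absent because the error accumulated over zero steps
    vanishes.\<close>
  have tele: "(\<Sum>k<j. A (Suc k) (F k) l - A k (F k) l) =
      A j (F j) l - (\<Sum>k<j. A (Suc k) (F (Suc k)) l - A (Suc k) (F k) l)" for j l
    by (induction j) (auto simp: T0)
  have M0: "0 \<le> M" using h1b_nonneg[OF F[of 0]] by simp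
  have G0: "0 \<le> cubic_bound" using M0 by (simp add: cubic_bound_def)
  have 1: "l2b (A m (F m)) (48 * (C * \<tau>\<^sup>2) * K\<^sup>2 * (2 * M) * (2 * M) * (2 * M))"
    unfolding A_def by (rule tb) (auto intro: F)
  have 2: "l2b (\<lambda>l. A (Suc k) (F (Suc k)) l - A (Suc k) (F k) l)
      (144 * (C * \<tau>\<^sup>2) * K\<^sup>2 * (2 * M) * (2 * M) * (e * cubic_bound * \<tau>))" if "k < m" for k
  proof -
    have D: "h1b (\<lambda>l. F (Suc k) \<sigma> l - F k \<sigma> l) (e * cubic_bound * \<tau>)" for \<sigma>
    proof -
      have "h1b (amp n (\<lambda>l. phi (real (Suc k) * \<tau>) l - phi (real k * \<tau>) l) \<sigma>)
          (e * cubic_bound * (real (Suc k) * \<tau> - real k * \<tau>))"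
        using that tau kT[of "Suc k"] by (intro h1b_amp phi_increment) (auto simp: algebra_simps)
      then show ?thesis unfolding F_def amp_diff[abs_def] by (simp add: algebra_simps)
    qed
    have k: "k \<le> m" "Suc k \<le> m" using that by auto
    show ?thesis unfolding A_def trilin_diff3
      by (rule l2b_mono[OF l2b_add[OF l2b_add[OF tb[OF D F[OF k(2)] F[OF k(2)]]
          tb[OF F[OF k(1)] D F[OF k(2)]]] tb[OF F[OF k(1)] F[OF k(1)] D]]])
        (simp add: algebra_simps)
  qed
  have "l2b (\<lambda>l. A m (F m) l - (\<Sum>k<m. A (Suc k) (F (Suc k)) l - A (Suc k) (F k) l))
    (48 * (C * \<tau>\<^sup>2) * K\<^sup>2 * (2 * M) * (2 * M) * (2 * M)
     + (\<Sum>k<m. 144 * (C * \<tau>\<^sup>2) * K\<^sup>2 * (2 * M) * (2 * M) * (e * cubic_bound * \<tau>)))"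
    by (intro l2b_diff 1 l2b_sum 2) auto
  then have "l2b (\<lambda>l. \<i> * of_real e * (A m (F m) l - (\<Sum>k<m. A (Suc k) (F (Suc k)) l - A (Suc k) (F k) l)))
    (e * (48 * (C * \<tau>\<^sup>2) * K\<^sup>2 * (2 * M) * (2 * M) * (2 * M)
     + (\<Sum>k<m. 144 * (C * \<tau>\<^sup>2) * K\<^sup>2 * (2 * M) * (2 * M) * (e * cubic_bound * \<tau>))))"
    by (rule l2b_scale) (use e_nonneg in \<open>auto simp: norm_mult\<close>)
  then have "l2b (\<lambda>l. \<i> * of_real e * (A m (F m) l - (\<Sum>k<m. A (Suc k) (F (Suc k)) l - A (Suc k) (F k) l)))
    ((48 * C * K\<^sup>2 * (2 * M) ^ 3 + 144 * C * K\<^sup>2 * (2 * M)\<^sup>2 * cubic_bound * T) * (e * \<tau>\<^sup>2))"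
  proof (rule l2b_mono)
    \<comment> \<open>The m differences carry a factor e \<tau> each, so the length T / e of the
      time interval is compensated exactly.\<close>
    have "e * (real m * \<tau>) \<le> T" using mult_left_mono[OF m e_nonneg] eT by linarith
    then have "(144 * C * K\<^sup>2 * (2 * M)\<^sup>2 * cubic_bound * (e * \<tau>\<^sup>2)) * (e * (real m * \<tau>))
        \<le> (144 * C * K\<^sup>2 * (2 * M)\<^sup>2 * cubic_bound * (e * \<tau>\<^sup>2)) * T"
      using C M0 G0 e_nonneg by (intro mult_left_mono) auto
    then show "e * (48 * (C * \<tau>\<^sup>2) * K\<^sup>2 * (2 * M) * (2 * M) * (2 * M)
     + (\<Sum>k<m. 144 * (C * \<tau>\<^sup>2) * K\<^sup>2 * (2 * M) * (2 * M) * (e * cubic_bound * \<tau>)))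
     \<le> (48 * C * K\<^sup>2 * (2 * M) ^ 3 + 144 * C * K\<^sup>2 * (2 * M)\<^sup>2 * cubic_bound * T) * (e * \<tau>\<^sup>2)"
      by (simp add: power3_eq_cube power2_eq_square algebra_simps)
  qed
  then have "l2b (\<lambda>l. \<i> * of_real e * (\<Sum>k<m. A (Suc k) (F k) l - A k (F k) l))
    ((48 * C * K\<^sup>2 * (2 * M) ^ 3 + 144 * C * K\<^sup>2 * (2 * M)\<^sup>2 * cubic_bound * T) * (e * \<tau>\<^sup>2))"
    by (simp only: tele)
  then show ?thesis by (simp only: A_def)
qed

text \<open>The defects are summed over the steps before any norm is taken, since only their sum is
  O(e \<tau>^2); the remaining stability term is then absorbed by Gronwall. Strong induction is used
  because the Lipschitz estimate at step k requires that the error there is already known to be at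
  most 1.\<close>

theorem splitting_error:
  assumes tau: "0 < \<tau>" and eT: "e * Te \<le> T" and C: "0 \<le> C"
    and n: "\<And>l. \<bar>l\<bar> \<le> 3 * n \<Longrightarrow> \<beta> l \<le> B"
    and quad: "\<And>\<theta> k. \<bar>\<theta>\<bar> \<le> 4 * B \<Longrightarrow> cmod (quad_err \<tau> k \<theta>) \<le> C * \<tau>\<^sup>2 * \<bar>\<theta>\<bar>"
    and tail: "\<And>t. 0 \<le> t \<Longrightarrow> t \<le> Te \<Longrightarrow> l2b (\<lambda>l. if \<bar>l\<bar> \<le> n then 0 else psi t l) \<eta>"
    and c0: "c 0 = psi 0"
    and cSuc: "\<And>k l. c (Suc k) l = lin \<tau> (c k) l + of_real (e * \<tau>) *
      lin (\<tau> / 2) (\<lambda>l. \<i> * (of_real (1 / \<beta> l) * conv3 (rp (lin (\<tau> / 2) (c k))) l)) l"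
    and small: "defect_const T C * (e * \<tau>\<^sup>2 + \<eta>) * exp (growth_const * T) \<le> 1"
    and m: "real m * \<tau> \<le> Te"
  shows "h1b (\<lambda>l. psi (real m * \<tau>) l - c m l) (defect_const T C * (e * \<tau>\<^sup>2 + \<eta>) * exp (growth_const * T))"
proof -
  define R where "R = 2 * M"
  define G where "G = cubic_bound"
  define d where "d k = lin (- (real k * \<tau>)) (c k)" for k
  define y where "y k l = of_real (\<beta> l) * (phi (real k * \<tau>) l - d k l)" for k l
  define F where "F k = amp n (phi (real k * \<tau>))" for k
  define mid where "mid k = (real k + 1 / 2) * \<tau>" for k
  define A where "A = defect_const T C * (e * \<tau>\<^sup>2 + \<eta>)"
  define L where "L = growth_const"
  have Te0: "0 \<le> Te" by (rule order_trans[OF _ m]) (use tau in simp)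
  have M0: "0 \<le> M" using l2b_nonneg[OF bound_V[of 0]] Te0 by simp
  have G0: "0 \<le> G" using M0 by (simp add: G_def cubic_bound_def)
  have eta0: "0 \<le> \<eta>" using l2b_nonneg[OF tail[of 0]] Te0 by simp
  have T0: "0 \<le> T" using eT Te0 e_nonneg by (meson mult_nonneg_nonneg order_trans)
  have L0: "0 \<le> L" by (simp add: L_def growth_const_def)
  have A0: "0 \<le> A" unfolding A_def defect_const_def using C M0 G0[unfolded G_def] T0 eta0 e_nonneg
    by (intro mult_nonneg_nonneg add_nonneg_nonneg) auto
  \<comment> \<open>In the rotated variable the scheme is exactly the midpoint rule: a half step of
    the linear flow before and after the nonlinearity places its phase at
    \<open>mid k\<close>.\<close>
  have dSuc: "of_real (\<beta> l) * (d (Suc k) l - d k l) = \<i> * of_real (e * \<tau>) * nl (mid k) (d k) l" for k l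
  proof -
    have E: "exp (- (\<i> * of_real (real (Suc k) * \<tau> * \<beta> l))) * (exp (\<i> * of_real (\<tau> / 2 * \<beta> l)))
        = exp (\<i> * of_real (- mid k * \<beta> l))"
      unfolding exp_add[symmetric] mid_def by (rule arg_cong[where f = exp]) (simp add: field_simps)
    have "lin (mid k) (d k) = lin (\<tau> / 2) (c k)"
      unfolding d_def lin_lin mid_def by (simp add: algebra_simps)
    then have nl: "nl (mid k) (d k) l = exp (\<i> * of_real (- mid k * \<beta> l)) * conv3 (rp (lin (\<tau> / 2) (c k))) l"
      by (simp add: nl_def lin_def)
    have "d (Suc k) l = lin (- (real (Suc k) * \<tau>)) (lin \<tau> (c k)) l + exp (- (\<i> * of_real (real (Suc k) * \<tau> * \<beta> l))) *
        (of_real (e * \<tau>) * (exp (\<i> * of_real (\<tau> / 2 * \<beta> l)) * (\<i> * (of_real (1 / \<beta> l) * conv3 (rp (lin (\<tau> / 2) (c k))) l))))"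
      unfolding d_def by (simp add: lin_def cSuc distrib_left)
    also have "lin (- (real (Suc k) * \<tau>)) (lin \<tau> (c k)) l = d k l"
      unfolding lin_lin d_def by (simp add: algebra_simps)
    finally have "d (Suc k) l - d k l = (exp (- (\<i> * of_real (real (Suc k) * \<tau> * \<beta> l))) * (exp (\<i> * of_real (\<tau> / 2 * \<beta> l)))) *
        (of_real (e * \<tau>) * (\<i> * (of_real (1 / \<beta> l) * conv3 (rp (lin (\<tau> / 2) (c k))) l)))"
      by simp
    then show ?thesis unfolding E nl by simp
  qed
  define r where "r k l = of_real (\<beta> l) * (phi (real k * \<tau> + \<tau>) l - phi (real k * \<tau>) l)
      - \<i> * of_real e * (trilin n (osc (real k * \<tau> + \<tau>)) (F k) (F k) (F k) l - trilin n (osc (real k * \<tau>)) (F k) (F k) (F k) l)" for k l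
  define p where "p k l = \<i> * of_real (e * \<tau>) * (nl (mid k) (trunc n (phi (real k * \<tau>))) l - nl (mid k) (phi (real k * \<tau>)) l)" for k l
  define s where "s k l = \<i> * of_real (e * \<tau>) * (nl (mid k) (phi (real k * \<tau>)) l - nl (mid k) (d k) l)" for k l
  define q where "q k l = trilin n (quad_err \<tau> (Suc k)) (F k) (F k) (F k) l - trilin n (quad_err \<tau> k) (F k) (F k) (F k) l" for k l
  have q: "q k l = trilin n (osc (real k * \<tau> + \<tau>)) (F k) (F k) (F k) l - trilin n (osc (real k * \<tau>)) (F k) (F k) (F k) l
      - of_real \<tau> * nl (mid k) (trunc n (phi (real k * \<tau>))) l" for k l
  proof -
    have "q k l = trilin n (\<lambda>\<theta>. (osc (real k * \<tau> + \<tau>) \<theta> - osc (real k * \<tau>) \<theta>)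
        - of_real \<tau> * exp (\<i> * of_real (mid k * \<theta>))) (F k) (F k) (F k) l"
      unfolding q_def trilin_diff_kernel[symmetric]
      by (simp add: quad_err_def mid_def algebra_simps)
    then show ?thesis
      unfolding trilin_diff_kernel trilin_scale_kernel nl_trunc F_def[symmetric] by simp
  qed
  have ySuc: "y (Suc k) l - y k l = \<i> * of_real e * q k l + (r k l + p k l) + s k l" for k l
  proof -
    have "y (Suc k) l - y k l = of_real (\<beta> l) * (phi (real k * \<tau> + \<tau>) l - phi (real k * \<tau>) l)
        - of_real (\<beta> l) * (d (Suc k) l - d k l)"
      by (simp add: y_def algebra_simps)
    then show ?thesis unfolding dSuc q r_def p_def s_def by (simp add: algebra_simps)
  qed
  have y0: "y 0 l = 0" for l
    by (simp add: y_def d_def c0 phi_def)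
  have ysum: "y j l = \<i> * of_real e * (\<Sum>k<j. q k l) + (\<Sum>k<j. r k l + p k l) + (\<Sum>k<j. s k l)" for j l
  proof -
    have "y j l = (\<Sum>k<j. y (Suc k) l - y k l)" using sum_lessThan_telescope[of "\<lambda>k. y k l" j] y0 by simp
    then show ?thesis by (simp add: ySuc sum.distrib sum_distrib_left)
  qed
  have kT: "real k * \<tau> \<le> Te" if "k \<le> m" for k
    using that m tau by (meson mult_right_mono of_nat_mono order_trans less_imp_le)
  have tl: "l2b (\<lambda>l. phi t l - trunc n (phi t) l) \<eta>" if "0 \<le> t" "t \<le> Te" for t
    by (rule l2b_dominated[OF tail[OF that]]) (simp add: trunc_def phi_def)
  have rb: "l2b (r k) (3 * (K * R)\<^sup>2 * e * \<tau> * (e * \<tau>\<^sup>2 * G + \<eta>))" if "k < m" for k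
    unfolding r_def F_def R_def G_def
    using kT[of "Suc k"] kT[of k] that tau by (intro step_error tl) (auto simp: algebra_simps)
  have pb: "l2b (p k) (e * \<tau> * (3 * (K * R)\<^sup>2 * \<eta>))" if "k < m" for k
  proof -
    have kk: "0 \<le> real k * \<tau>" "real k * \<tau> \<le> Te" using kT[of k] that tau by auto
    have "h1b (phi (real k * \<tau>)) R" unfolding R_def by (rule bound_phi[OF kk])
    moreover have "h1b (trunc n (phi (real k * \<tau>))) R"
      by (rule h1b_dominated[OF calculation]) (simp add: trunc_def)
    moreover have "l2b (\<lambda>l. trunc n (phi (real k * \<tau>)) l - phi (real k * \<tau>) l) \<eta>"
      using l2b_uminus[OF tl[OF kk]] by simp
    ultimately have "l2b (\<lambda>l. nl (mid k) (trunc n (phi (real k * \<tau>))) l - nl (mid k) (phi (real k * \<tau>)) l) (3 * (K * R)\<^sup>2 * \<eta>)"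
      by (intro nl_lipschitz)
    then show ?thesis unfolding p_def
      by (rule l2b_scale) (use e_nonneg tau in \<open>auto simp: norm_mult abs_mult\<close>)
  qed
  \<comment> \<open>Everything except the stability terms s, bounded by one constant A for all j at
    once; Gronwall can then start from A instead of from a defect per step.\<close>
  have main: "l2b (\<lambda>l. \<i> * of_real e * (\<Sum>k<j. q k l) + (\<Sum>k<j. r k l + p k l)) A" if j: "j \<le> m" for j
  proof -
    have "l2b (\<lambda>l. \<i> * of_real e * (\<Sum>k<j. q k l) + (\<Sum>k<j. r k l + p k l))
      ((48 * C * K\<^sup>2 * (2 * M) ^ 3 + 144 * C * K\<^sup>2 * (2 * M)\<^sup>2 * cubic_bound * T) * (e * \<tau>\<^sup>2)
       + (\<Sum>k<j. 3 * (K * R)\<^sup>2 * e * \<tau> * (e * \<tau>\<^sup>2 * G + \<eta>) + e * \<tau> * (3 * (K * R)\<^sup>2 * \<eta>)))"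
      unfolding q_def F_def using j
      by (intro l2b_add accumulated_quadrature[where B = B] l2b_sum rb pb kT tau eT C n quad) auto
    then show ?thesis
    proof (rule l2b_mono)
      have "e * (real j * \<tau>) \<le> T" using mult_left_mono[OF kT[OF j] e_nonneg] eT by linarith
      then have "(3 * (K * R)\<^sup>2 * (e * \<tau>\<^sup>2 * G + 2 * \<eta>)) * (e * (real j * \<tau>)) \<le> (3 * (K * R)\<^sup>2 * (e * \<tau>\<^sup>2 * G + 2 * \<eta>)) * T"
        using e_nonneg G0 eta0 by (intro mult_left_mono) auto
      then have *: "(\<Sum>k<j. 3 * (K * R)\<^sup>2 * e * \<tau> * (e * \<tau>\<^sup>2 * G + \<eta>) + e * \<tau> * (3 * (K * R)\<^sup>2 * \<eta>))
         \<le> 3 * (K * R)\<^sup>2 * (e * \<tau>\<^sup>2 * G + 2 * \<eta>) * T"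
        by (simp add: algebra_simps)
      \<comment> \<open>The cross terms by which the product of \<open>defect_const T C\<close> and
        e \<tau>^2 + \<eta> exceeds the sum of the separate bounds.\<close>
      have **: "0 \<le> (48 * C * K\<^sup>2 * (2 * M) ^ 3 + 144 * C * K\<^sup>2 * (2 * M)\<^sup>2 * cubic_bound * T + 3 * (K * R)\<^sup>2 * G * T) * \<eta>"
        "0 \<le> 6 * (K * R)\<^sup>2 * T * (e * \<tau>\<^sup>2)"
        using C M0 G0 T0 eta0 e_nonneg by (auto simp: G_def)
      show "(48 * C * K\<^sup>2 * (2 * M) ^ 3 + 144 * C * K\<^sup>2 * (2 * M)\<^sup>2 * cubic_bound * T) * (e * \<tau>\<^sup>2)
       + (\<Sum>k<j. 3 * (K * R)\<^sup>2 * e * \<tau> * (e * \<tau>\<^sup>2 * G + \<eta>) + e * \<tau> * (3 * (K * R)\<^sup>2 * \<eta>)) \<le> A"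
        using * ** unfolding A_def defect_const_def R_def G_def by (simp add: algebra_simps)
    qed
  qed
  have gr: "A * (1 + e * \<tau> * L) ^ k \<le> A * exp (L * T)" if "k \<le> m" for k
  proof -
    have "(1 + e * \<tau> * L) ^ k \<le> exp (e * \<tau> * L) ^ k"
      using e_nonneg tau L0 by (intro power_mono exp_ge_add_one_self) (auto intro: add_nonneg_nonneg)
    also have "\<dots> = exp (L * (e * (real k * \<tau>)))" by (simp add: exp_of_nat_mult[symmetric] mult_ac)
    also have "e * (real k * \<tau>) \<le> T" using mult_left_mono[OF kT[OF that] e_nonneg] eT by linarith
    then have "exp (L * (e * (real k * \<tau>))) \<le> exp (L * T)" using L0 by (simp add: mult_left_mono)
    finally show ?thesis using A0 by (rule mult_left_mono)
  qed
  have "l2b (y j) (A * (1 + e * \<tau> * L) ^ j)" if "j \<le> m" for j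
    using that
  proof (induction j rule: less_induct)
    case (less j)
    have sb: "l2b (s k) (e * \<tau> * (L * (A * (1 + e * \<tau> * L) ^ k)))" if k: "k < j" for k
    proof -
      have kk: "0 \<le> real k * \<tau>" "real k * \<tau> \<le> Te" using kT[of k] k less.prems tau by auto
      have yk: "h1b (\<lambda>l. phi (real k * \<tau>) l - d k l) (A * (1 + e * \<tau> * L) ^ k)"
        using less.IH[OF k] k less.prems unfolding h1b_def y_def by simp
      have y1: "A * (1 + e * \<tau> * L) ^ k \<le> 1"
        using gr[of k] small k less.prems unfolding A_def L_def by linarith
      \<comment> \<open>Exact and numerical coefficients lie in the same ball: the latter differ
        from the former by at most 1 in H^1, by the induction hypothesis and
        \<open>small\<close>.\<close>
      have "h1b (phi (real k * \<tau>)) (R + 1)"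
        unfolding R_def by (rule h1b_mono[OF bound_phi[OF kk]]) simp
      moreover have "h1b (d k) (R + 1)"
        using h1b_diff[OF bound_phi[OF kk] h1b_mono[OF yk y1]] by (simp add: R_def)
      ultimately have "l2b (\<lambda>l. nl (mid k) (phi (real k * \<tau>)) l - nl (mid k) (d k) l)
          (3 * (K * (R + 1))\<^sup>2 * (A * (1 + e * \<tau> * L) ^ k))"
        by (intro nl_lipschitz h1b_l2b yk)
      then show ?thesis unfolding s_def L_def growth_const_def R_def
        by (rule l2b_scale) (use e_nonneg tau in \<open>auto simp: norm_mult abs_mult\<close>)
    qed
    have "l2b (y j) (A + (\<Sum>k<j. e * \<tau> * (L * (A * (1 + e * \<tau> * L) ^ k))))"
      unfolding ysum[abs_def] by (intro l2b_add main l2b_sum sb less.prems) auto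
    \<comment> \<open>The geometric sequence solves the Gronwall recursion with equality, so the
      induction reproduces its own bound.\<close>
    moreover have "A + (\<Sum>k<i. e * \<tau> * (L * (A * (1 + e * \<tau> * L) ^ k))) = A * (1 + e * \<tau> * L) ^ i" for i
      by (induction i) (auto simp: algebra_simps)
    ultimately show ?case by simp
  qed
  then have "l2b (y m) (A * exp (L * T))" using gr[of m] l2b_mono by blast
  then show ?thesis
    unfolding h1b_def A_def L_def
    by (rule l2b_dominated)
      (simp add: y_def d_def phi_def lin_diff[symmetric] norm_mult)
qed

end

section \<open>Fourier series on an interval\<close>

lemma square_integrable_cong:
  assumes "\<And>x. x \<in> {a..b} \<Longrightarrow> f x = g x"
  shows "square_integrable a b f \<longleftrightarrow> square_integrable a b g"
proof -
  have "(\<lambda>x. indicator {a..b} x *\<^sub>R f x) = (\<lambda>x. indicator {a..b} x *\<^sub>R g x)"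
    "(\<lambda>x. indicator {a..b} x *\<^sub>R (norm (f x))\<^sup>2) = (\<lambda>x. indicator {a..b} x *\<^sub>R (norm (g x))\<^sup>2)"
    using assms by (auto simp: indicator_def fun_eq_iff)
  then show ?thesis
    by (simp add: square_integrable_def set_borel_measurable_def set_integrable_def)
qed

lemma square_integrable_of_real:
  assumes "square_integrable a b (f :: real \<Rightarrow> real)"
  shows "square_integrable a b (\<lambda>x. complex_of_real (f x))"
proof -
  have "(\<lambda>x. complex_of_real (indicator {a..b} x *\<^sub>R f x)) \<in> borel_measurable lebesgue"
    by (rule measurable_compose[OF _ borel_measurable_of_real])
      (use assms in \<open>simp add: square_integrable_def set_borel_measurable_def\<close>)
  then show ?thesis using assms
    by (simp add: square_integrable_def set_borel_measurable_def scaleR_conv_of_real)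
qed

lemma square_integrable_bounded_by:
  fixes f :: "real \<Rightarrow> complex" and g :: "real \<Rightarrow> real"
  assumes "set_borel_measurable lebesgue {a..b} f"
    and "set_integrable lebesgue {a..b} g"
    and "\<And>x. x \<in> {a..b} \<Longrightarrow> (cmod (f x))\<^sup>2 \<le> g x"
  shows "square_integrable a b f"
  unfolding square_integrable_def
proof
  have "set_borel_measurable lebesgue {a..b} (\<lambda>x. (norm (f x))\<^sup>2)"
  proof -
    have "(\<lambda>x. (norm (indicator {a..b} x *\<^sub>R f x))\<^sup>2) \<in> borel_measurable lebesgue"
      using assms(1) unfolding set_borel_measurable_def by measurable
    also have "(\<lambda>x. (norm (indicator {a..b} x *\<^sub>R f x))\<^sup>2) = (\<lambda>x. indicator {a..b} x *\<^sub>R (norm (f x))\<^sup>2)"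
      by (auto simp: indicator_def)
    finally show ?thesis by (simp add: set_borel_measurable_def)
  qed
  then show "set_integrable lebesgue {a..b} (\<lambda>x. (norm (f x))\<^sup>2)"
    by (rule set_integrable_bound[OF assms(2)]) (use assms(3) in \<open>force intro!: AE_I2\<close>)
qed (fact assms(1))

lemma square_integrable_add:
  fixes f g :: "real \<Rightarrow> complex"
  assumes "square_integrable a b f" "square_integrable a b g"
  shows "square_integrable a b (\<lambda>x. f x + g x)"
proof (rule square_integrable_bounded_by)
  show "set_borel_measurable lebesgue {a..b} (\<lambda>x. f x + g x)"
    using assms unfolding square_integrable_def set_borel_measurable_def scaleR_add_right
    by (intro borel_measurable_add) auto
  show "set_integrable lebesgue {a..b} (\<lambda>x. 2 * (norm (f x))\<^sup>2 + 2 * (norm (g x))\<^sup>2)"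
    using assms unfolding square_integrable_def by (intro set_integral_add) auto
  show "(cmod (f x + g x))\<^sup>2 \<le> 2 * (norm (f x))\<^sup>2 + 2 * (norm (g x))\<^sup>2" for x
  proof -
    have "(cmod (f x + g x))\<^sup>2 \<le> (cmod (f x) + cmod (g x))\<^sup>2" by (intro power_mono norm_triangle_ineq) auto
    also have "\<dots> \<le> 2 * (norm (f x))\<^sup>2 + 2 * (norm (g x))\<^sup>2"
      using zero_le_power2[of "cmod (f x) - cmod (g x)"] by (simp add: power2_eq_square algebra_simps)
    finally show ?thesis .
  qed
qed

lemma set_measurable_continuous:
  "continuous_on {a..b} (f :: real \<Rightarrow> complex) \<Longrightarrow> set_borel_measurable lebesgue {a..b} f"
  using absolutely_integrable_continuous_real[of a b f]
  by (auto simp: set_integrable_def set_borel_measurable_def)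

lemma square_integrable_continuous:
  "continuous_on {a..b} (f :: real \<Rightarrow> complex) \<Longrightarrow> square_integrable a b f"
  by (rule square_integrable_bounded_by[where g = "\<lambda>x. (cmod (f x))\<^sup>2"])
    (auto intro!: set_measurable_continuous absolutely_integrable_continuous_real continuous_intros)

lemma set_measurable_mult:
  fixes f g :: "real \<Rightarrow> complex"
  assumes "set_borel_measurable M A f" "set_borel_measurable M A g"
  shows "set_borel_measurable M A (\<lambda>x. f x * g x)"
proof -
  have "(\<lambda>x. (indicator A x *\<^sub>R f x) * (indicator A x *\<^sub>R g x)) \<in> borel_measurable M"
    using assms unfolding set_borel_measurable_def by (intro borel_measurable_times)
  also have "(\<lambda>x. (indicator A x *\<^sub>R f x) * (indicator A x *\<^sub>R g x)) = (\<lambda>x. indicator A x *\<^sub>R (f x * g x))"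
    by (auto simp: indicator_def)
  finally show ?thesis by (simp add: set_borel_measurable_def)
qed

lemma square_integrable_mult_continuous:
  fixes f :: "real \<Rightarrow> complex"
  assumes "square_integrable a b f" "continuous_on {a..b} g"
  shows "square_integrable a b (\<lambda>x. g x * f x)"
proof -
  have "bounded (g ` {a..b})" by (intro compact_imp_bounded compact_continuous_image assms) simp
  then obtain C where "\<forall>y\<in>g ` {a..b}. cmod y \<le> C" unfolding bounded_iff by blast
  then have C: "cmod (g x) \<le> C" if "x \<in> {a..b}" for x using that by blast
  show ?thesis
  proof (rule square_integrable_bounded_by[where g = "\<lambda>x. C\<^sup>2 * (norm (f x))\<^sup>2"])
    show "set_borel_measurable lebesgue {a..b} (\<lambda>x. g x * f x)"
      using assms(1) by (intro set_measurable_mult[OF set_measurable_continuous[OF assms(2)]]) (simp add: square_integrable_def)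
    show "set_integrable lebesgue {a..b} (\<lambda>x. C\<^sup>2 * (norm (f x))\<^sup>2)"
      using assms by (auto simp: square_integrable_def)
    fix x assume x: "x \<in> {a..b}"
    have "(cmod (g x))\<^sup>2 \<le> C\<^sup>2" using C[OF x] by (intro power_mono) auto
    then show "(cmod (g x * f x))\<^sup>2 \<le> C\<^sup>2 * (cmod (f x))\<^sup>2"
      by (simp add: norm_mult power_mult_distrib mult_right_mono)
  qed
qed

lemma square_integrable_diff:
  fixes f g :: "real \<Rightarrow> complex"
  assumes "square_integrable a b f" "square_integrable a b g"
  shows "square_integrable a b (\<lambda>x. f x - g x)"
  using square_integrable_add[OF assms(1) square_integrable_mult_continuous[OF assms(2), of "\<lambda>_. - 1"]] by simp

lemma square_integrable_cnj:
  assumes "square_integrable a b f"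
  shows "square_integrable a b (\<lambda>x. cnj (f x))"
proof -
  have "(\<lambda>x. cnj (indicator {a..b} x *\<^sub>R f x)) \<in> borel_measurable lebesgue"
    by (rule measurable_compose[OF _ borel_measurable_continuous_onI])
      (use assms in \<open>auto simp: square_integrable_def set_borel_measurable_def intro: continuous_intros\<close>)
  then show ?thesis using assms
    by (simp add: square_integrable_def set_borel_measurable_def)
qed

lemma square_integrable_integrable:
  fixes f :: "real \<Rightarrow> complex"
  assumes "square_integrable a b f"
  shows "set_integrable lebesgue {a..b} f"
proof (rule set_integrable_bound)
  have "set_integrable lebesgue {a..b} (\<lambda>x. 1 :: real)"
    by (intro absolutely_integrable_continuous_real continuous_intros)
  then show "set_integrable lebesgue {a..b} (\<lambda>x. 1 + (norm (f x))\<^sup>2)"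
    using assms unfolding square_integrable_def by (intro set_integral_add) auto
  show "set_borel_measurable lebesgue {a..b} f" using assms by (simp add: square_integrable_def)
  have "y \<le> 1 + y\<^sup>2" for y :: real
    using zero_le_power2[of "y - 1/2"] by (simp add: power2_eq_square algebra_simps)
  then show "AE x in lebesgue. x \<in> {a..b} \<longrightarrow> norm (f x) \<le> norm (1 + (norm (f x))\<^sup>2)"
    by (intro AE_I2) (auto simp: abs_of_nonneg)
qed

section \<open>Characters, Bessel's inequality and absolutely convergent Fourier series\<close>

locale interval =
  fixes a b :: real
  assumes ab: "a < b"
begin

definition ew :: "int \<Rightarrow> real \<Rightarrow> complex" where
  "ew l x = exp (\<i> * of_real (mu a b l * (x - a)))"

abbreviation "sqi \<equiv> square_integrable a b :: (real \<Rightarrow> complex) \<Rightarrow> bool"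

abbreviation "fc \<equiv> fcoeff a b"

definition fser :: "(int \<Rightarrow> complex) \<Rightarrow> real \<Rightarrow> complex" where
  "fser c x = (\<Sum>\<^sub>\<infinity>l. c l * ew l x)"

lemma mu_add: "mu a b (j + k) = mu a b j + mu a b k"
  by (simp add: mu_def distrib_left add_divide_distrib)

lemma mu_minus: "mu a b (- j) = - mu a b j"
  by (simp add: mu_def)

lemma mu_0 [simp]: "mu a b 0 = 0" by (simp add: mu_def)

lemma ew_add: "ew (j + k) x = ew j x * ew k x"
  by (simp add: ew_def mu_add exp_add[symmetric] algebra_simps)

lemma ew_0 [simp]: "ew 0 x = 1" by (simp add: ew_def)

lemma cnj_ew: "cnj (ew l x) = ew (- l) x"
  by (simp add: ew_def mu_minus exp_cnj)

lemma norm_ew [simp]: "cmod (ew l x) = 1" by (simp add: ew_def)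

lemma continuous_ew [continuous_intros]: "continuous_on S (ew l)"
  unfolding ew_def by (intro continuous_intros)

lemma ew_a [simp]: "ew l a = 1" by (simp add: ew_def)

lemma ew_b [simp]: "ew l b = 1"
proof -
  have "mu a b l * (b - a) = 2 * pi * of_int l" using ab by (simp add: mu_def)
  then have "ew l b = exp ((2 * of_int l * of_real pi) * \<i>)" by (simp add: ew_def mult_ac)
  then show ?thesis using exp_integer_2pi[of "of_int l"] by simp
qed

lemma ew_deriv: "(ew l has_vector_derivative \<i> * of_real (mu a b l) * ew l x) (at x within S)"
proof -
  have "((\<lambda>x. exp (of_real (x - a) * (\<i> * of_real (mu a b l)))) has_vector_derivative
      (of_real 1 * (\<i> * of_real (mu a b l))) * exp (of_real (x - a) * (\<i> * of_real (mu a b l)))) (at x within S)"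
    by (intro field_vector_diff_chain_within[unfolded o_def] has_vector_derivative_mult_left
        has_vector_derivative_of_real) (auto intro!: derivative_eq_intros)
  then show ?thesis by (simp add: ew_def[abs_def] mult_ac)
qed

lemma fc_eq: "fc f l = (LINT x:{a..b}|lebesgue. f x * ew (- l) x) / of_real (b - a)"
  by (simp add: fcoeff_def ew_def mu_minus)

lemma fc_cong: "(\<And>x. x \<in> {a..b} \<Longrightarrow> f x = g x) \<Longrightarrow> fc f l = fc g l"
  unfolding fc_eq by (subst set_lebesgue_integral_cong[of _ lebesgue _ "\<lambda>x. g x * ew (- l) x"]) auto

lemma sqi_mult_ew: "sqi f \<Longrightarrow> sqi (\<lambda>x. f x * ew l x)"
  using square_integrable_mult_continuous[of a b f "ew l"] by (simp add: continuous_intros mult.commute)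

lemma fc_add: "sqi f \<Longrightarrow> sqi g \<Longrightarrow> fc (\<lambda>x. f x + g x) l = fc f l + fc g l"
  unfolding fc_eq distrib_right
  by (subst set_integral_add) (auto intro!: square_integrable_integrable sqi_mult_ew simp: add_divide_distrib)

lemma fc_diff: "sqi f \<Longrightarrow> sqi g \<Longrightarrow> fc (\<lambda>x. f x - g x) l = fc f l - fc g l"
  unfolding fc_eq left_diff_distrib
  by (subst set_integral_diff) (auto intro!: square_integrable_integrable sqi_mult_ew simp: diff_divide_distrib)

lemma fc_cmult: "fc (\<lambda>x. c * f x) l = c * fc f l"
  unfolding fc_eq mult.assoc by simp

lemma fc_cnj: "fc (\<lambda>x. cnj (f x)) l = cnj (fc f (- l))"
proof -
  have "(LINT x:{a..b}|lebesgue. cnj (f x) * ew (- l) x) = cnj (LINT x:{a..b}|lebesgue. f x * ew l x)"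
    unfolding set_lebesgue_integral_def
    by (subst Bochner_Integration.integral_cnj[symmetric]) (simp add: cnj_ew)
  then show ?thesis by (simp add: fc_eq)
qed

lemma sqi_sum: "finite A \<Longrightarrow> (\<And>k. k \<in> A \<Longrightarrow> sqi (f k)) \<Longrightarrow> sqi (\<lambda>x. \<Sum>k\<in>A. f k x)"
  by (induction A rule: finite_induct) (simp_all add: square_integrable_add square_integrable_continuous)

lemma fc_sum: "finite A \<Longrightarrow> (\<And>k. k \<in> A \<Longrightarrow> sqi (f k)) \<Longrightarrow> fc (\<lambda>x. \<Sum>k\<in>A. f k x) l = (\<Sum>k\<in>A. fc (f k) l)"
  by (induction A rule: finite_induct) (auto simp: fc_add sqi_sum fc_eq[of "\<lambda>x. 0"])

lemma fc_shift: "fc (\<lambda>x. f x * ew k x) l = fc f (l - k)"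
  unfolding fc_eq using ew_add[of k "- l"] by (simp add: mult.assoc)

lemma fc_1: "fc (\<lambda>x. 1) l = (if l = 0 then 1 else 0)"
proof (cases "l = 0")
  case True
  have "(LINT x:{a..b}|lebesgue. (1::complex)) = of_real (b - a)"
    using ab by (subst set_integral_const) (auto simp: scaleR_conv_of_real)
  then show ?thesis using True ab by (simp add: fc_eq)
next
  case False
  define m where "m = \<i> * complex_of_real (mu a b (- l))"
  have m0: "m \<noteq> 0" using False ab by (simp add: m_def mu_def)
  have "((\<lambda>x. m * ew (- l) x) has_integral (ew (- l) b - ew (- l) a)) {a..b}"
    using ab by (intro fundamental_theorem_of_calculus) (auto simp: m_def intro: ew_deriv)
  then have "integral {a..b} (\<lambda>x. m * ew (- l) x) = ew (- l) b - ew (- l) a" by (rule integral_unique)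
  moreover have "(LINT x:{a..b}|lebesgue. m * ew (- l) x) = integral {a..b} (\<lambda>x. m * ew (- l) x)"
    by (intro set_lebesgue_integral_eq_integral square_integrable_integrable square_integrable_continuous continuous_intros)
  ultimately have "(LINT x:{a..b}|lebesgue. m * ew (- l) x) = 0" by (simp only: ew_a ew_b diff_self)
  then show ?thesis using m0 False by (simp add: fc_eq)
qed

lemma fc_ew: "fc (ew k) l = (if l = k then 1 else 0)"
  using fc_shift[of "\<lambda>x. 1" k l] by (simp add: fc_1)

text \<open>Expands 0 \<le> |f - S|^2 for the partial sum S. Integrals are read off as coefficients
  of index 0, which reduces orthogonality to \<open>fc_ew\<close>.\<close>

lemma Bessel_inequality:
  assumes f: "sqi f" and A: "finite A"
  shows "(b - a) * (\<Sum>l\<in>A. (cmod (fc f l))\<^sup>2) \<le> (LINT x:{a..b}|lebesgue. (cmod (f x))\<^sup>2)"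
proof -
  define S where "S x = (\<Sum>l\<in>A. fc f l * ew l x)" for x
  define s where "s = (\<Sum>l\<in>A. (cmod (fc f l))\<^sup>2)"
  have contS: "continuous_on {a..b} S" unfolding S_def by (intro continuous_intros)
  have sS: "sqi S" by (intro square_integrable_continuous contS)
  have cS: "cnj (S x) = (\<Sum>l\<in>A. cnj (fc f l) * ew (- l) x)" for x
    by (simp add: S_def cnj_ew)
  have sg: "sqi (\<lambda>x. g x * cnj (S x))" if "sqi g" for g
    using square_integrable_mult_continuous[OF that, of "\<lambda>x. cnj (S x)"] contS
    by (simp add: continuous_intros mult.commute)
  have fcS: "fc (\<lambda>x. g x * cnj (S x)) 0 = (\<Sum>l\<in>A. cnj (fc f l) * fc g l)" if "sqi g" for g
  proof -
    have "fc (\<lambda>x. g x * cnj (S x)) 0 = fc (\<lambda>x. \<Sum>l\<in>A. cnj (fc f l) * (g x * ew (- l) x)) 0"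
      by (simp add: cS sum_distrib_left mult_ac)
    also have "\<dots> = (\<Sum>l\<in>A. cnj (fc f l) * fc g l)"
      by (subst fc_sum) (auto simp: A fc_cmult fc_shift
          intro!: square_integrable_mult_continuous[where g = "\<lambda>_. _"] sqi_mult_ew that)
    finally show ?thesis .
  qed
  have cn: "cnj z * z = of_real ((cmod z)\<^sup>2)" for z by (metis complex_norm_square mult.commute of_real_power)
  have 1: "fc (\<lambda>x. f x * cnj (S x)) 0 = of_real s"
    unfolding fcS[OF f] s_def by (simp add: cn)
  have fS: "fc S l = fc f l" if "l \<in> A" for l
  proof -
    have "fc S l = (\<Sum>k\<in>A. fc f k * (if l = k then 1 else 0))"
      unfolding S_def by (subst fc_sum) (auto simp: A fc_cmult fc_ew intro!: square_integrable_continuous continuous_intros)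
    then show ?thesis using that A by (simp add: if_distrib cong: if_cong)
  qed
  have 2: "fc (\<lambda>x. S x * cnj (S x)) 0 = of_real s"
    unfolding fcS[OF sS] s_def using fS by (simp add: cn)
  \<comment> \<open>D is |f|^2 - |f - S|^2 written with conjugates, hence real and at most |f|^2;
    its mean is s + s - s.\<close>
  define D where "D x = f x * cnj (S x) + cnj (f x * cnj (S x)) - S x * cnj (S x)" for x
  have sD: "sqi D" unfolding D_def
    by (intro square_integrable_diff square_integrable_add square_integrable_cnj sg f sS)
  have "fc D 0 = of_real s"
    unfolding D_def
    by (subst fc_diff fc_add; (intro square_integrable_diff square_integrable_add square_integrable_cnj sg f sS)?)+
      (simp add: fc_cnj[of "\<lambda>x. f x * cnj (S x)", simplified] 1 2)
  then have intD: "(LINT x:{a..b}|lebesgue. D x) = of_real ((b - a) * s)"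
    using ab by (simp add: fc_eq field_simps)
  have Dre: "D x = of_real (Re (D x))" and Dle: "Re (D x) \<le> (cmod (f x))\<^sup>2" for x
  proof -
    have "cnj (D x) = D x" by (simp add: D_def algebra_simps)
    then show "D x = of_real (Re (D x))" by (metis complex_cnj_cancel_iff Reals_cnj_iff of_real_Re)
    have "of_real ((cmod (f x - S x))\<^sup>2) = of_real ((cmod (f x))\<^sup>2) - D x"
      unfolding D_def cn[symmetric] by (simp add: algebra_simps)
    then have "(cmod (f x - S x))\<^sup>2 = (cmod (f x))\<^sup>2 - Re (D x)"
      by (metis Re_complex_of_real minus_complex.sel(1))
    then show "Re (D x) \<le> (cmod (f x))\<^sup>2" using zero_le_power2[of "cmod (f x - S x)"] by linarith
  qed
  have "(b - a) * s = (LINT x:{a..b}|lebesgue. Re (D x))"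
  proof -
    have "(LINT x:{a..b}|lebesgue. D x) = of_real (LINT x:{a..b}|lebesgue. Re (D x))"
      by (subst Dre) (rule set_integral_complex_of_real)
    then show ?thesis unfolding intD by (simp only: of_real_eq_iff)
  qed
  also have "\<dots> \<le> (LINT x:{a..b}|lebesgue. (cmod (f x))\<^sup>2)"
  proof (rule set_integral_mono)
    show "set_integrable lebesgue {a..b} (\<lambda>x. Re (D x))"
      using integrable_Re[OF square_integrable_integrable[OF sD, unfolded set_integrable_def]]
      by (simp add: set_integrable_def)
    show "set_integrable lebesgue {a..b} (\<lambda>x. (cmod (f x))\<^sup>2)" using f by (simp add: square_integrable_def)
  qed (rule Dle)
  finally show ?thesis by (simp add: s_def)
qed

lemma fc_l2b: assumes f: "sqi f" shows "\<exists>B. l2b (fc f) B"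
proof -
  define I where "I = (LINT x:{a..b}|lebesgue. (cmod (f x))\<^sup>2)"
  have "L2_set (\<lambda>l. cmod (fc f l)) A \<le> sqrt (I / (b - a))" if "finite A" for A
    unfolding L2_set_def using Bessel_inequality[OF f that] ab
    by (intro real_sqrt_le_mono) (simp add: I_def field_simps)
  then show ?thesis unfolding l2b_def by blast
qed

lemma fser_uniform:
  assumes "l1b c B"
  shows "uniform_limit UNIV (\<lambda>A x. \<Sum>l\<in>A. c l * ew l x) (fser c) (finite_subsets_at_top UNIV)"
  unfolding fser_def[abs_def]
  by (rule Weierstrass_m_test_general[OF _ l1b_abs_summable[OF assms]]) (simp add: norm_mult)

lemma continuous_fser: assumes "l1b c B" shows "continuous_on S (fser c)"
proof (rule continuous_on_subset)
  show "continuous_on UNIV (fser c)"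
    by (rule uniform_limit_theorem[OF _ fser_uniform[OF assms]])
      (auto intro!: always_eventually continuous_intros)
qed simp

lemma sqi_fser: "l1b c B \<Longrightarrow> sqi (fser c)"
  by (intro square_integrable_continuous continuous_fser)

lemma fc_bound:
  assumes "sqi f" "\<And>x. x \<in> {a..b} \<Longrightarrow> cmod (f x) \<le> e"
  shows "cmod (fc f l) \<le> e"
proof -
  have "cmod (LINT x:{a..b}|lebesgue. f x * ew (- l) x) \<le> (LINT x:{a..b}|lebesgue. cmod (f x * ew (- l) x))"
    by (rule set_integral_norm_bound) (intro square_integrable_integrable sqi_mult_ew assms)
  also have "\<dots> \<le> (LINT x:{a..b}|lebesgue. e)"
  proof (rule set_integral_mono)
    show "set_integrable lebesgue {a..b} (\<lambda>x. cmod (f x * ew (- l) x))"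
      by (intro set_integrable_norm square_integrable_integrable sqi_mult_ew assms)
    show "set_integrable lebesgue {a..b} (\<lambda>x. e)"
      by (intro absolutely_integrable_continuous_real continuous_intros)
  qed (use assms(2) in \<open>simp add: norm_mult\<close>)
  also have "\<dots> = e * (b - a)" using ab by (simp add: set_lebesgue_integral_def)
  finally show ?thesis using ab unfolding fc_eq norm_divide norm_of_real by (simp add: divide_le_eq)
qed

text \<open>A partial sum that contains the index l has l-th coefficient exactly c l, and a
  coefficient is bounded by the supremum norm of the uniformly small remainder.\<close>

lemma fc_fser: assumes c: "l1b c B" shows "fc (fser c) l = c l"
proof -
  have "cmod (fc (fser c) l - c l) \<le> e" if e: "e > 0" for e
  proof -
    have "\<forall>\<^sub>F A in finite_subsets_at_top UNIV. \<forall>x\<in>UNIV. dist (\<Sum>l\<in>A. c l * ew l x) (fser c x) < e"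
      using uniform_limitD[OF fser_uniform[OF c] e] .
    moreover have "\<forall>\<^sub>F A in finite_subsets_at_top UNIV. finite A \<and> l \<in> A"
      by (auto simp: eventually_finite_subsets_at_top intro!: exI[of _ "{l}"])
    ultimately have "\<forall>\<^sub>F A in finite_subsets_at_top UNIV. (\<forall>x\<in>UNIV. dist (\<Sum>l\<in>A. c l * ew l x) (fser c x) < e) \<and> finite A \<and> l \<in> A"
      by (rule eventually_conj)
    then obtain A where A: "\<And>x. dist (\<Sum>l\<in>A. c l * ew l x) (fser c x) < e" "finite A" "l \<in> A"
      by (auto dest!: eventually_happens)
    define S where "S x = (\<Sum>l\<in>A. c l * ew l x)" for x
    have sS: "sqi S" unfolding S_def by (intro square_integrable_continuous continuous_intros)
    have "fc S l = (\<Sum>k\<in>A. c k * (if l = k then 1 else 0))"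
      unfolding S_def by (subst fc_sum) (auto simp: A fc_cmult fc_ew intro!: square_integrable_continuous continuous_intros)
    then have "fc S l = c l" using A by (simp add: if_distrib cong: if_cong)
    then have "fc (fser c) l - c l = fc (\<lambda>x. fser c x - S x) l"
      by (simp add: fc_diff[OF sqi_fser[OF c] sS])
    also have "cmod \<dots> \<le> e"
      by (rule fc_bound[OF square_integrable_diff[OF sqi_fser[OF c] sS]])
        (use A(1) in \<open>auto simp: S_def dist_norm norm_minus_commute intro: less_imp_le\<close>)
    finally show ?thesis .
  qed
  then have "cmod (fc (fser c) l - c l) \<le> 0" by (rule field_le_epsilon) simp
  then show ?thesis by simp
qed

lemma fser_summable: "l1b c B \<Longrightarrow> (\<lambda>l. c l * ew l x) summable_on UNIV"
  by (rule abs_summable_summable) (simp add: norm_mult l1b_abs_summable)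

lemma fser_cnj: "cnj (fser c x) = fser (\<lambda>l. cnj (c (- l))) x"
proof -
  have "cnj (fser c x) = (\<Sum>\<^sub>\<infinity>l. cnj (c l) * ew (- l) x)"
    unfolding fser_def infsum_cnj[symmetric] by (simp add: cnj_ew)
  also have "\<dots> = fser (\<lambda>l. cnj (c (- l))) x"
    unfolding fser_def by (rule infsum_reindex_bij_witness[of _ uminus uminus]) auto
  finally show ?thesis .
qed

lemma fser_cmult: "k * fser c x = fser (\<lambda>l. k * c l) x"
  unfolding fser_def mult.assoc by (rule infsum_cmult_right'[symmetric])

lemma fser_add: "l1b c B \<Longrightarrow> l1b d D \<Longrightarrow> fser c x + fser d x = fser (\<lambda>l. c l + d l) x"
  unfolding fser_def distrib_right by (rule infsum_add[symmetric]; rule fser_summable)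

text \<open>Cauchy product. Fubini requires absolute summability over the pairs (l, k); a finite set
  of pairs is enclosed in a box, on which the l^1 bounds apply in turn.\<close>

lemma fser_mult:
  assumes c: "l1b c B" and d: "l1b d D"
  shows "fser c x * fser d x = fser (conv c d) x"
proof -
  have "l1b (\<lambda>(l, k). c k * ew k x * (d (l - k) * ew (l - k) x)) (B * D)"
    unfolding l1b_def
  proof (intro allI impI)
    fix F :: "(int \<times> int) set" assume F: "finite F"
    define P where "P = fst ` F" define Q where "Q = snd ` F"
    have PQ: "finite P" "finite Q" "F \<subseteq> P \<times> Q" using F by (simp_all add: P_def Q_def subset_fst_snd)
    have "(\<Sum>p\<in>F. cmod (case p of (l, k) \<Rightarrow> c k * ew k x * (d (l - k) * ew (l - k) x)))
        \<le> (\<Sum>p\<in>P \<times> Q. cmod (case p of (l, k) \<Rightarrow> c k * ew k x * (d (l - k) * ew (l - k) x)))"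
      by (rule sum_mono2) (use PQ in auto)
    also have "\<dots> = (\<Sum>(l, k)\<in>P \<times> Q. cmod (c k) * cmod (d (l - k)))"
      by (rule sum.cong) (auto simp: norm_mult)
    also have "\<dots> = (\<Sum>l\<in>P. \<Sum>k\<in>Q. cmod (c k) * cmod (d (l - k)))"
      by (rule sum.cartesian_product[symmetric])
    also have "\<dots> = (\<Sum>k\<in>Q. \<Sum>l\<in>P. cmod (c k) * cmod (d (l - k)))"
      by (rule sum.swap)
    also have "\<dots> = (\<Sum>k\<in>Q. cmod (c k) * (\<Sum>l\<in>P. cmod (d (l - k))))"
      by (simp add: sum_distrib_left)
    also have "\<dots> \<le> (\<Sum>k\<in>Q. cmod (c k) * D)"
      by (intro sum_mono mult_left_mono l1bD[OF l1b_reindex[OF d]] PQ) (auto simp: inj_def)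
    also have "\<dots> \<le> B * D"
      unfolding sum_distrib_right[symmetric] by (intro mult_right_mono l1bD[OF c] PQ l1b_nonneg[OF d])
    finally show "(\<Sum>p\<in>F. cmod (case p of (l, k) \<Rightarrow> c k * ew k x * (d (l - k) * ew (l - k) x))) \<le> B * D" .
  qed
  from abs_summable_summable[OF l1b_abs_summable[OF this]]
  have sm: "(\<lambda>(l, k). c k * ew k x * (d (l - k) * ew (l - k) x)) summable_on (UNIV \<times> UNIV)"
    by (simp only: UNIV_Times_UNIV)
  have "fser (conv c d) x = (\<Sum>\<^sub>\<infinity>l. \<Sum>\<^sub>\<infinity>k. c k * ew k x * (d (l - k) * ew (l - k) x))"
    unfolding fser_def conv_def infsum_cmult_left'[symmetric]
  proof (intro infsum_cong)
    fix l k
    show "c k * d (l - k) * ew l x = c k * ew k x * (d (l - k) * ew (l - k) x)"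
      using ew_add[of k "l - k" x] by simp
  qed
  also have "\<dots> = (\<Sum>\<^sub>\<infinity>k. \<Sum>\<^sub>\<infinity>l. c k * ew k x * (d (l - k) * ew (l - k) x))"
    by (rule infsum_swap_banach[OF sm])
  also have "\<dots> = (\<Sum>\<^sub>\<infinity>k. c k * ew k x * fser d x)"
  proof (intro infsum_cong)
    fix k
    have "(\<Sum>\<^sub>\<infinity>l. d (l - k) * ew (l - k) x) = fser d x"
      unfolding fser_def by (rule infsum_reindex_bij_witness[of _ "\<lambda>l. l + k" "\<lambda>l. l - k"]) auto
    then show "(\<Sum>\<^sub>\<infinity>l. c k * ew k x * (d (l - k) * ew (l - k) x)) = c k * ew k x * fser d x"
      by (simp add: infsum_cmult_right')
  qed
  also have "\<dots> = fser c x * fser d x"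
    unfolding fser_def[of c] by (simp add: infsum_cmult_left')
  finally show ?thesis by simp
qed

lemma fser_cube: assumes c: "l1b c B" shows "fser c x ^ 3 = fser (conv3 c) x"
  unfolding conv3_def fser_mult[OF c young_l1[OF c c], symmetric] fser_mult[OF c c, symmetric]
    power3_eq_cube mult.assoc ..

end

section \<open>Pointwise inversion and Fourier coefficients of derivatives\<close>

context interval
begin

lemma set_measurable_inverse_ew_diff:
  "set_borel_measurable lebesgue {a..b} (\<lambda>x. inverse (ew l x - c))"
proof -
  have "(\<lambda>x. ew l x - c) \<in> borel_measurable borel"
    by (intro borel_measurable_continuous_onI continuous_intros)
  then have "(\<lambda>x. ew l x - c) \<in> borel_measurable lebesgue"
    by (intro measurable_completion) simp
  then show ?thesis
    unfolding set_borel_measurable_def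
    by (intro borel_measurable_scaleR borel_measurable_inverse borel_measurable_indicator) auto
qed

lemma norm_ew_1_diff: "cmod (ew 1 x - ew 1 y) = 2 * \<bar>sin (pi * (x - y) / (b - a))\<bar>"
proof -
  define t where "t = mu a b 1 * (x - y)"
  have "ew 1 x = ew 1 y * exp (\<i> * of_real t)"
    unfolding ew_def exp_add[symmetric] t_def by (simp add: algebra_simps)
  then have "ew 1 x - ew 1 y = ew 1 y * (exp (\<i> * of_real t) - 1)" by (simp add: algebra_simps)
  then have "cmod (ew 1 x - ew 1 y) = cmod (exp (\<i> * of_real t) - 1)" by (simp add: norm_mult)
  also have "\<dots> = 2 * \<bar>sin (t / 2)\<bar>" by (rule dist_exp_i_1)
  also have "t / 2 = pi * (x - y) / (b - a)" using ab by (simp add: t_def mu_def field_simps)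
  finally show ?thesis .
qed

text \<open>Chord against arc on the circle: since a and b are identified, the relevant distance is
  the shorter of the two arcs between x and y. Half of the central angle is at most pi / 2, whence
  \<open>abs_sin_ge\<close> at 1/2.\<close>

lemma ew_1_diff_lower:
  obtains c where "c > 0"
    "\<And>x y. x \<in> {a..b} \<Longrightarrow> y \<in> {a..b} \<Longrightarrow> c * min \<bar>x - y\<bar> (b - a - \<bar>x - y\<bar>) \<le> cmod (ew 1 x - ew 1 y)"
proof -
  obtain c where c: "c > 0" "\<And>x. \<bar>x\<bar> \<le> pi * (1 / 2) \<Longrightarrow> c * \<bar>x\<bar> \<le> \<bar>sin x\<bar>"
    using abs_sin_ge[of "1 / 2"] by auto
  show ?thesis
  proof (rule that[of "2 * c * pi / (b - a)"])
    show "2 * c * pi / (b - a) > 0" using c ab by simp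
    fix x y assume xy: "x \<in> {a..b}" "y \<in> {a..b}"
    define d where "d = \<bar>x - y\<bar>"
    define t where "t = pi * d / (b - a)"
    have d: "0 \<le> d" "d \<le> b - a" using xy by (auto simp: d_def)
    have st: "\<bar>sin (pi * (x - y) / (b - a))\<bar> = \<bar>sin t\<bar>"
    proof (cases "y \<le> x")
      case False
      then have "x - y = - d" by (simp add: d_def)
      then have "pi * (x - y) / (b - a) = - t" unfolding t_def by simp
      then show ?thesis by simp
    qed (simp add: t_def d_def)
    have "c * min t (pi - t) \<le> \<bar>sin t\<bar>"
    proof (cases "t \<le> pi / 2")
      case True
      have "0 \<le> t" using d ab by (simp add: t_def)
      then have "c * t \<le> \<bar>sin t\<bar>" using c(2)[of t] True by simp
      moreover have "c * min t (pi - t) \<le> c * t" using c by (intro mult_left_mono) auto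
      ultimately show ?thesis by linarith
    next
      case False
      have "pi * d \<le> pi * (b - a)" using d by (intro mult_left_mono) auto
      then have "t \<le> pi" using ab by (simp add: t_def divide_le_eq)
      then have "c * (pi - t) \<le> \<bar>sin (pi - t)\<bar>" using c(2)[of "pi - t"] False by simp
      moreover have "c * min t (pi - t) \<le> c * (pi - t)" using c by (intro mult_left_mono) auto
      ultimately show ?thesis by simp
    qed
    moreover have "min t (pi - t) = pi / (b - a) * min d (b - a - d)"
    proof -
      have "pi / (b - a) * (b - a - d) = pi - t" using ab by (simp add: t_def field_simps)
      moreover have "pi / (b - a) * d = t" by (simp add: t_def)
      moreover have "pi / (b - a) * min d (b - a - d) = min (pi / (b - a) * d) (pi / (b - a) * (b - a - d))"
        using ab by (subst min_mult_distrib_left) simp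
      ultimately show ?thesis by (simp only:)
    qed
    ultimately have "c * (pi / (b - a) * min d (b - a - d)) \<le> \<bar>sin t\<bar>" by (simp only:)
    moreover have "2 * c * pi / (b - a) * min d (b - a - d) = 2 * (c * (pi / (b - a) * min d (b - a - d)))"
      by simp
    ultimately show "2 * c * pi / (b - a) * min \<bar>x - y\<bar> (b - a - \<bar>x - y\<bar>) \<le> cmod (ew 1 x - ew 1 y)"
      unfolding norm_ew_1_diff st d_def[symmetric] by linarith
  qed
qed

text \<open>Riemann-Lebesgue in L^2: by Bessel the squared coefficients are summable, and
  injectivity of p keeps them so along the sequence.\<close>

lemma fc_LIMSEQ:
  assumes "sqi g" "inj (p :: nat \<Rightarrow> int)"
  shows "(\<lambda>n. fc g (p n)) \<longlonglongrightarrow> 0"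
proof -
  obtain B where "l2b (fc g) B" using fc_l2b[OF assms(1)] by blast
  then have "l2b (\<lambda>n. fc g (p n)) B" using assms(2) by (rule l2b_reindex)
  from l2b_summable(1)[OF this] have "summable (\<lambda>n. (cmod (fc g (p n)))\<^sup>2)"
    by (rule summable_on_imp_summable)
  then have "(\<lambda>n. sqrt ((cmod (fc g (p n)))\<^sup>2)) \<longlonglongrightarrow> sqrt 0"
    by (intro tendsto_real_sqrt summable_LIMSEQ_zero)
  then show ?thesis by (simp add: tendsto_norm_zero_iff)
qed

lemma fser_LIMSEQ:
  assumes "l1b c B"
  shows "(\<lambda>n. \<Sum>l\<in>{- int n..int n}. c l * ew l x) \<longlonglongrightarrow> fser c x"
proof -
  have "((\<lambda>A. \<Sum>l\<in>A. c l * ew l x) \<longlongrightarrow> fser c x) (finite_subsets_at_top UNIV)"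
    unfolding fser_def by (rule infsum_tendsto[OF fser_summable[OF assms]])
  moreover have "filterlim (\<lambda>n. {- int n..int n}) (finite_subsets_at_top UNIV) sequentially"
    unfolding filterlim_finite_subsets_at_top
  proof (intro allI impI)
    fix X :: "int set" assume X: "finite X \<and> X \<subseteq> UNIV"
    define N where "N = (\<Sum>x\<in>X. nat \<bar>x\<bar>)"
    have "nat \<bar>x\<bar> \<le> N" if "x \<in> X" for x
      unfolding N_def using X that by (intro member_le_sum) auto
    then have "X \<subseteq> {- int n..int n}" if "n \<ge> N" for n
      using that by fastforce
    then show "\<forall>\<^sub>F n in sequentially. finite {- int n..int n} \<and> X \<subseteq> {- int n..int n} \<and> {- int n..int n} \<subseteq> UNIV"
      by (auto intro!: eventually_sequentiallyI[of N])
  qed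
  ultimately show ?thesis by (rule filterlim_compose)
qed

text \<open>Pointwise inversion by Chernoff's argument: dividing $f-f(x_0)$ by $e_1-e_1(x_0)$ leaves a
  bounded function $g$, the partial sums of the series of $f$ at $x_0$ telescope in the coefficients
  of $g$, and these tend to $0$ by Bessel's inequality.\<close>

lemma fser_inversion:
  assumes cont: "continuous_on {a..b} f" and per: "f a = f b"
    and lip: "\<And>x y. x \<in> {a..b} \<Longrightarrow> y \<in> {a..b} \<Longrightarrow> cmod (f x - f y) \<le> L * \<bar>x - y\<bar>"
    and sum: "l1b (fc f) B" and x0: "x0 \<in> {a..b}"
  shows "f x0 = fser (fc f) x0"
proof -
  define z where "z x = ew 1 x - ew 1 x0" for x
  define g where "g x = (f x - f x0) * inverse (z x)" for x
  obtain c where c: "c > 0" "\<And>x y. x \<in> {a..b} \<Longrightarrow> y \<in> {a..b} \<Longrightarrow>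
      c * min \<bar>x - y\<bar> (b - a - \<bar>x - y\<bar>) \<le> cmod (ew 1 x - ew 1 y)"
    using ew_1_diff_lower by blast
  have L0: "0 \<le> L"
  proof -
    have "0 \<le> L * \<bar>a - b\<bar>" using lip[of a b] ab by (meson atLeastAtMost_iff less_imp_le norm_ge_zero order_refl order_trans)
    then show ?thesis using ab by (simp add: zero_le_mult_iff)
  qed
  \<comment> \<open>The Lipschitz bound is also applied along the other arc, through the identified
    endpoints, so that it matches the lower bound on the chord.\<close>
  have bnd: "cmod (f x - f x0) \<le> L / c * cmod (z x)" if x: "x \<in> {a..b}" for x
  proof -
    have "cmod (f x - f x0) \<le> L * (b - a - \<bar>x - x0\<bar>)"
    proof (cases "x \<le> x0")
      case True
      have "cmod (f x - f x0) \<le> cmod (f x - f a) + cmod (f b - f x0)"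
        using norm_triangle_ineq[of "f x - f a" "f b - f x0"] per by simp
      also have "\<dots> \<le> L * \<bar>x - a\<bar> + L * \<bar>b - x0\<bar>"
        using x x0 ab by (intro add_mono lip) auto
      finally show ?thesis using True x x0 by (simp add: algebra_simps)
    next
      case False
      have "cmod (f x - f x0) \<le> cmod (f x - f b) + cmod (f a - f x0)"
        using norm_triangle_ineq[of "f x - f b" "f a - f x0"] per by simp
      also have "\<dots> \<le> L * \<bar>x - b\<bar> + L * \<bar>a - x0\<bar>"
        using x x0 ab by (intro add_mono lip) auto
      finally show ?thesis using False x x0 by (simp add: algebra_simps)
    qed
    moreover have "cmod (f x - f x0) \<le> L * \<bar>x - x0\<bar>" by (rule lip[OF x x0])
    ultimately have "cmod (f x - f x0) \<le> L * min \<bar>x - x0\<bar> (b - a - \<bar>x - x0\<bar>)"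
      by (simp add: min_def)
    also have "\<dots> \<le> L * (cmod (z x) / c)"
      using c(2)[OF x x0] c(1) L0 by (intro mult_left_mono) (auto simp: z_def field_simps)
    finally show ?thesis by simp
  qed
  have sg: "sqi g"
  proof (rule square_integrable_bounded_by)
    show "set_borel_measurable lebesgue {a..b} g"
      unfolding g_def z_def
      by (intro set_measurable_mult set_measurable_inverse_ew_diff set_measurable_continuous continuous_intros cont)
    show "set_integrable lebesgue {a..b} (\<lambda>x. (L / c)\<^sup>2)"
      by (intro absolutely_integrable_continuous_real continuous_intros)
    fix x assume x: "x \<in> {a..b}"
    have "cmod (g x) \<le> L / c"
    proof (cases "z x = 0")
      case True
      then show ?thesis using L0 c by (simp add: g_def)
    next
      case False
      then show ?thesis using bnd[OF x] c(1) by (simp add: g_def norm_mult norm_divide norm_inverse divide_simps mult_ac)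
    qed
    then show "(cmod (g x))\<^sup>2 \<le> (L / c)\<^sup>2" by (intro power_mono) auto
  qed
  \<comment> \<open>Where z vanishes, which may include an endpoint identified with x0,
    \<open>bnd\<close> forces f x = f x0, so the identity survives the default value of the
    inverse.\<close>
  have fg: "f x = f x0 * 1 + (g x * ew 1 x - ew 1 x0 * g x)" if x: "x \<in> {a..b}" for x
  proof (cases "z x = 0")
    case True
    then show ?thesis using bnd[OF x] by (simp add: g_def)
  next
    case False
    then have "g x * z x = f x - f x0" by (simp add: g_def)
    then show ?thesis by (simp add: z_def algebra_simps)
  qed
  have s1: "sqi (\<lambda>x. f x0 * 1)" by (intro square_integrable_continuous continuous_intros)
  have s2: "sqi (\<lambda>x. ew 1 x0 * g x)" by (intro square_integrable_mult_continuous sg continuous_intros)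
  have ff: "fc f l = f x0 * (if l = 0 then 1 else 0) + (fc g (l - 1) - ew 1 x0 * fc g l)" for l
  proof -
    have "fc f l = fc (\<lambda>x. f x0 * 1 + (g x * ew 1 x - ew 1 x0 * g x)) l"
      by (rule fc_cong) (rule fg)
    also have "\<dots> = fc (\<lambda>x. f x0 * 1) l + (fc (\<lambda>x. g x * ew 1 x) l - fc (\<lambda>x. ew 1 x0 * g x) l)"
      by (subst fc_add[OF s1 square_integrable_diff[OF sqi_mult_ew[OF sg] s2]])
        (subst fc_diff[OF sqi_mult_ew[OF sg] s2], rule refl)
    finally show ?thesis unfolding fc_cmult fc_shift fc_1 .
  qed
  define h where "h l = fc g (l - 1) * ew l x0" for l
  \<comment> \<open>Multiplying by e_1 shifts the coefficients of g, so each term is h l - h (l +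
    1), apart from the contribution f x0 at l = 0.\<close>
  have tele: "(\<Sum>l\<in>{- int n..int n}. fc f l * ew l x0) = f x0 + h (- int n) - h (int n + 1)" for n
  proof -
    have t: "fc f l * ew l x0 = f x0 * (if l = 0 then 1 else 0) + (h l - h (l + 1))" for l
      unfolding ff h_def using ew_add[of l 1 x0] by (simp add: algebra_simps)
    show ?thesis
    proof (induction n)
      case 0
      show ?case using t[of 0] by simp
    next
      case (Suc n)
      have "{- int (Suc n)..int (Suc n)} = insert (- int (Suc n)) (insert (int (Suc n)) {- int n..int n})" by auto
      then have "(\<Sum>l\<in>{- int (Suc n)..int (Suc n)}. fc f l * ew l x0)
          = fc f (- int (Suc n)) * ew (- int (Suc n)) x0 + (fc f (int (Suc n)) * ew (int (Suc n)) x0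
            + (\<Sum>l\<in>{- int n..int n}. fc f l * ew l x0))" by (simp del: of_nat_Suc)
      also have "\<dots> = (h (- int (Suc n)) - h (- int (Suc n) + 1)) + ((h (int (Suc n)) - h (int (Suc n) + 1))
          + (f x0 + h (- int n) - h (int n + 1)))"
        unfolding Suc.IH t[of "- int (Suc n)"] t[of "int (Suc n)"] by (simp del: of_nat_Suc)
      moreover have "- int (Suc n) + 1 = - int n" "1 - int (Suc n) = - int n" "int n + 1 = int (Suc n)" by simp_all
      ultimately show ?case by (simp del: of_nat_Suc)
    qed
  qed
  have h0: "(\<lambda>n. h (p n)) \<longlonglongrightarrow> 0" if "inj (p :: nat \<Rightarrow> int)" for p
  proof -
    have "(\<lambda>n. fc g (p n - 1)) \<longlonglongrightarrow> 0" using that by (intro fc_LIMSEQ sg) (auto simp: inj_def)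
    then have "(\<lambda>n. cmod (h (p n))) \<longlonglongrightarrow> 0" unfolding h_def by (simp add: norm_mult tendsto_norm_zero_iff)
    then show ?thesis by (simp add: tendsto_norm_zero_iff)
  qed
  have "(\<lambda>n. f x0 + h (- int n) - h (int n + 1)) \<longlonglongrightarrow> f x0 + 0 - 0"
    by (intro tendsto_intros h0) (auto simp: inj_def)
  then show ?thesis
    using LIMSEQ_unique[OF fser_LIMSEQ[OF sum, of x0]] unfolding tele by simp
qed

text \<open>Integration by parts against a character when $H$ is only an indefinite Lebesgue integral: the
  difference of the two sides, as a function of the right endpoint, has derivative $0$ everywhere.\<close>

lemma fc_indefinite_integral:
  assumes h: "sqi h"
    and H: "\<And>x. x \<in> {a..b} \<Longrightarrow> H x = H a + (LINT y:{a..x}|lebesgue. h y)"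
    and per: "H b = H a"
  shows "fc h l = \<i> * of_real (mu a b l) * fc H l"
proof -
  define E where "E = ew (- l)"
  define m where "m = \<i> * complex_of_real (mu a b (- l))"
  \<comment> \<open>A continuous monotone function that dominates the increments of H.\<close>
  define P where "P x = integral {a..x} (\<lambda>y. cmod (h y))" for x
  have hi: "set_integrable lebesgue {a..b} h" by (rule square_integrable_integrable[OF h])
  have hI: "h integrable_on {a..b}" by (rule set_lebesgue_integral_eq_integral(1)[OF hi])
  have hN: "(\<lambda>y. cmod (h y)) integrable_on {a..b}"
    by (rule set_lebesgue_integral_eq_integral(1)[OF set_integrable_norm[OF hi]])
  have H': "H x = H a + integral {a..x} h" if x: "x \<in> {a..b}" for x
  proof -
    have "set_integrable lebesgue {a..x} h" by (rule set_integrable_subset[OF hi]) (use x in auto)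
    then show ?thesis using H[OF x] by (simp add: set_lebesgue_integral_eq_integral)
  qed
  have contH: "continuous_on {a..b} H"
  proof -
    have "continuous_on {a..b} (\<lambda>x. H a + integral {a..x} h)"
      by (intro continuous_intros indefinite_integral_continuous_1 hI)
    then show ?thesis by (rule continuous_on_eq) (rule H'[symmetric])
  qed
  have contP: "continuous_on {a..b} P"
    unfolding P_def by (rule indefinite_integral_continuous_1[OF hN])
  have contE: "continuous_on S E" for S unfolding E_def by (intro continuous_intros)
  have normE: "cmod (E x) = 1" for x by (simp add: E_def)
  have dE: "(E has_vector_derivative m * E x) (at x within S)" for x S
    unfolding E_def m_def by (rule ew_deriv)
  have hE: "set_integrable lebesgue {a..b} (\<lambda>y. h y * E y)"
    unfolding E_def by (intro square_integrable_integrable sqi_mult_ew h)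
  have HE: "set_integrable lebesgue {a..b} (\<lambda>y. H y * (m * E y))"
    by (intro square_integrable_integrable square_integrable_continuous continuous_intros contH contE)
  note hEI = set_lebesgue_integral_eq_integral(1)[OF hE] and HEI = set_lebesgue_integral_eq_integral(1)[OF HE]
  define w where "w y = h y * E y + H y * (m * E y)" for y
  have wI: "w integrable_on {a..b}" unfolding w_def by (intro integrable_add hEI HEI)
  define D where "D x = integral {a..x} w - H x * E x" for x
  have sub: "f integrable_on {x..y}" if "f integrable_on {a..b}" "a \<le> x" "y \<le> b" for f :: "real \<Rightarrow> 'c::banach" and x y
    by (rule integrable_subinterval_real[OF that(1)]) (use that in auto)
  have comb: "integral {x..y} f = integral {a..y} f - integral {a..x} f"
    if "f integrable_on {a..b}" "a \<le> x" "x \<le> y" "y \<le> b" for f :: "real \<Rightarrow> 'c::banach" and x y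
    using Henstock_Kurzweil_Integration.integral_combine[of a x y f] that sub[OF that(1), of a y]
    by (simp add: algebra_simps)
  have Pmono: "P x \<le> P y" if "a \<le> x" "x \<le> y" "y \<le> b" for x y
  proof -
    have "0 \<le> integral {x..y} (\<lambda>y. cmod (h y))" by (rule integral_nonneg[OF sub[OF hN]]) (use that in auto)
    then show ?thesis using comb[OF hN that] by (simp add: P_def)
  qed
  have Hdiff: "cmod (H y - H x) \<le> P y - P x" if "a \<le> x" "x \<le> y" "y \<le> b" for x y
  proof -
    have "H y - H x = integral {x..y} h" using H'[of x] H'[of y] comb[OF hI that] that by simp
    also have "cmod \<dots> \<le> integral {x..y} (\<lambda>y. cmod (h y))"
      by (intro integral_norm_bound_integral sub[OF hI] sub[OF hN]) (use that in auto)
    finally show ?thesis using comb[OF hN that] by (simp add: P_def)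
  qed
  have Ediff: "cmod (E s - E x) \<le> cmod m * (s - x)" if "x \<le> s" for s x
  proof -
    have "((\<lambda>y. m * E y) has_integral (E s - E x)) {x..s}"
      by (rule fundamental_theorem_of_calculus[OF that]) (rule dE)
    from has_integral_bound[OF norm_ge_zero this[unfolded box_real(2)[symmetric]], of m]
    show ?thesis using that by (simp add: norm_mult normE)
  qed
  have step: "cmod (D y - D x) \<le> 2 * cmod m * (y - x) * (P y - P x)" if xy: "a \<le> x" "x \<le> y" "y \<le> b" for x y
  proof -
    \<comment> \<open>Freezing E at the left end and H at the right end leaves two integrals that
      evaluate exactly and cancel against the increment of H E. What remains is O((y - x) (P y - P
      x)), and continuity of P makes this o(y - x) at every point.\<close>
    define v where "v s = h s * (E s - E x) + (H s - H y) * (m * E s)" for s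
    have i1: "((\<lambda>s. h s * E x) has_integral ((H y - H x) * E x)) {x..y}"
      using has_integral_mult_left[OF integrable_integral[OF sub[OF hI xy(1,3)]], of "E x"]
        H'[of x] H'[of y] comb[OF hI xy] xy by simp
    have i2: "((\<lambda>s. H y * (m * E s)) has_integral (H y * (E y - E x))) {x..y}"
      by (intro has_integral_mult_right fundamental_theorem_of_calculus xy dE)
    have i3: "(w has_integral (integral {a..y} w - integral {a..x} w)) {x..y}"
      using integrable_integral[OF sub[OF wI xy(1,3)]] comb[OF wI xy] by simp
    have "((\<lambda>s. w s - h s * E x - H y * (m * E s)) has_integral
      (integral {a..y} w - integral {a..x} w - (H y - H x) * E x - H y * (E y - E x))) {x..y}"
      by (intro has_integral_diff i1 i2 i3)
    also have "(\<lambda>s. w s - h s * E x - H y * (m * E s)) = v"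
      by (auto simp: w_def v_def algebra_simps)
    also have "integral {a..y} w - integral {a..x} w - (H y - H x) * E x - H y * (E y - E x) = D y - D x"
      by (simp add: D_def algebra_simps)
    finally have vi: "(v has_integral (D y - D x)) {x..y}" .
    have "((\<lambda>s. cmod m * (y - x) * cmod (h s) + cmod m * (P y - P x)) has_integral
        (cmod m * (y - x) * (P y - P x) + (y - x) *\<^sub>R (cmod m * (P y - P x)))) {x..y}"
    proof (intro has_integral_add has_integral_mult_right)
      show "((\<lambda>s. cmod (h s)) has_integral (P y - P x)) {x..y}"
        using integrable_integral[OF sub[OF hN xy(1,3)]] comb[OF hN xy] by (simp add: P_def)
      show "((\<lambda>s. cmod m * (P y - P x)) has_integral ((y - x) *\<^sub>R (cmod m * (P y - P x)))) {x..y}"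
        using has_integral_const_real[of "cmod m * (P y - P x)" x y] xy by simp
    qed
    moreover have "cmod (v s) \<le> cmod m * (y - x) * cmod (h s) + cmod m * (P y - P x)" if s: "s \<in> {x..y}" for s
    proof -
      have "cmod (v s) \<le> cmod (h s) * cmod (E s - E x) + cmod (H s - H y) * cmod m"
        unfolding v_def by (rule order_trans[OF norm_triangle_ineq]) (simp add: norm_mult normE)
      also have "\<dots> \<le> cmod (h s) * (cmod m * (y - x)) + (P y - P x) * cmod m"
      proof (intro add_mono mult_left_mono mult_right_mono)
        show "cmod (E s - E x) \<le> cmod m * (y - x)"
          using Ediff[of x s] s mult_left_mono[of "s - x" "y - x" "cmod m"] by auto
        show "cmod (H s - H y) \<le> P y - P x"
          using Hdiff[of s y] Pmono[of x s] s xy by (auto simp: norm_minus_commute)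
      qed auto
      finally show ?thesis by (simp add: mult_ac)
    qed
    ultimately have "cmod (D y - D x) \<le> cmod m * (y - x) * (P y - P x) + (y - x) *\<^sub>R (cmod m * (P y - P x))"
      using integral_norm_bound_integral[of v "{x..y}"] vi by (metis has_integral_iff)
    then show ?thesis by (simp add: algebra_simps)
  qed
  have step': "cmod (D y - D x) \<le> 2 * cmod m * \<bar>y - x\<bar> * \<bar>P y - P x\<bar>" if "x \<in> {a..b}" "y \<in> {a..b}" for x y
    using step[of x y] step[of y x] Pmono[of x y] Pmono[of y x] that
    by (cases "x \<le> y") (auto simp: norm_minus_commute abs_minus_commute)
  have "(D has_derivative (\<lambda>h. 0)) (at x within {a..b})" if x: "x \<in> {a..b}" for x
    unfolding has_derivative_within
  proof (intro conjI bounded_linear_zero)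
    have "((\<lambda>y. 2 * cmod m * \<bar>P y - P x\<bar>) \<longlongrightarrow> 2 * cmod m * \<bar>P x - P x\<bar>) (at x within {a..b})"
      using contP x by (intro tendsto_intros) (auto simp: continuous_on_def)
    then have lim: "((\<lambda>y. 2 * cmod m * \<bar>P y - P x\<bar>) \<longlongrightarrow> 0) (at x within {a..b})" by simp
    show "((\<lambda>y. (1 / norm (y - x)) *\<^sub>R (D y - (D x + 0))) \<longlongrightarrow> 0) (at x within {a..b})"
    proof (rule Lim_null_comparison[OF _ lim])
      show "\<forall>\<^sub>F y in at x within {a..b}. norm ((1 / norm (y - x)) *\<^sub>R (D y - (D x + 0))) \<le> 2 * cmod m * \<bar>P y - P x\<bar>"
        unfolding eventually_at_filter
        by (rule always_eventually) (use step'[OF x] in \<open>auto simp: divide_le_eq mult_ac\<close>)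
    qed
  qed
  then obtain k where "\<And>x. x \<in> {a..b} \<Longrightarrow> D x = k"
    using has_derivative_zero_constant[of "{a..b}" D] by auto
  then have "D b = D a" using ab by simp
  then have "integral {a..b} w = 0" using per by (simp add: D_def E_def)
  moreover have "integral {a..b} w = (LINT y:{a..b}|lebesgue. h y * E y) + (LINT y:{a..b}|lebesgue. H y * (m * E y))"
    unfolding w_def set_lebesgue_integral_eq_integral(2)[OF hE] set_lebesgue_integral_eq_integral(2)[OF HE]
    by (intro Henstock_Kurzweil_Integration.integral_add hEI HEI)
  moreover have "(LINT y:{a..b}|lebesgue. H y * (m * E y)) = m * (LINT y:{a..b}|lebesgue. H y * E y)"
    by (simp add: mult.left_commute)
  ultimately have "(LINT y:{a..b}|lebesgue. h y * E y) = - m * (LINT y:{a..b}|lebesgue. H y * E y)"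
    by (simp add: add_eq_0_iff)
  then show ?thesis by (simp add: fc_eq E_def m_def mu_minus)
qed

text \<open>A single coefficient of the difference quotient minus the derivative is bounded by its
  L^2 norm: Bessel for a one-element index set.\<close>

lemma has_L2_derivative_fc:
  assumes D: "has_L2_derivative a b f f' t S" and t: "t \<in> S"
  shows "((\<lambda>s. fc (\<lambda>x. of_real (f s x)) l) has_vector_derivative fc (\<lambda>x. of_real (f' x)) l) (at t within S)"
proof -
  define F where "F s = fc (\<lambda>x. of_real (f s x)) l" for s
  define I where "I s = (LINT x:{a..b}|lebesgue. ((f s x - f t x) / (s - t) - f' x)\<^sup>2)" for s
  have sf: "sqi (\<lambda>x. of_real (f s x))" if "s \<in> S" for s
    using D that by (auto simp: has_L2_derivative_def intro: square_integrable_of_real)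
  have sf': "sqi (\<lambda>x. of_real (f' x))"
    using D by (auto simp: has_L2_derivative_def intro: square_integrable_of_real)
  have I0: "((\<lambda>s. sqrt (I s / (b - a))) \<longlongrightarrow> sqrt (0 / (b - a))) (at t within S)"
    using D ab by (intro tendsto_intros) (auto simp: has_L2_derivative_def I_def)
  have q: "cmod ((1 / (s - t)) *\<^sub>R (F s - (F t + (s - t) *\<^sub>R fc (\<lambda>x. of_real (f' x)) l))) \<le> sqrt (I s / (b - a))"
    if s: "s \<in> S" "s \<noteq> t" for s
  proof -
    define d where "d x = complex_of_real ((f s x - f t x) / (s - t) - f' x)" for x
    have d: "d x = of_real (1 / (s - t)) * (of_real (f s x) - of_real (f t x)) - of_real (f' x)" for x
      by (simp add: d_def)
    have s1: "sqi (\<lambda>x. of_real (1 / (s - t)) * (of_real (f s x) - of_real (f t x)))"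
      by (intro square_integrable_mult_continuous square_integrable_diff sf s t continuous_intros)
    have sd: "sqi d" unfolding d by (intro square_integrable_diff s1 sf')
    have "fc d l = of_real (1 / (s - t)) * (F s - F t) - fc (\<lambda>x. of_real (f' x)) l"
      unfolding d fc_diff[OF s1 sf'] fc_cmult fc_diff[OF sf[OF s(1)] sf[OF t]] F_def ..
    also have "\<dots> = (1 / (s - t)) *\<^sub>R (F s - (F t + (s - t) *\<^sub>R fc (\<lambda>x. of_real (f' x)) l))"
      using s by (simp add: scaleR_conv_of_real field_simps)
    finally have e: "fc d l = \<dots>" .
    have "(b - a) * (cmod (fc d l))\<^sup>2 \<le> (LINT x:{a..b}|lebesgue. (cmod (d x))\<^sup>2)"
      using Bessel_inequality[OF sd, of "{l}"] by simp
    also have "\<dots> = I s" unfolding I_def d_def norm_of_real power2_abs ..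
    finally have "(cmod (fc d l))\<^sup>2 \<le> I s / (b - a)" using ab by (simp add: field_simps)
    then show ?thesis unfolding e[symmetric] by (rule real_le_rsqrt)
  qed
  have "((\<lambda>s. (1 / norm (s - t)) *\<^sub>R (F s - (F t + (s - t) *\<^sub>R fc (\<lambda>x. of_real (f' x)) l))) \<longlongrightarrow> 0) (at t within S)"
  proof (rule Lim_null_comparison)
    show "\<forall>\<^sub>F s in at t within S. norm ((1 / norm (s - t)) *\<^sub>R (F s - (F t + (s - t) *\<^sub>R fc (\<lambda>x. of_real (f' x)) l)))
        \<le> sqrt (I s / (b - a))"
      unfolding eventually_at_filter by (rule always_eventually) (use q in auto)
    show "((\<lambda>s. sqrt (I s / (b - a))) \<longlongrightarrow> 0) (at t within S)" using I0 by simp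
  qed
  then show ?thesis
    unfolding has_vector_derivative_def has_derivative_within F_def
    by (auto intro: bounded_linear_scaleR_left)
qed

end

section \<open>Solutions and splitting approximations\<close>

context interval
begin

definition bt :: "int \<Rightarrow> real" where "bt l = sqrt (1 + (mu a b l)\<^sup>2)"

lemma bt_sq: "(bt l)\<^sup>2 = 1 + (mu a b l)\<^sup>2"
  by (simp add: bt_def)

lemma mu_le_bt: "\<bar>mu a b l\<bar> \<le> bt l"
  unfolding bt_def by (intro real_le_rsqrt) simp

text \<open>Comparison with the sum of 1 / n^2 on the nonnegative half-line; evenness gives the
  other half at the price of a factor 2.\<close>

lemma l2b_inverse_bt: "\<exists>K. l2b (\<lambda>l. of_real (1 / bt l)) K"
proof -
  define c where "c = 2 * pi / (b - a)"
  have c: "c > 0" using ab by (simp add: c_def)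
  define g where "g l = 1 / (1 + (mu a b l)\<^sup>2)" for l
  have g0: "0 \<le> g l" and gm: "g (- l) = g l" for l by (auto simp: g_def mu_minus)
  have sg: "summable (\<lambda>n. g (int n))"
  proof (rule summable_comparison_test')
    show "summable (\<lambda>n. (1 / c\<^sup>2) * inverse (real n ^ 2))"
      by (intro summable_mult inverse_power_summable) simp
    fix n :: nat assume n: "1 \<le> n"
    have "mu a b (int n) = c * n" by (simp add: mu_def c_def)
    moreover have "1 / (1 + (c * n)\<^sup>2) \<le> 1 / (c * n)\<^sup>2" using c n by (intro divide_left_mono) (auto simp: add_pos_nonneg)
    ultimately show "norm (g (int n)) \<le> (1 / c\<^sup>2) * inverse (real n ^ 2)"
      using g0[of "int n"] by (simp add: g_def power_mult_distrib field_simps)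
  qed
  define S where "S = (\<Sum>n. g (int n))"
  have "(\<Sum>l\<in>A. g l) \<le> 2 * S" if A: "finite A" for A
  proof -
    define N where "N = (\<lambda>l. nat \<bar>l\<bar>) ` A"
    have N: "finite N" using A by (simp add: N_def)
    have "l \<in> int ` N \<union> (\<lambda>n. - int n) ` N" if "l \<in> A" for l
    proof (cases "0 \<le> l")
      case True
      then have "l = int (nat \<bar>l\<bar>)" by simp
      then show ?thesis using that unfolding N_def by blast
    next
      case False
      then have "l = - int (nat \<bar>l\<bar>)" by simp
      then show ?thesis using that unfolding N_def by blast
    qed
    then have "A \<subseteq> int ` N \<union> (\<lambda>n. - int n) ` N" by blast
    then have "(\<Sum>l\<in>A. g l) \<le> (\<Sum>l\<in>int ` N \<union> (\<lambda>n. - int n) ` N. g l)"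
      using N g0 by (intro sum_mono2) auto
    also have "\<dots> \<le> (\<Sum>l\<in>int ` N. g l) + (\<Sum>l\<in>(\<lambda>n. - int n) ` N. g l)"
      using sum.union_inter[of "int ` N" "(\<lambda>n. - int n) ` N" g] N
        sum_nonneg[of "int ` N \<inter> (\<lambda>n. - int n) ` N" g] g0 by simp
    also have "\<dots> = (\<Sum>n\<in>N. g (int n)) + (\<Sum>n\<in>N. g (int n))"
      by (simp add: sum.reindex inj_on_def gm)
    also have "\<dots> \<le> S + S"
      unfolding S_def using g0 by (intro add_mono sum_le_suminf sg N) auto
    finally show ?thesis by simp
  qed
  then have "L2_set (\<lambda>l. cmod (of_real (1 / bt l))) A \<le> sqrt (2 * S)" if "finite A" for A
    using that unfolding L2_set_def norm_of_real power2_abs power_divide bt_sq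
    by (intro real_sqrt_le_mono) (simp add: g_def)
  then show ?thesis unfolding l2b_def by blast
qed

text \<open>A fixed choice depending only on a and b, so that constants built from it are uniform in
  \<epsilon> and \<tau>.\<close>

definition bt_const :: real where "bt_const = (SOME K. l2b (\<lambda>l. of_real (1 / bt l)) K)"

sublocale weights bt bt_const
proof
  show "1 \<le> bt l" for l by (simp add: bt_def)
  show "bt (- l) = bt l" for l by (simp add: bt_def mu_minus)
  show "bt (j + k) \<le> bt j + bt k" for j k
  proof -
    \<comment> \<open>Triangle inequality in the plane for the vectors (1, \<mu>_j) and (1,
      \<mu>_k).\<close>
    have "bt (j + k) \<le> sqrt ((1 + 1)\<^sup>2 + (mu a b j + mu a b k)\<^sup>2)"
      unfolding bt_def mu_add by (intro real_sqrt_le_mono) simp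
    also have "\<dots> \<le> bt j + bt k"
      using real_sqrt_sum_squares_triangle_ineq[of 1 1 "mu a b j" "mu a b k"] by (simp add: bt_def)
    finally show ?thesis .
  qed
  show "l2b (\<lambda>l. complex_of_real (1 / bt l)) bt_const"
    unfolding bt_const_def using l2b_inverse_bt by (rule someI_ex)
qed

lemma hspace_weight: "(cmod (of_real (bt l ^ m) * z))\<^sup>2 = (1 + (mu a b l)\<^sup>2) ^ m * (cmod z)\<^sup>2"
  by (simp add: norm_mult power_mult_distrib norm_power bt_sq[symmetric] power_mult[symmetric] mult.commute)

lemma hspace_l2b:
  assumes "u \<in> hspace a b m" "hnorm a b m u \<le> M"
  shows "l2b (\<lambda>l. of_real (bt l ^ m) * fc u l) M"
proof -
  have "(\<lambda>l. (cmod (of_real (bt l ^ m) * fc u l))\<^sup>2) summable_on UNIV"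
    using assms(1) unfolding hspace_weight by (simp add: hspace_def)
  from l2b_of_summable[OF this] show ?thesis
    by (rule l2b_mono) (use assms(2) in \<open>simp only: hspace_weight hnorm_def\<close>)
qed

lemma l2b_hspace:
  assumes "sqi u" "l2b (\<lambda>l. of_real (bt l ^ m) * fc u l) B"
  shows "u \<in> hspace a b m" "hnorm a b m u \<le> B"
proof -
  show "u \<in> hspace a b m"
    using assms(1) l2b_summable(1)[OF assms(2)] unfolding hspace_weight by (simp add: hspace_def)
  show "hnorm a b m u \<le> B"
    using l2b_summable(2)[OF assms(2)] l2b_nonneg[OF assms(2)] unfolding hspace_weight hnorm_def
    by (intro real_le_lsqrt) auto
qed

lemma fmult_eq: "fmult a b \<sigma> f = fser (\<lambda>l. \<sigma> l * fc f l)"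
  by (rule ext) (simp add: fmult_def fser_def ew_def)

lemma exp_japanese_eq: "exp_japanese a b t f = fser (lin t (fc f))"
  by (simp add: exp_japanese_def fmult_eq lin_def[abs_def] bt_def)

lemma japanese_inv_eq: "japanese_inv a b f = fser (\<lambda>l. of_real (1 / bt l) * fc f l)"
  by (simp add: japanese_inv_def fmult_eq bt_def)

lemma japanese_eq: "japanese a b f = fser (\<lambda>l. of_real (bt l) * fc f l)"
  by (simp add: japanese_def fmult_eq bt_def)

lemma l1b_lin: "l1b c B \<Longrightarrow> l1b (lin s c) B"
  by (erule l1b_dominated) simp

text \<open>The factor 1/8 makes the nonlinearity the cube of the real part.\<close>

lemma nonlin_G_fser:
  assumes "l1b c B"
  shows "nonlin_G (fser c) = fser (conv3 (rp c))"
proof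
  fix x
  have c': "l1b (\<lambda>l. cnj (c (- l))) B"
    by (rule l1b_dominated[OF l1b_reindex[OF assms, of uminus]]) auto
  have "(1 / 2) * (fser c x + cnj (fser c x)) = fser (rp c) x"
    unfolding fser_cnj fser_add[OF assms c'] fser_cmult by (simp add: rp_def[abs_def])
  then have "((1 / 2) * (fser c x + cnj (fser c x))) ^ 3 = fser (conv3 (rp c)) x"
    using fser_cube[OF l1b_rp[OF assms]] by simp
  then show "nonlin_G (fser c) x = fser (conv3 (rp c)) x"
    by (simp add: nonlin_G_def power_mult_distrib power_divide)
qed

section \<open>The splitting scheme on Fourier coefficients\<close>

definition strang_coeff_step :: "real \<Rightarrow> real \<Rightarrow> (int \<Rightarrow> complex) \<Rightarrow> int \<Rightarrow> complex" where
  "strang_coeff_step e \<tau> c l = lin \<tau> c l + of_real (e * \<tau>) *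
     lin (\<tau> / 2) (\<lambda>l. \<i> * (of_real (1 / bt l) * conv3 (rp (lin (\<tau> / 2) c)) l)) l"

text \<open>The invariant is absolute summability of the coefficients weighted by \<beta>: every
  series in the scheme then converges, including that of <D> psi in the velocity. It is preserved
  because \<beta> cancels against the inverse weight in the nonlinear term. The bound may grow with
  the step; only its existence matters here.\<close>

lemma strang_step:
  fixes e \<tau> :: real and \<psi> :: "real \<Rightarrow> complex"
  assumes c: "l1b (\<lambda>l. of_real (bt l) * fc \<psi> l) B"
  defines "\<psi>' \<equiv> \<lambda>x. exp_japanese a b \<tau> \<psi> x + of_real (e * \<tau>) *
             exp_japanese a b (\<tau> / 2) (nonlin_F a b (exp_japanese a b (\<tau> / 2) \<psi>)) x"
  shows "sqi \<psi>'" "fc \<psi>' l = strang_coeff_step e \<tau> (fc \<psi>) l"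
    "\<exists>B. l1b (\<lambda>l. of_real (bt l) * fc \<psi>' l) B"
proof -
  define c where "c = fc \<psi>"
  have c1: "l1b c B" unfolding c_def
    by (rule l1b_dominated[OF assms(1)]) (use beta_ge_1 in \<open>auto simp: norm_mult mult_le_cancel_right1\<close>)
  define g where "g = conv3 (rp (lin (\<tau> / 2) c))"
  have g1: "l1b g (B ^ 3)" unfolding g_def by (intro l1b_conv3 l1b_rp l1b_lin c1)
  define f where "f l = \<i> * (of_real (1 / bt l) * g l)" for l
  have ib: "cmod (complex_of_real (1 / bt l) * z) \<le> cmod z" for l z
    using beta_ge_1[of l] by (simp add: norm_divide divide_le_eq mult_le_cancel_left1)
  have gb1: "l1b (\<lambda>l. of_real (1 / bt l) * g l) (B ^ 3)" by (rule l1b_dominated[OF g1]) (rule ib)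
  have f1: "l1b f (B ^ 3)" unfolding f_def by (rule l1b_dominated[OF gb1]) (simp add: norm_mult norm_divide)
  have G: "nonlin_G (exp_japanese a b (\<tau> / 2) \<psi>) = fser g"
    unfolding exp_japanese_eq g_def c_def[symmetric] by (rule nonlin_G_fser[OF l1b_lin[OF c1]])
  have F: "nonlin_F a b (exp_japanese a b (\<tau> / 2) \<psi>) = fser f"
    unfolding nonlin_F_def[abs_def] G japanese_inv_eq fc_fser[OF g1] fser_cmult f_def ..
  have fcf: "fc (fser f) = f" by (rule ext) (rule fc_fser[OF f1])
  have e2: "l1b (\<lambda>l. of_real (e * \<tau>) * lin (\<tau> / 2) f l) (\<bar>e * \<tau>\<bar> * B ^ 3)"
    by (rule l1b_scale[OF l1b_lin[OF f1, of "\<tau> / 2"]]) (auto simp: norm_mult abs_mult)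
  have psi': "\<psi>' = fser (strang_coeff_step e \<tau> c)"
  proof
    fix x
    have "\<psi>' x = fser (lin \<tau> c) x + of_real (e * \<tau>) * fser (lin (\<tau> / 2) f) x"
      unfolding \<psi>'_def F unfolding exp_japanese_eq fcf c_def[symmetric] ..
    also have "\<dots> = fser (\<lambda>l. lin \<tau> c l + of_real (e * \<tau>) * lin (\<tau> / 2) f l) x"
      unfolding fser_cmult by (rule fser_add[OF l1b_lin[OF c1] e2])
    finally show "\<psi>' x = fser (strang_coeff_step e \<tau> c) x"
      by (simp only: strang_coeff_step_def[abs_def] f_def[abs_def] g_def)
  qed
  have "l1b (\<lambda>l. of_real (bt l) * strang_coeff_step e \<tau> c l) (B + \<bar>e * \<tau>\<bar> * B ^ 3)"
    unfolding strang_coeff_step_def distrib_left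
  proof (rule l1b_add)
    show "l1b (\<lambda>l. of_real (bt l) * lin \<tau> c l) B"
      by (rule l1b_dominated[OF assms(1)]) (simp add: norm_mult c_def)
    show "l1b (\<lambda>l. of_real (bt l) * (of_real (e * \<tau>) *
        lin (\<tau> / 2) (\<lambda>l. \<i> * (of_real (1 / bt l) * conv3 (rp (lin (\<tau> / 2) c)) l)) l)) (\<bar>e * \<tau>\<bar> * B ^ 3)"
      unfolding g_def[symmetric]
      by (rule l1b_scale[OF g1]) (auto simp: norm_mult norm_divide abs_mult)
  qed
  note bc = this
  have "l1b (strang_coeff_step e \<tau> c) (B + \<bar>e * \<tau>\<bar> * B ^ 3)"
    by (rule l1b_dominated[OF bc]) (use beta_ge_1 in \<open>auto simp: norm_mult mult_le_cancel_right1\<close>)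
  then show "sqi \<psi>'" and fc': "fc \<psi>' l = strang_coeff_step e \<tau> (fc \<psi>) l" for l
    unfolding psi' by (auto simp: sqi_fser fc_fser c_def)
  show "\<exists>B. l1b (\<lambda>l. of_real (bt l) * fc \<psi>' l) B"
    using bc unfolding fc'[abs_def] c_def by blast
qed

lemma Lipschitz_of_continuous_derivative:
  fixes f f' :: "real \<Rightarrow> real"
  assumes du: "\<And>x. x \<in> {a..b} \<Longrightarrow> (f has_real_derivative f' x) (at x within {a..b})"
    and cont: "continuous_on {a..b} f'"
  obtains L where "\<And>x y. x \<in> {a..b} \<Longrightarrow> y \<in> {a..b} \<Longrightarrow> \<bar>f x - f y\<bar> \<le> L * \<bar>x - y\<bar>"
proof -
  have "bounded (f' ` {a..b})" by (intro compact_imp_bounded compact_continuous_image cont) simp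
  then obtain L where "\<forall>y\<in>f' ` {a..b}. norm y \<le> L" unfolding bounded_iff by blast
  then have L: "\<bar>f' x\<bar> \<le> L" if "x \<in> {a..b}" for x using that by auto
  show ?thesis
  proof (rule that)
    fix x y assume "x \<in> {a..b}" "y \<in> {a..b}"
    then show "\<bar>f x - f y\<bar> \<le> L * \<bar>x - y\<bar>"
      using field_differentiable_bound[of "{a..b}" f f' L x y] du L by auto
  qed
qed

end

text \<open>The constants of the error bound come from the H^1 and L^2 bounds M. The condition
  \<open>reg0\<close> is qualitative: it starts the summability invariant of the scheme.\<close>

locale nkg = interval +
  fixes \<epsilon> Te M :: real and u0 u1 :: "real \<Rightarrow> real" and u ut :: "real \<Rightarrow> real \<Rightarrow> real"
  assumes sol: "nkg_solution a b \<epsilon> Te u0 u1 u ut"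
    and Te: "0 < Te"
    and bu: "\<And>t. 0 \<le> t \<Longrightarrow> t \<le> Te \<Longrightarrow> h1b (fc (\<lambda>x. of_real (u t x))) M"
    and reg0: "\<exists>B. l2b (\<lambda>l. of_real ((bt l)\<^sup>2) * fc (\<lambda>x. of_real (u 0 x)) l) B"
      "\<exists>B. l2b (\<lambda>l. of_real (bt l) * fc (\<lambda>x. of_real (ut 0 x)) l) B"
    and bv: "\<And>t. 0 \<le> t \<Longrightarrow> t \<le> Te \<Longrightarrow> l2b (fc (\<lambda>x. of_real (ut t x))) M"
begin

abbreviation "cu t \<equiv> (\<lambda>x. complex_of_real (u t x))"
abbreviation "cv t \<equiv> (\<lambda>x. complex_of_real (ut t x))"

lemma sqi_cv: assumes t: "0 \<le> t" "t \<le> Te" shows "sqi (cv t)"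
  using sol t unfolding nkg_solution_def has_L2_derivative_def
  by (force intro: square_integrable_of_real)

text \<open>Testing the equation against a character yields an ordinary differential equation for
  each coefficient, with u^3 turned into a triple convolution.\<close>

lemma coefficients:
  assumes t: "0 \<le> t" "t \<le> Te"
  shows "sqi (cu t)"
    "fc (\<lambda>x. of_real (u t x ^ 3)) = conv3 (fc (cu t))"
    "((\<lambda>t. fc (cu t) l) has_vector_derivative fc (cv t) l) (at t within {0..Te})"
    "((\<lambda>t. fc (cv t) l) has_vector_derivative
      - of_real ((bt l)\<^sup>2) * fc (cu t) l - of_real (\<epsilon>\<^sup>2) * conv3 (fc (cu t)) l) (at t within {0..Te})"
proof -
  obtain utt ux uxx where S: "\<forall>t\<in>{0..Te}.
        has_L2_derivative a b u (ut t) t {0..Te} \<and>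
        has_L2_derivative a b ut (utt t) t {0..Te} \<and>
        square_integrable a b (uxx t) \<and>
        (\<forall>x\<in>{a..b}. (u t has_real_derivative ux t x) (at x within {a..b}) \<and>
                     ux t x = ux t a + (LINT y:{a..x}|lebesgue. uxx t y)) \<and>
        u t a = u t b \<and> ux t a = ux t b \<and>
        (AE x in lebesgue. x \<in> {a<..<b} \<longrightarrow>
            utt t x - uxx t x + u t x + \<epsilon>\<^sup>2 * (u t x) ^ 3 = 0)"
    using sol unfolding nkg_solution_def by blast
  have tt: "t \<in> {0..Te}" using t by simp
  note St = S[rule_format, OF tt]
  have d1: "has_L2_derivative a b u (ut t) t {0..Te}" and d2: "has_L2_derivative a b ut (utt t) t {0..Te}"
    and sxx: "square_integrable a b (uxx t)" and per: "u t a = u t b" "ux t a = ux t b"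
    and pde: "AE x in lebesgue. x \<in> {a<..<b} \<longrightarrow> utt t x - uxx t x + u t x + \<epsilon>\<^sup>2 * (u t x) ^ 3 = 0"
    and du: "\<And>x. x \<in> {a..b} \<Longrightarrow> (u t has_real_derivative ux t x) (at x within {a..b})"
    and ux: "\<And>x. x \<in> {a..b} \<Longrightarrow> ux t x = ux t a + (LINT y:{a..x}|lebesgue. uxx t y)"
    using St by blast+
  have sxx': "sqi (\<lambda>x. of_real (uxx t x))" by (rule square_integrable_of_real[OF sxx])
  have stt: "sqi (\<lambda>x. of_real (utt t x))"
    using d2 by (auto simp: has_L2_derivative_def intro: square_integrable_of_real)
  have contu: "continuous_on {a..b} (u t)"
    using du by (meson has_real_derivative_imp_continuous_on DERIV_continuous_on)
  have contux: "continuous_on {a..b} (ux t)"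
  proof -
    have i: "set_integrable lebesgue {a..b} (uxx t)"
    proof -
      have "set_integrable lebesgue {a..b} (\<lambda>x. Re (complex_of_real (uxx t x)))"
        using integrable_Re[OF square_integrable_integrable[OF sxx', unfolded set_integrable_def]]
        by (simp add: set_integrable_def)
      then show ?thesis by simp
    qed
    have "ux t a + integral {a..x} (uxx t) = ux t x" if x: "x \<in> {a..b}" for x
    proof -
      have "set_integrable lebesgue {a..x} (uxx t)" by (rule set_integrable_subset[OF i]) (use x in auto)
      then show ?thesis using ux[OF x] by (simp add: set_lebesgue_integral_eq_integral)
    qed
    moreover have "continuous_on {a..b} (\<lambda>x. ux t a + integral {a..x} (uxx t))"
      by (intro continuous_intros indefinite_integral_continuous_1 set_lebesgue_integral_eq_integral(1) i)
    ultimately show ?thesis by (rule continuous_on_eq[rotated])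
  qed
  have ccu: "continuous_on {a..b} (cu t)" by (intro continuous_intros contu)
  then show su: "sqi (cu t)" by (rule square_integrable_continuous)
  have b1: "l1b (fc (cu t)) (bt_const * M)" by (rule h1b_l1b[OF bu[OF t]])
  obtain L where L: "\<And>x y. x \<in> {a..b} \<Longrightarrow> y \<in> {a..b} \<Longrightarrow> \<bar>u t x - u t y\<bar> \<le> L * \<bar>x - y\<bar>"
    using Lipschitz_of_continuous_derivative[OF du contux] by blast
  \<comment> \<open>The cube is taken pointwise, so u must equal its Fourier series at every point
    before the product formula can be applied.\<close>
  have inv: "cu t x = fser (fc (cu t)) x" if "x \<in> {a..b}" for x
    by (rule fser_inversion[OF ccu _ _ b1 that, of L])
      (use per L in \<open>auto simp flip: of_real_diff\<close>)
  show cube: "fc (\<lambda>x. of_real (u t x ^ 3)) = conv3 (fc (cu t))"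
  proof
    fix l
    have "fc (\<lambda>x. of_real (u t x ^ 3)) l = fc (fser (conv3 (fc (cu t)))) l"
      by (rule fc_cong) (simp add: fser_cube[OF b1, symmetric] inv[symmetric])
    then show "fc (\<lambda>x. of_real (u t x ^ 3)) l = conv3 (fc (cu t)) l"
      by (simp add: fc_fser[OF l1b_conv3[OF b1]])
  qed
  show "((\<lambda>t. fc (cu t) l) has_vector_derivative fc (cv t) l) (at t within {0..Te})"
    by (rule has_L2_derivative_fc[OF d1 tt])
  \<comment> \<open>Two applications of the integration by parts turn the second space derivative
    into - \<mu>_l^2. The second one handles a derivative that is merely square integrable.\<close>
  have x1: "fc (\<lambda>x. of_real (ux t x)) l = \<i> * of_real (mu a b l) * fc (cu t) l"
  proof (rule fc_indefinite_integral)
    show "sqi (\<lambda>x. of_real (ux t x))" by (intro square_integrable_continuous continuous_intros contux)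
    fix x assume x: "x \<in> {a..b}"
    have "(ux t has_integral (u t x - u t a)) {a..x}"
    proof (rule fundamental_theorem_of_calculus)
      fix y assume "y \<in> {a..x}"
      then show "(u t has_vector_derivative ux t y) (at y within {a..x})"
        using x DERIV_subset[OF du[of y], of "{a..x}"]
        by (auto simp: has_real_derivative_iff_has_vector_derivative)
    qed (use x in simp)
    then have "integral {a..x} (ux t) = u t x - u t a" by (rule integral_unique)
    moreover have "set_integrable lebesgue {a..x} (ux t)"
      by (rule absolutely_integrable_continuous_real) (use contux x in \<open>auto intro: continuous_on_subset\<close>)
    ultimately show "cu t x = cu t a + (LINT y:{a..x}|lebesgue. of_real (ux t y))"
      by (simp add: set_integral_complex_of_real set_lebesgue_integral_eq_integral)
  qed (use per in simp)
  have x2: "fc (\<lambda>x. of_real (uxx t x)) l = \<i> * of_real (mu a b l) * fc (\<lambda>x. of_real (ux t x)) l"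
  proof (rule fc_indefinite_integral[OF sxx'])
    fix x assume x: "x \<in> {a..b}"
    show "complex_of_real (ux t x) = of_real (ux t a) + (LINT y:{a..x}|lebesgue. of_real (uxx t y))"
      unfolding set_integral_complex_of_real of_real_add[symmetric] ux[OF x, symmetric] ..
  qed (use per in simp)
  have xx: "fc (\<lambda>x. of_real (uxx t x)) l = - of_real ((mu a b l)\<^sup>2) * fc (cu t) l"
    unfolding x2 x1 by (simp add: power2_eq_square algebra_simps)
  have su3: "sqi (\<lambda>x. of_real (\<epsilon>\<^sup>2) * of_real (u t x ^ 3))"
    by (intro square_integrable_continuous continuous_intros contu)
  define d where "d x = (complex_of_real (utt t x) - of_real (uxx t x)) + (cu t x + of_real (\<epsilon>\<^sup>2) * of_real (u t x ^ 3))" for x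
  have fd: "fc d l = (fc (\<lambda>x. of_real (utt t x)) l - fc (\<lambda>x. of_real (uxx t x)) l)
      + (fc (cu t) l + of_real (\<epsilon>\<^sup>2) * conv3 (fc (cu t)) l)"
    unfolding d_def fc_add[OF square_integrable_diff[OF stt sxx'] square_integrable_add[OF su su3]]
      fc_diff[OF stt sxx'] fc_add[OF su su3] fc_cmult cube ..
  \<comment> \<open>The equation is assumed on the open interval; the two endpoints form a null
    set.\<close>
  have "AE x in lebesgue. indicator {a..b} x *\<^sub>R (d x * ew (- l) x) = 0"
  proof -
    have "{a, b} \<in> null_sets lebesgue"
      by (intro null_sets_completionI finite_imp_null_set_lborel) simp
    from AE_not_in[OF this] show ?thesis using pde
    proof eventually_elim
      case (elim x)
      show ?case
      proof (cases "x \<in> {a..b}")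
        case True
        then have "x \<in> {a<..<b}" using elim by auto
        then have "d x = of_real 0"
          unfolding d_def using elim(2) by (simp flip: of_real_diff of_real_mult of_real_add of_real_power)
        then show ?thesis by simp
      qed simp
    qed
  qed
  then have "fc d l = 0" unfolding fc_eq set_lebesgue_integral_def by (subst integral_eq_zero_AE) auto
  then have utt: "fc (\<lambda>x. of_real (utt t x)) l = - of_real ((bt l)\<^sup>2) * fc (cu t) l - of_real (\<epsilon>\<^sup>2) * conv3 (fc (cu t)) l"
    unfolding fd xx by (simp add: bt_sq algebra_simps add_eq_0_iff)
  show "((\<lambda>t. fc (cv t) l) has_vector_derivative
      - of_real ((bt l)\<^sup>2) * fc (cu t) l - of_real (\<epsilon>\<^sup>2) * conv3 (fc (cu t)) l) (at t within {0..Te})"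
    unfolding utt[symmetric] by (rule has_L2_derivative_fc[OF d2 tt])
qed

sublocale kg_flow bt bt_const "\<lambda>t. fc (cu t)" "\<lambda>t. fc (cv t)" "\<epsilon>\<^sup>2" Te M
proof
  fix t l assume t: "0 \<le> t" "t \<le> Te"
  show "fc (cu t) (- l) = cnj (fc (cu t) l)" using fc_cnj[of "cu t" "- l"] by simp
  show "fc (cv t) (- l) = cnj (fc (cv t) l)" using fc_cnj[of "cv t" "- l"] by simp
qed (use coefficients bu bv in auto)

lemma strang_coefficients:
  "sqi (strang_psi a b \<epsilon> \<tau> u0 u1 k)"
  "\<exists>B. l1b (\<lambda>l. of_real (bt l) * fc (strang_psi a b \<epsilon> \<tau> u0 u1 k) l) B"
  "fc (strang_psi a b \<epsilon> \<tau> u0 u1 0) = psi 0"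
  "fc (strang_psi a b \<epsilon> \<tau> u0 u1 (Suc k)) l = strang_coeff_step (\<epsilon>\<^sup>2) \<tau> (fc (strang_psi a b \<epsilon> \<tau> u0 u1 k)) l"
proof -
  have t0: "0 \<le> (0::real)" "0 \<le> Te" using Te by auto
  have u0: "complex_of_real (u0 x) = cu 0 x" "complex_of_real (u1 x) = cv 0 x" if "x \<in> {a..b}" for x
    using sol that unfolding nkg_solution_def by auto
  have su0: "sqi (\<lambda>x. of_real (u0 x))"
    using coefficients(1)[OF t0] square_integrable_cong[of a b "\<lambda>x. complex_of_real (u0 x)" "cu 0"] u0(1) by blast
  have fu0: "fc (\<lambda>x. of_real (u0 x)) l = fc (cu 0) l" "fc (\<lambda>x. of_real (u1 x)) l = fc (cv 0) l" for l
    using u0 by (auto intro!: fc_cong)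
  have w: "l1b (\<lambda>l. of_real (1 / bt l) * fc (cv 0) l) (bt_const * M)"
    by (rule l2b_mult_l1b[OF l2b_inverse bv[OF t0]])
  have j: "japanese_inv a b (\<lambda>y. of_real (u1 y)) = fser (\<lambda>l. of_real (1 / bt l) * fc (cv 0) l)"
    unfolding japanese_inv_eq fu0 ..
  have s0: "sqi (\<lambda>x. \<i> * fser (\<lambda>l. of_real (1 / bt l) * fc (cv 0) l) x)"
    by (intro square_integrable_mult_continuous sqi_fser[OF w] continuous_intros)
  have sq0: "sqi (strang_psi a b \<epsilon> \<tau> u0 u1 0)"
    unfolding strang_psi.simps j by (intro square_integrable_diff su0 s0)
  show c0: "fc (strang_psi a b \<epsilon> \<tau> u0 u1 0) = psi 0"
    unfolding strang_psi.simps j fc_diff[OF su0 s0, abs_def] fc_cmult fc_fser[OF w] fu0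
    by (rule ext) (simp add: psi_def)
  show l1: "\<exists>B. l1b (\<lambda>l. of_real (bt l) * fc (strang_psi a b \<epsilon> \<tau> u0 u1 k) l) B" for k
  proof (induction k)
    case 0
    \<comment> \<open>Data in H^2 and H^1 make \<beta> times the coefficients of psi an H^1
      sequence, which is absolutely summable.\<close>
    obtain A B where A: "l2b (\<lambda>l. of_real ((bt l)\<^sup>2) * fc (cu 0) l) A" and B: "l2b (\<lambda>l. of_real (bt l) * fc (cv 0) l) B"
      using reg0 by blast
    have "l2b (\<lambda>l. of_real ((bt l)\<^sup>2) * fc (cu 0) l - \<i> * (of_real (bt l) * fc (cv 0) l)) (A + B)"
      by (intro l2b_diff A l2b_dominated[OF B]) (simp add: norm_mult)
    then have "h1b (\<lambda>l. of_real (bt l) * psi 0 l) (A + B)"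
      unfolding h1b_def by (rule l2b_dominated) (simp add: psi_def power2_eq_square right_diff_distrib mult_ac)
    then show ?case unfolding c0 using h1b_l1b by blast
  next
    case (Suc k)
    then obtain B where "l1b (\<lambda>l. of_real (bt l) * fc (strang_psi a b \<epsilon> \<tau> u0 u1 k) l) B" by blast
    from strang_step(3)[OF this, of \<tau> "\<epsilon>\<^sup>2"] show ?case by (simp add: Let_def)
  qed
  show "sqi (strang_psi a b \<epsilon> \<tau> u0 u1 k)"
  proof (cases k)
    case (Suc k')
    obtain B where "l1b (\<lambda>l. of_real (bt l) * fc (strang_psi a b \<epsilon> \<tau> u0 u1 k') l) B" using l1 by blast
    from strang_step(1)[OF this, of \<tau> "\<epsilon>\<^sup>2"] show ?thesis by (simp add: Let_def Suc)
  qed (use sq0 in simp)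
  obtain B where "l1b (\<lambda>l. of_real (bt l) * fc (strang_psi a b \<epsilon> \<tau> u0 u1 k) l) B" using l1 by blast
  from strang_step(2)[OF this, of \<tau> "\<epsilon>\<^sup>2"]
  show "fc (strang_psi a b \<epsilon> \<tau> u0 u1 (Suc k)) l = strang_coeff_step (\<epsilon>\<^sup>2) \<tau> (fc (strang_psi a b \<epsilon> \<tau> u0 u1 k)) l"
    by (simp add: Let_def)
qed

end

section \<open>The error bounds\<close>

context weights
begin

definition nrm :: "(int \<Rightarrow> complex) \<Rightarrow> int \<Rightarrow> complex" where
  "nrm f l = of_real (cmod (f l))"

lemma l2b_nrm: "l2b f B \<Longrightarrow> l2b (nrm f) B"
  by (erule l2b_dominated) (simp add: nrm_def)

lemma l1b_nrm: "l1b f B \<Longrightarrow> l1b (nrm f) B"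
  by (erule l1b_dominated) (simp add: nrm_def)

text \<open>The k-th power of the weight falls on one factor while the other is measured in l^1, so
  the estimate is linear in the high norm; this lets regularity propagate without a smallness
  condition. The pointwise comparison is made with convolutions of moduli.\<close>

lemma l2b_weight_conv:
  assumes f: "l1b f A" and g: "l1b g A'"
    and wf: "l2b (\<lambda>l. of_real (\<beta> l ^ k) * f l) B" and wg: "l2b (\<lambda>l. of_real (\<beta> l ^ k) * g l) B'"
  shows "l2b (\<lambda>l. of_real (\<beta> l ^ k) * conv f g l) (2 ^ k * (B * A' + A * B'))"
proof -
  define F where "F = (\<lambda>l. of_real (\<beta> l ^ k) * f l)"
  define G where "G = (\<lambda>l. of_real (\<beta> l ^ k) * g l)"
  have FB: "l2b F B" and GB: "l2b G B'" using wf wg by (simp_all add: F_def G_def)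
  have 1: "l2b (\<lambda>l. conv (nrm F) (nrm g) l + conv (nrm f) (nrm G) l) (B * A' + A * B')"
    by (intro l2b_add young_l2' young_l2 l2b_nrm l1b_nrm FB GB f g)
  show ?thesis
  proof (rule l2b_scale[OF 1])
    fix l
    define x where "x j = cmod (F j) * cmod (g (l - j))" for j
    define y where "y j = cmod (f j) * cmod (G (l - j))" for j
    have nx: "cmod (nrm F j * nrm g (l - j)) = x j" and ny: "cmod (nrm f j * nrm G (l - j)) = y j" for j
      by (simp_all add: x_def y_def nrm_def norm_mult)
    have sx: "x summable_on UNIV"
      using conv_summable[OF l1b_nrm[OF g] l2b_nrm[OF FB], of l]
        summable_on_reindex_bij_witness[of UNIV "\<lambda>k. l - k" "\<lambda>k. l - k" UNIV x "\<lambda>k. cmod (nrm g k * nrm F (l - k))"]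
      by (simp add: x_def nrm_def norm_mult mult.commute)
    have sy: "y summable_on UNIV"
      using conv_summable[OF l1b_nrm[OF f] l2b_nrm[OF GB], of l] by (simp add: ny)
    have cx: "conv (nrm F) (nrm g) l = of_real (\<Sum>\<^sub>\<infinity>j. x j)"
    proof -
      have "conv (nrm F) (nrm g) l = (\<Sum>\<^sub>\<infinity>j. of_real (x j))" by (simp add: conv_def x_def nrm_def)
      also have "\<dots> = of_real (\<Sum>\<^sub>\<infinity>j. x j)" by (rule infsumI[OF has_sum_of_real[OF has_sum_infsum[OF sx]]])
      finally show ?thesis .
    qed
    have cy: "conv (nrm f) (nrm G) l = of_real (\<Sum>\<^sub>\<infinity>j. y j)"
    proof -
      have "conv (nrm f) (nrm G) l = (\<Sum>\<^sub>\<infinity>j. of_real (y j))" by (simp add: conv_def y_def nrm_def)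
      also have "\<dots> = of_real (\<Sum>\<^sub>\<infinity>j. y j)" by (rule infsumI[OF has_sum_of_real[OF has_sum_infsum[OF sy]]])
      finally show ?thesis .
    qed
    have sz: "(\<lambda>j. 2 ^ k * (x j + y j)) summable_on UNIV"
      by (intro summable_on_cmult_right summable_on_add sx sy)
    have p: "cmod (of_real (\<beta> l ^ k) * (f j * g (l - j))) \<le> 2 ^ k * (x j + y j)" for j
    proof -
      \<comment> \<open>\<beta> l is at most twice the larger of the two weights, which gives the
        factor 2^k.\<close>
      have "\<beta> l \<le> \<beta> j + \<beta> (l - j)" using beta_triangle[of j "l - j"] by simp
      also have "\<dots> \<le> 2 * max (\<beta> j) (\<beta> (l - j))" by simp
      finally have "\<beta> l ^ k \<le> (2 * max (\<beta> j) (\<beta> (l - j))) ^ k"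
        using beta_pos[of l] by (intro power_mono) auto
      also have "\<dots> = 2 ^ k * max (\<beta> j) (\<beta> (l - j)) ^ k" by (rule power_mult_distrib)
      also have "max (\<beta> j) (\<beta> (l - j)) ^ k \<le> \<beta> j ^ k + \<beta> (l - j) ^ k"
        using beta_pos[of j] beta_pos[of "l - j"] by (simp add: max_def)
      finally have "\<beta> l ^ k \<le> 2 ^ k * (\<beta> j ^ k + \<beta> (l - j) ^ k)" by simp
      then have "\<beta> l ^ k * (cmod (f j) * cmod (g (l - j))) \<le>
          2 ^ k * (\<beta> j ^ k + \<beta> (l - j) ^ k) * (cmod (f j) * cmod (g (l - j)))"
        by (intro mult_right_mono) auto
      then show ?thesis
        by (simp add: norm_mult norm_power x_def y_def F_def G_def algebra_simps)
    qed
    have "of_real (\<beta> l ^ k) * conv f g l = (\<Sum>\<^sub>\<infinity>j. of_real (\<beta> l ^ k) * (f j * g (l - j)))"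
      unfolding conv_def by (rule infsum_cmult_right'[symmetric])
    also have "cmod \<dots> \<le> (\<Sum>\<^sub>\<infinity>j. 2 ^ k * (x j + y j))"
      by (rule norm_infsum_le[OF _ has_sum_infsum[OF sz] p]) 
        (rule has_sum_infsum, rule abs_summable_summable, rule summable_on_comparison_test[OF sz], use p in auto)
    also have "\<dots> = 2 ^ k * ((\<Sum>\<^sub>\<infinity>j. x j) + (\<Sum>\<^sub>\<infinity>j. y j))"
      by (simp add: infsum_cmult_right' infsum_add[OF sx sy])
    also have "\<dots> \<le> 2 ^ k * cmod (conv (nrm F) (nrm g) l + conv (nrm f) (nrm G) l)"
      unfolding cx cy of_real_add[symmetric] norm_of_real by simp
    finally show "cmod (of_real (\<beta> l ^ k) * conv f g l)
        \<le> 2 ^ k * cmod (conv (nrm F) (nrm g) l + conv (nrm f) (nrm G) l)" .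
  qed simp
qed

lemma l2b_weight_rp:
  assumes "l2b (\<lambda>l. of_real (\<beta> l ^ k) * f l) B"
  shows "l2b (\<lambda>l. of_real (\<beta> l ^ k) * rp f l) B"
  using l2b_rp[OF assms] by (rule l2b_dominated) (simp add: rp_def beta_minus ring_distribs)

lemma l2b_tail:
  assumes "l2b (\<lambda>l. of_real (w l) * f l) D" "\<And>l. n < \<bar>l\<bar> \<Longrightarrow> 1 \<le> r * w l" "0 \<le> r" "\<And>l. 0 \<le> w l"
  shows "l2b (\<lambda>l::int. if \<bar>l\<bar> \<le> n then 0 else f l) (r * D)"
proof (rule l2b_scale[OF assms(1)])
  fix l
  show "cmod (if \<bar>l\<bar> \<le> n then 0 else f l) \<le> r * cmod (of_real (w l) * f l)"
    using mult_right_mono[OF assms(2)[of l], of "cmod (f l)"] assms(3,4) by (auto simp: norm_mult mult.assoc)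
qed (rule assms(3))

end

context kg_flow
begin

lemma rp_psi: "0 \<le> t \<Longrightarrow> t \<le> Te \<Longrightarrow> rp (psi t) = U t"
  using rp_phi[of t] by (simp add: phi_def lin_lin lin_0)

text \<open>The equation gains one derivative, so regularity of the data propagates with bounds that only
  involve $\varepsilon^2 T_\varepsilon$.\<close>

lemma regularity_gain:
  assumes eT: "e * Te \<le> T" and D: "\<And>t. 0 \<le> t \<Longrightarrow> t \<le> Te \<Longrightarrow> l2b (\<lambda>l. of_real (\<beta> l ^ k) * U t l) D"
    and D0: "l2b (\<lambda>l. of_real (\<beta> l ^ Suc k) * psi 0 l) D0"
    and t: "0 \<le> t" "t \<le> Te"
  defines "G \<equiv> 2 ^ k * (D * (K * M * (K * M)) + K * M * (2 ^ k * (D * (K * M) + K * M * D)))"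
  shows "l2b (\<lambda>l. of_real (\<beta> l ^ Suc k) * psi t l) (D0 + T * G)"
proof -
  have l1: "l1b (U s) (K * M)" if "0 \<le> s" "s \<le> Te" for s by (rule h1b_l1b[OF bound_U[OF that]])
  have c3: "l2b (\<lambda>l. of_real (\<beta> l ^ k) * conv3 (U s) l) G" if "0 \<le> s" "s \<le> Te" for s
    unfolding conv3_def G_def
    by (intro l2b_weight_conv l1 young_l1 D that)
  have G0: "0 \<le> G" by (rule l2b_nonneg[OF c3[OF t]])
  have "l2b (\<lambda>l. of_real (\<beta> l ^ k) * (of_real (\<beta> l) * phi t l) - of_real (\<beta> l ^ k) * (of_real (\<beta> l) * phi 0 l)) (e * G * (t - 0))"
  proof (rule l2b_mvt[OF t(1)])
    fix s l assume s: "0 \<le> s" "s \<le> t"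
    show "((\<lambda>s. of_real (\<beta> l ^ k) * (of_real (\<beta> l) * phi s l)) has_vector_derivative
        of_real (\<beta> l ^ k) * (\<i> * of_real e * nl s (phi s) l)) (at s within {0..t})"
      using s t by (intro has_vector_derivative_mult_right deriv_within_subinterval[OF deriv_phi]) auto
  next
    fix s assume s: "0 \<le> s" "s \<le> t"
    then have sT: "0 \<le> s" "s \<le> Te" using t by auto
    show "l2b (\<lambda>l. of_real (\<beta> l ^ k) * (\<i> * of_real e * nl s (phi s) l)) (e * G)"
      by (rule l2b_scale[OF c3[OF sT]]) (use e_nonneg in \<open>auto simp: nl_phi[OF sT] norm_mult\<close>)
  qed
  then have 1: "l2b (\<lambda>l. of_real (\<beta> l ^ Suc k) * phi t l - of_real (\<beta> l ^ Suc k) * phi 0 l) (e * G * t)"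
    by (simp add: mult_ac)
  have "e * G * t \<le> T * G"
  proof -
    have "e * t \<le> T" using mult_left_mono[OF t(2) e_nonneg] eT by linarith
    from mult_right_mono[OF this G0] show ?thesis by (simp add: mult_ac)
  qed
  from l2b_mono[OF 1 this]
  have 2: "l2b (\<lambda>l. of_real (\<beta> l ^ Suc k) * phi t l - of_real (\<beta> l ^ Suc k) * phi 0 l) (T * G)" .
  have 3: "l2b (\<lambda>l. of_real (\<beta> l ^ Suc k) * phi 0 l) D0"
    by (rule l2b_dominated[OF D0]) (simp add: phi_def norm_mult)
  have "l2b (\<lambda>l. of_real (\<beta> l ^ Suc k) * phi t l) (D0 + T * G)"
    using l2b_add[OF 3 2] by simp
  then show ?thesis by (rule l2b_dominated) (simp add: phi_def norm_mult)
qed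

end

lemma strang_error_le_mono:
  "strang_error_le a b T \<epsilon> \<tau> u0 u1 u ut B \<Longrightarrow> B \<le> B' \<Longrightarrow> strang_error_le a b T \<epsilon> \<tau> u0 u1 u ut B'"
  unfolding strang_error_le_def Let_def by fastforce

section \<open>Transfer of the coefficient bound to functions\<close>

context nkg
begin

text \<open>The error in u is the real part of the error in psi, and the error in the time
  derivative is i/2 times \<beta> err minus its reflected conjugate. Each is bounded by the H^1
  error of psi, hence the factor 2.\<close>

lemma strang_error:
  assumes tau: "0 < \<tau>" and C: "0 \<le> C" and Te_eq: "Te = T / \<epsilon>\<^sup>2" and eps: "\<epsilon> \<noteq> 0"
    and n: "\<And>l. \<bar>l\<bar> \<le> 3 * n \<Longrightarrow> bt l \<le> B"
    and quad: "\<And>\<theta> k. \<bar>\<theta>\<bar> \<le> 4 * B \<Longrightarrow> cmod (quad_err \<tau> k \<theta>) \<le> C * \<tau>\<^sup>2 * \<bar>\<theta>\<bar>"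
    and tail: "\<And>t. 0 \<le> t \<Longrightarrow> t \<le> Te \<Longrightarrow> l2b (\<lambda>l. if \<bar>l\<bar> \<le> n then 0 else psi t l) \<eta>"
    and small: "defect_const T C * (\<epsilon>\<^sup>2 * \<tau>\<^sup>2 + \<eta>) * exp (growth_const * T) \<le> 1"
  shows "strang_error_le a b T \<epsilon> \<tau> u0 u1 u ut (2 * (defect_const T C * (\<epsilon>\<^sup>2 * \<tau>\<^sup>2 + \<eta>) * exp (growth_const * T)))"
  unfolding strang_error_le_def Let_def
proof (intro allI impI)
  fix k :: nat assume "real k \<le> T / \<epsilon>\<^sup>2 / \<tau>"
  then have kT: "real k * \<tau> \<le> Te" unfolding Te_eq pos_le_divide_eq[OF tau] .
  define t where "t = real k * \<tau>"
  have t: "0 \<le> t" "t \<le> Te" using kT tau by (auto simp: t_def)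
  define E where "E = defect_const T C * (\<epsilon>\<^sup>2 * \<tau>\<^sup>2 + \<eta>) * exp (growth_const * T)"
  define \<psi> where "\<psi> = strang_psi a b \<epsilon> \<tau> u0 u1 k"
  define c where "c = fc \<psi>"
  define err where "err l = psi t l - c l" for l
  have err: "h1b err E"
    unfolding err_def E_def t_def c_def \<psi>_def
    by (rule splitting_error[where c = "\<lambda>k. fc (strang_psi a b \<epsilon> \<tau> u0 u1 k)" and B = B, OF tau _ C n quad tail _ _ small kT])
      (use strang_coefficients(3,4) eps in \<open>auto simp: Te_eq strang_coeff_step_def\<close>)
  have s\<psi>: "sqi \<psi>" unfolding \<psi>_def by (rule strang_coefficients(1))
  note sc = square_integrable_cnj[OF s\<psi>]
  obtain B' where B': "l1b (\<lambda>l. of_real (bt l) * c l) B'"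
    using strang_coefficients(2)[of \<tau> k] unfolding c_def \<psi>_def by blast
  have su_eq: "strang_u a b \<epsilon> \<tau> u0 u1 k = (\<lambda>x. 1 / 2 * (\<psi> x + cnj (\<psi> x)))"
    by (rule ext) (simp add: strang_u_def \<psi>_def)
  have ssu: "sqi (strang_u a b \<epsilon> \<tau> u0 u1 k)"
    unfolding su_eq by (intro square_integrable_mult_continuous square_integrable_add s\<psi> sc continuous_intros)
  have fsu: "fc (strang_u a b \<epsilon> \<tau> u0 u1 k) l = rp c l" for l
    unfolding su_eq fc_cmult fc_add[OF s\<psi> sc] fc_cnj by (simp add: rp_def c_def)
  define w where "w l = of_real (bt l) * (c l - cnj (c (- l)))" for l
  have w1: "l1b w (B' + B')"
    unfolding w_def right_diff_distrib
    by (rule l1b_diff[OF B' l1b_dominated[OF l1b_reindex[OF B', of uminus]]])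
      (auto simp: norm_mult beta_minus)
  have "(\<lambda>l. of_real (bt l) * fc (\<lambda>x. \<psi> x - cnj (\<psi> x)) l) = w"
    by (rule ext) (simp add: fc_diff[OF s\<psi> sc] fc_cnj w_def c_def)
  then have sv_eq: "strang_v a b \<epsilon> \<tau> u0 u1 k = (\<lambda>x. \<i> / 2 * fser w x)"
    unfolding strang_v_def[abs_def] \<psi>_def[symmetric] japanese_eq by simp
  have ssv: "sqi (strang_v a b \<epsilon> \<tau> u0 u1 k)"
    unfolding sv_eq by (intro square_integrable_mult_continuous sqi_fser[OF w1] continuous_intros)
  have fsv: "fc (strang_v a b \<epsilon> \<tau> u0 u1 k) l = \<i> / 2 * w l" for l
    unfolding sv_eq fc_cmult fc_fser[OF w1] ..
  define eu where "eu = (\<lambda>x. cu t x - strang_u a b \<epsilon> \<tau> u0 u1 k x)"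
  define ev where "ev = (\<lambda>x. cv t x - strang_v a b \<epsilon> \<tau> u0 u1 k x)"
  have seu: "sqi eu" unfolding eu_def by (intro square_integrable_diff coefficients(1)[OF t] ssu)
  have sev: "sqi ev" unfolding ev_def by (intro square_integrable_diff sqi_cv[OF t] ssv)
  have feu: "fc eu l = rp err l" for l
    unfolding eu_def fc_diff[OF coefficients(1)[OF t] ssu] fsu rp_psi[OF t, symmetric] err_def[abs_def] rp_diff ..
  have fev: "fc ev l = \<i> / 2 * (of_real (bt l) * err l - cnj (of_real (bt (- l)) * err (- l)))" for l
  proof -
    have "fc (cv t) l = \<i> / 2 * (of_real (bt l) * (psi t l - cnj (psi t (- l))))"
      by (simp add: psi_def beta_minus sym_U[OF t] sym_V[OF t] field_simps)
    then show ?thesis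
      unfolding ev_def fc_diff[OF sqi_cv[OF t] ssv] fsv w_def err_def
      by (simp add: beta_minus algebra_simps)
  qed
  have 1: "l2b (\<lambda>l. of_real (bt l ^ 1) * fc eu l) E"
    unfolding feu using l2b_weight_rp[of 1 err E] err by (simp add: h1b_def)
  have 2: "l2b (\<lambda>l. of_real (bt l ^ 0) * fc ev l) E"
  proof -
    define y where "y l = of_real (bt l) * err l" for l
    have y: "l2b y E" using err by (simp add: h1b_def y_def[abs_def])
    have y': "l2b (\<lambda>l. cnj (y (- l))) E"
      by (rule l2b_dominated[OF l2b_reindex[OF y, of uminus]]) auto
    have "l2b (fc ev) (1 / 2 * (E + E))"
      unfolding fev[abs_def] y_def[symmetric]
      by (rule l2b_scale[OF l2b_diff[OF y y']]) (auto simp: norm_mult norm_divide)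
    then show ?thesis by simp
  qed
  show "eu \<in> hspace a b 1 \<and> ev \<in> hspace a b 0 \<and> hnorm a b 1 eu + hnorm a b 0 ev \<le> 2 * E"
    using l2b_hspace[OF seu 1] l2b_hspace[OF sev 2] by simp
qed

end

section \<open>The step restriction and constants uniform in the parameters\<close>

context interval
begin

text \<open>An upper bound for the weight of frequencies with |l| \<le> 1/\<tau>0. The prescribed
  step bound is pi / 2 divided by it, so the four weights in a phase allow \<tau> |\<theta>| up to 2
  pi \<alpha>.\<close>

definition step_freq :: "real \<Rightarrow> real" where
  "step_freq \<tau>0 = sqrt (1 + 4 * pi\<^sup>2 * (1 + 1 / \<tau>0\<^sup>2) / (b - a)\<^sup>2)"

lemma step_bound_eq:
  assumes "0 < \<tau>0" shows "step_bound a b \<tau>0 = pi / (2 * step_freq \<tau>0)"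
proof -
  have "\<tau>0\<^sup>2 * (b - a)\<^sup>2 + 4 * pi\<^sup>2 * (1 + \<tau>0\<^sup>2) = (\<tau>0 * (b - a))\<^sup>2 * (1 + 4 * pi\<^sup>2 * (1 + 1 / \<tau>0\<^sup>2) / (b - a)\<^sup>2)"
  proof -
    have "x\<^sup>2 * y\<^sup>2 + 4 * pi\<^sup>2 * (1 + x\<^sup>2) = (x * y)\<^sup>2 * (1 + 4 * pi\<^sup>2 * (1 + 1 / x\<^sup>2) / y\<^sup>2)"
      if "x > 0" "y > 0" for x y :: real
      using that by (simp add: field_simps)
    from this[OF assms, of "b - a"] show ?thesis using ab by simp
  qed
  then have "sqrt (\<tau>0\<^sup>2 * (b - a)\<^sup>2 + 4 * pi\<^sup>2 * (1 + \<tau>0\<^sup>2)) = \<tau>0 * (b - a) * step_freq \<tau>0"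
    using assms ab by (simp add: real_sqrt_mult step_freq_def)
  then show ?thesis using assms ab by (simp add: step_bound_def)
qed

lemma step_freq_ge_1: "1 \<le> step_freq \<tau>0"
  using ab by (simp add: step_freq_def)

text \<open>The cutoff is 1/(3 \<tau>0) so that sums of three retained frequencies stay below
  1/\<tau>0.\<close>

lemma bt_le_step_freq:
  assumes "0 < \<tau>0" "\<bar>l\<bar> \<le> 3 * \<lfloor>1 / (3 * \<tau>0)\<rfloor>"
  shows "bt l \<le> step_freq \<tau>0"
proof -
  have "real_of_int \<bar>l\<bar> \<le> 3 * of_int \<lfloor>1 / (3 * \<tau>0)\<rfloor>" using assms(2) by linarith
  also have "\<dots> \<le> 3 * (1 / (3 * \<tau>0))" by (intro mult_left_mono of_int_floor_le) simp
  finally have "\<bar>real_of_int l\<bar> \<le> 1 / \<tau>0" by simp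
  then have "(real_of_int l)\<^sup>2 \<le> (1 / \<tau>0)\<^sup>2" by (metis abs_ge_zero power2_abs power_mono)
  then have "(real_of_int l)\<^sup>2 \<le> 1 + 1 / \<tau>0\<^sup>2" by (simp add: power_divide)
  then have "4 * pi\<^sup>2 * (real_of_int l)\<^sup>2 / (b - a)\<^sup>2 \<le> 4 * pi\<^sup>2 * (1 + 1 / \<tau>0\<^sup>2) / (b - a)\<^sup>2"
    by (intro divide_right_mono mult_left_mono) auto
  then show ?thesis
    unfolding bt_def step_freq_def by (intro real_sqrt_le_mono) (simp add: mu_def power_mult_distrib power_divide)
qed

lemma mu_tail:
  assumes "0 < \<tau>0" "\<lfloor>1 / (3 * \<tau>0)\<rfloor> < \<bar>l\<bar>"
  shows "2 * pi / (3 * (b - a)) / \<tau>0 \<le> \<bar>mu a b l\<bar>"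
proof -
  have "1 / (3 * \<tau>0) < real_of_int \<bar>l\<bar>" using assms(2) by (simp add: floor_less_iff)
  then have "2 * pi / (b - a) * (1 / (3 * \<tau>0)) \<le> 2 * pi / (b - a) * real_of_int \<bar>l\<bar>"
    using ab by (intro mult_left_mono) auto
  then show ?thesis using ab by (simp add: mu_def abs_mult mult_ac)
qed

text \<open>Makes \<tau> = O(\<tau>0), so that small \<tau>0 alone renders the error bound small
  enough for the bootstrap.\<close>

lemma step_bound_upper:
  assumes "0 < \<tau>0" shows "step_bound a b \<tau>0 \<le> (b - a) * \<tau>0 / 4"
proof -
  have "sqrt ((2 * pi / (\<tau>0 * (b - a)))\<^sup>2) \<le> step_freq \<tau>0"
    unfolding step_freq_def
    by (intro real_sqrt_le_mono) (simp add: power_divide power_mult_distrib distrib_left add_divide_distrib)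
  then have "2 * pi / (\<tau>0 * (b - a)) \<le> step_freq \<tau>0" using ab assms by simp
  then have "pi / (2 * step_freq \<tau>0) \<le> pi / (2 * (2 * pi / (\<tau>0 * (b - a))))"
    using ab assms by (intro divide_left_mono mult_left_mono mult_pos_pos) (auto intro: divide_pos_pos less_le_trans[OF _ step_freq_ge_1])
  also have "\<dots> = (b - a) * \<tau>0 / 4" by simp
  finally show ?thesis by (simp only: step_bound_eq[OF assms])
qed

text \<open>Allows \<tau>0 to be chosen proportional to a given \<tau> without violating the step
  restriction.\<close>

lemma step_bound_lower:
  obtains s where "s > 0" "\<And>\<tau>0. 0 < \<tau>0 \<Longrightarrow> \<tau>0 \<le> 1 \<Longrightarrow> s * \<tau>0 \<le> step_bound a b \<tau>0"
proof
  define q where "q = sqrt ((b - a)\<^sup>2 + 4 * pi\<^sup>2 * (1 + 1))"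
  have q: "q > 0" using ab by (simp add: q_def add_pos_pos)
  show "pi * (b - a) / (2 * q) > 0" using q ab by simp
  fix \<tau>0 :: real assume t: "0 < \<tau>0" "\<tau>0 \<le> 1"
  have "\<tau>0\<^sup>2 \<le> 1" using t by (simp add: power_le_one)
  then have "\<tau>0\<^sup>2 * (b - a)\<^sup>2 \<le> 1 * (b - a)\<^sup>2" "4 * pi\<^sup>2 * (1 + \<tau>0\<^sup>2) \<le> 4 * pi\<^sup>2 * (1 + 1)"
    by (intro mult_right_mono mult_left_mono; simp)+
  then have "sqrt (\<tau>0\<^sup>2 * (b - a)\<^sup>2 + 4 * pi\<^sup>2 * (1 + \<tau>0\<^sup>2)) \<le> q"
    unfolding q_def by (intro real_sqrt_le_mono add_mono) (simp_all only: mult_1)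
  moreover have "0 < sqrt (\<tau>0\<^sup>2 * (b - a)\<^sup>2 + 4 * pi\<^sup>2 * (1 + \<tau>0\<^sup>2))"
    using t by (simp add: add_nonneg_pos add_pos_nonneg)
  ultimately have "pi * (b - a) * \<tau>0 / (2 * q) \<le> step_bound a b \<tau>0"
    unfolding step_bound_def using t ab q by (intro divide_left_mono) auto
  then show "pi * (b - a) / (2 * q) * \<tau>0 \<le> step_bound a b \<tau>0" by simp
qed

definition solution_psi :: "(real \<Rightarrow> real) \<Rightarrow> (real \<Rightarrow> real) \<Rightarrow> int \<Rightarrow> complex" where
  "solution_psi v w l = fc (\<lambda>x. of_real (v x)) l - \<i> * fc (\<lambda>x. of_real (w x)) l / of_real (bt l)"

abbreviation tail :: "real \<Rightarrow> (int \<Rightarrow> complex) \<Rightarrow> int \<Rightarrow> complex" where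
  "tail \<tau>0 f \<equiv> \<lambda>l. if \<bar>l\<bar> \<le> \<lfloor>1 / (3 * \<tau>0)\<rfloor> then 0 else f l"

lemma uniform_error:
  fixes \<alpha> :: real
  assumes alpha: "0 < \<alpha>" "\<alpha> < 1"
  obtains C where "C > 0"
    "\<And>\<epsilon> \<tau> \<tau>0 \<eta> u0 u1 u ut. nkg a b \<epsilon> (T / \<epsilon>\<^sup>2) M u0 u1 u ut \<Longrightarrow> 0 < \<epsilon> \<Longrightarrow> 0 < \<tau>0 \<Longrightarrow>
      0 < \<tau> \<Longrightarrow> \<tau> < \<alpha> * step_bound a b \<tau>0 \<Longrightarrow>
      (\<And>t. 0 \<le> t \<Longrightarrow> t \<le> T / \<epsilon>\<^sup>2 \<Longrightarrow>
        l2b (tail \<tau>0 (solution_psi (u t) (ut t))) \<eta>) \<Longrightarrow>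
      C * (\<epsilon>\<^sup>2 * \<tau>\<^sup>2 + \<eta>) \<le> 1 \<Longrightarrow>
      strang_error_le a b T \<epsilon> \<tau> u0 u1 u ut (C * (\<epsilon>\<^sup>2 * \<tau>\<^sup>2 + \<eta>))"
proof -
  obtain Q where Q: "Q > 0" "\<And>\<tau> \<theta> n. 0 < \<tau> \<Longrightarrow> \<tau> * \<bar>\<theta>\<bar> \<le> 2 * pi * \<alpha> \<Longrightarrow>
      cmod (quad_err \<tau> n \<theta>) \<le> Q * \<tau>\<^sup>2 * \<bar>\<theta>\<bar>"
    using quad_err_bound[OF alpha] by blast
  \<comment> \<open>The exported constants depend only on \<open>bt_const\<close>, M, T and Q, so D
    is fixed before \<epsilon>, \<tau>, \<tau>0 and the solution.\<close>
  define D where "D = kg_flow.defect_const bt_const M T Q * exp (kg_flow.growth_const bt_const M * T)"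
  \<comment> \<open>The absolute value makes C positive without determining the sign of D.\<close>
  define C where "C = 2 * \<bar>D\<bar> + 1"
  show ?thesis
  proof (rule that[of C])
    show "C > 0" by (simp add: C_def)
    fix \<epsilon> \<tau> \<tau>0 \<eta> :: real and u0 u1 u ut
    assume nkg: "nkg a b \<epsilon> (T / \<epsilon>\<^sup>2) M u0 u1 u ut" and eps: "0 < \<epsilon>" and t0: "0 < \<tau>0"
      and tau: "0 < \<tau>" "\<tau> < \<alpha> * step_bound a b \<tau>0"
      and tl: "\<And>t. 0 \<le> t \<Longrightarrow> t \<le> T / \<epsilon>\<^sup>2 \<Longrightarrow>
        l2b (tail \<tau>0 (solution_psi (u t) (ut t))) \<eta>"
      and small: "C * (\<epsilon>\<^sup>2 * \<tau>\<^sup>2 + \<eta>) \<le> 1"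
    interpret nkg a b \<epsilon> "T / \<epsilon>\<^sup>2" M u0 u1 u ut by (rule nkg)
    have psi: "solution_psi (u t) (ut t) = psi t" for t
      by (rule ext) (simp add: solution_psi_def psi_def)
    have eta0: "0 \<le> \<eta>" using l2b_nonneg[OF tl[of 0]] Te by simp
    have x0: "0 \<le> \<epsilon>\<^sup>2 * \<tau>\<^sup>2 + \<eta>" using eta0 by simp
    have quad: "cmod (quad_err \<tau> k \<theta>) \<le> Q * \<tau>\<^sup>2 * \<bar>\<theta>\<bar>" if "\<bar>\<theta>\<bar> \<le> 4 * step_freq \<tau>0" for \<theta> k
    proof (rule Q(2)[OF tau(1)])
      have f: "0 < step_freq \<tau>0" by (rule less_le_trans[OF zero_less_one step_freq_ge_1])
      have "\<tau> * \<bar>\<theta>\<bar> \<le> (\<alpha> * (pi / (2 * step_freq \<tau>0))) * (4 * step_freq \<tau>0)"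
        using tau t0 that alpha f by (intro mult_mono) (auto simp: step_bound_eq intro: less_imp_le)
      also have "\<dots> = 2 * pi * \<alpha>" using f by simp
      finally show "\<tau> * \<bar>\<theta>\<bar> \<le> 2 * pi * \<alpha>" .
    qed
    have D: "defect_const T Q * (\<epsilon>\<^sup>2 * \<tau>\<^sup>2 + \<eta>) * exp (growth_const * T) = D * (\<epsilon>\<^sup>2 * \<tau>\<^sup>2 + \<eta>)"
      by (simp add: D_def mult_ac)
    have "2 * D * (\<epsilon>\<^sup>2 * \<tau>\<^sup>2 + \<eta>) \<le> C * (\<epsilon>\<^sup>2 * \<tau>\<^sup>2 + \<eta>)"
      using x0 by (intro mult_right_mono) (auto simp: C_def)
    then have D2: "2 * (D * (\<epsilon>\<^sup>2 * \<tau>\<^sup>2 + \<eta>)) \<le> C * (\<epsilon>\<^sup>2 * \<tau>\<^sup>2 + \<eta>)" by (simp add: mult.assoc)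
    have "strang_error_le a b T \<epsilon> \<tau> u0 u1 u ut
        (2 * (defect_const T Q * (\<epsilon>\<^sup>2 * \<tau>\<^sup>2 + \<eta>) * exp (growth_const * T)))"
    proof (rule strang_error[OF tau(1) _ refl _ bt_le_step_freq[OF t0] quad])
      show "l2b (tail \<tau>0 (psi t)) \<eta>" if "0 \<le> t" "t \<le> T / \<epsilon>\<^sup>2" for t
        using tl[OF that] unfolding psi .
      show "defect_const T Q * (\<epsilon>\<^sup>2 * \<tau>\<^sup>2 + \<eta>) * exp (growth_const * T) \<le> 1"
        unfolding D using D2 small by linarith
    qed (use Q eps in auto)
    then show "strang_error_le a b T \<epsilon> \<tau> u0 u1 u ut (C * (\<epsilon>\<^sup>2 * \<tau>\<^sup>2 + \<eta>))"
      by (rule strang_error_le_mono) (use D2 in \<open>simp add: D\<close>)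
  qed
qed

end

section \<open>Families of solutions with common data, and the forms of the remainder\<close>

locale nkg_family = interval +
  fixes T \<alpha> M :: real and m :: nat
    and u0 u1 :: "real \<Rightarrow> real"
    and u ut :: "real \<Rightarrow> real \<Rightarrow> real \<Rightarrow> real"
  assumes T: "T > 0" and m: "m \<ge> 1" and alpha: "0 < \<alpha>" "\<alpha> < 1"
    and sol: "\<And>\<epsilon>. 0 < \<epsilon> \<Longrightarrow> \<epsilon> \<le> 1 \<Longrightarrow> nkg_solution a b \<epsilon> (T / \<epsilon>\<^sup>2) u0 u1 (u \<epsilon>) (ut \<epsilon>)"
    and reg_u: "\<And>\<epsilon> t. 0 < \<epsilon> \<Longrightarrow> \<epsilon> \<le> 1 \<Longrightarrow> 0 \<le> t \<Longrightarrow> t \<le> T / \<epsilon>\<^sup>2 \<Longrightarrow>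
        l2b (\<lambda>l. of_real (bt l ^ (m + 1)) * fc (\<lambda>x. of_real (u \<epsilon> t x)) l) M"
    and reg_ut: "\<And>\<epsilon> t. 0 < \<epsilon> \<Longrightarrow> \<epsilon> \<le> 1 \<Longrightarrow> 0 \<le> t \<Longrightarrow> t \<le> T / \<epsilon>\<^sup>2 \<Longrightarrow>
        l2b (\<lambda>l. of_real (bt l ^ m) * fc (\<lambda>x. of_real (ut \<epsilon> t x)) l) M"
begin

abbreviation "P \<epsilon> t \<equiv> solution_psi (u \<epsilon> t) (ut \<epsilon> t)"

abbreviation "err_le \<epsilon> \<tau> B \<equiv> strang_error_le a b T \<epsilon> \<tau> u0 u1 (u \<epsilon>) (ut \<epsilon>) B"

abbreviation "error_bound g \<equiv> \<exists>C>0. \<exists>\<delta>>0. \<delta> \<le> 1 \<and>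
  (\<forall>\<tau>0 \<epsilon> \<tau>. 0 < \<tau>0 \<and> \<tau>0 \<le> \<delta> \<and> 0 < \<epsilon> \<and> \<epsilon> \<le> 1 \<and> 0 < \<tau> \<and> \<tau> < \<alpha> * step_bound a b \<tau>0 \<longrightarrow>
    err_le \<epsilon> \<tau> (C * (\<epsilon>\<^sup>2 * \<tau>\<^sup>2 + g \<tau>0)))"

lemma lower_weight:
  assumes "l2b (\<lambda>l. of_real (bt l ^ k) * f l) B" "j \<le> k"
  shows "l2b (\<lambda>l. of_real (bt l ^ j) * f l) B"
  by (rule l2b_dominated[OF assms(1)])
    (use beta_ge_1 assms(2) in \<open>auto simp: norm_mult norm_power intro!: mult_right_mono power_increasing\<close>)

lemma nkg:
  assumes e: "0 < \<epsilon>" "\<epsilon> \<le> 1"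
  shows "nkg a b \<epsilon> (T / \<epsilon>\<^sup>2) M u0 u1 (u \<epsilon>) (ut \<epsilon>)"
proof
  show "nkg_solution a b \<epsilon> (T / \<epsilon>\<^sup>2) u0 u1 (u \<epsilon>) (ut \<epsilon>)" by (rule sol[OF e])
  show T0: "0 < T / \<epsilon>\<^sup>2" using T e by simp
  show "h1b (fc (\<lambda>x. of_real (u \<epsilon> t x))) M" if "0 \<le> t" "t \<le> T / \<epsilon>\<^sup>2" for t
    using lower_weight[OF reg_u[OF e that], of 1] by (simp add: h1b_def)
  show "l2b (fc (\<lambda>x. of_real (ut \<epsilon> t x))) M" if "0 \<le> t" "t \<le> T / \<epsilon>\<^sup>2" for t
    using lower_weight[OF reg_ut[OF e that], of 0] by simp
  show "\<exists>B. l2b (\<lambda>l. of_real ((bt l)\<^sup>2) * fc (\<lambda>x. of_real (u \<epsilon> 0 x)) l) B"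
    using lower_weight[OF reg_u[OF e, of 0], of 2] m T0 by auto
  show "\<exists>B. l2b (\<lambda>l. of_real (bt l) * fc (\<lambda>x. of_real (ut \<epsilon> 0 x)) l) B"
    using lower_weight[OF reg_ut[OF e, of 0], of 1] m T0 by auto
qed

text \<open>The common reduction for all forms of the remainder: any tail bound G g(\<tau>0) with g
  at most linear gives the error bound with g. Linearity is what turns the smallness condition of
  the bootstrap into a condition on \<tau>0.\<close>

lemma error_of_tail:
  assumes G: "0 \<le> G" and H: "0 \<le> H"
    and g: "\<And>\<tau>0. 0 < \<tau>0 \<Longrightarrow> \<tau>0 \<le> 1 \<Longrightarrow> 0 \<le> g \<tau>0 \<and> g \<tau>0 \<le> H * \<tau>0"
    and tl: "\<And>\<epsilon> t \<tau>0. 0 < \<epsilon> \<Longrightarrow> \<epsilon> \<le> 1 \<Longrightarrow> 0 \<le> t \<Longrightarrow> t \<le> T / \<epsilon>\<^sup>2 \<Longrightarrow> 0 < \<tau>0 \<Longrightarrow> \<tau>0 \<le> 1 \<Longrightarrow>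
        l2b (tail \<tau>0 (P \<epsilon> t)) (G * g \<tau>0)"
  shows "error_bound g"
proof -
  obtain C where C: "C > 0"
    "\<And>\<epsilon> \<tau> \<tau>0 \<eta> u0 u1 u ut. nkg a b \<epsilon> (T / \<epsilon>\<^sup>2) M u0 u1 u ut \<Longrightarrow> 0 < \<epsilon> \<Longrightarrow> 0 < \<tau>0 \<Longrightarrow>
      0 < \<tau> \<Longrightarrow> \<tau> < \<alpha> * step_bound a b \<tau>0 \<Longrightarrow>
      (\<And>t. 0 \<le> t \<Longrightarrow> t \<le> T / \<epsilon>\<^sup>2 \<Longrightarrow>
        l2b (tail \<tau>0 (solution_psi (u t) (ut t))) \<eta>) \<Longrightarrow>
      C * (\<epsilon>\<^sup>2 * \<tau>\<^sup>2 + \<eta>) \<le> 1 \<Longrightarrow>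
      strang_error_le a b T \<epsilon> \<tau> u0 u1 u ut (C * (\<epsilon>\<^sup>2 * \<tau>\<^sup>2 + \<eta>))"
    using uniform_error[OF alpha, of T M] by blast
  \<comment> \<open>Chosen so that \<epsilon>^2 \<tau>^2 + G g(\<tau>0) \<le> R \<tau>0; then
    \<delta> \<le> 1 / (C R) keeps C times this sum below 1.\<close>
  define R where "R = ((b - a) / 4)\<^sup>2 + G * H"
  have R: "R > 0" using ab G H by (simp add: R_def add_pos_nonneg)
  define \<delta> where "\<delta> = min 1 (1 / (C * R))"
  have d: "\<delta> > 0" "\<delta> \<le> 1" "C * (R * \<delta>) \<le> 1"
  proof -
    show "\<delta> > 0" "\<delta> \<le> 1" using C R by (auto simp: \<delta>_def)
    have "(C * R) * \<delta> \<le> (C * R) * (1 / (C * R))" using C R by (intro mult_left_mono) (auto simp: \<delta>_def)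
    then show "C * (R * \<delta>) \<le> 1" using C R by (simp add: mult.assoc)
  qed
  have "err_le \<epsilon> \<tau> (C * (1 + G) * (\<epsilon>\<^sup>2 * \<tau>\<^sup>2 + g \<tau>0))"
    if t0: "0 < \<tau>0" "\<tau>0 \<le> \<delta>" and e: "0 < \<epsilon>" "\<epsilon> \<le> 1" and tau: "0 < \<tau>" "\<tau> < \<alpha> * step_bound a b \<tau>0" for \<tau>0 \<epsilon> \<tau>
  proof -
    have t1: "\<tau>0 \<le> 1" using t0 d by linarith
    note gt = g[OF t0(1) t1]
    have "\<tau> \<le> 1 * step_bound a b \<tau>0"
    proof -
      have "0 < step_bound a b \<tau>0"
        using less_trans[OF tau] alpha by (simp add: zero_less_mult_iff)
      then have "\<alpha> * step_bound a b \<tau>0 \<le> 1 * step_bound a b \<tau>0" using alpha by (intro mult_right_mono) auto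
      then show ?thesis using tau by linarith
    qed
    then have "\<tau> \<le> (b - a) / 4 * \<tau>0" using step_bound_upper[OF t0(1)] by simp
    then have "\<tau>\<^sup>2 \<le> ((b - a) / 4 * \<tau>0)\<^sup>2" using tau by (intro power_mono) auto
    also have "\<dots> \<le> ((b - a) / 4)\<^sup>2 * \<tau>0"
      unfolding power_mult_distrib using t0 t1
      by (intro mult_left_mono) (simp_all add: power2_eq_square mult_left_le)
    finally have "\<tau>\<^sup>2 \<le> ((b - a) / 4)\<^sup>2 * \<tau>0" .
    moreover have "\<epsilon>\<^sup>2 * \<tau>\<^sup>2 \<le> 1 * \<tau>\<^sup>2" using e by (intro mult_right_mono) (auto simp: power_le_one)
    moreover have "G * g \<tau>0 \<le> G * (H * \<tau>0)" using gt G by (intro mult_left_mono) auto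
    ultimately have "\<epsilon>\<^sup>2 * \<tau>\<^sup>2 + G * g \<tau>0 \<le> R * \<tau>0" by (simp add: R_def algebra_simps)
    also have "\<dots> \<le> R * \<delta>" using R t0 by (intro mult_left_mono) auto
    finally have "C * (\<epsilon>\<^sup>2 * \<tau>\<^sup>2 + G * g \<tau>0) \<le> C * (R * \<delta>)" using C by (intro mult_left_mono) auto
    then have small: "C * (\<epsilon>\<^sup>2 * \<tau>\<^sup>2 + G * g \<tau>0) \<le> 1" using d by linarith
    have "err_le \<epsilon> \<tau> (C * (\<epsilon>\<^sup>2 * \<tau>\<^sup>2 + G * g \<tau>0))"
      using tl[OF e _ _ t0(1) t1] by (intro C(2)[OF nkg[OF e] e(1) t0(1) tau _ small])
    then show ?thesis
    proof (rule strang_error_le_mono)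
      have "0 \<le> G * (\<epsilon>\<^sup>2 * \<tau>\<^sup>2)" "0 \<le> g \<tau>0" using G gt by auto
      then have "\<epsilon>\<^sup>2 * \<tau>\<^sup>2 + G * g \<tau>0 \<le> (1 + G) * (\<epsilon>\<^sup>2 * \<tau>\<^sup>2 + g \<tau>0)" by (simp add: algebra_simps)
      then show "C * (\<epsilon>\<^sup>2 * \<tau>\<^sup>2 + G * g \<tau>0) \<le> C * (1 + G) * (\<epsilon>\<^sup>2 * \<tau>\<^sup>2 + g \<tau>0)"
        using C by (simp add: mult.assoc)
    qed
  qed
  moreover have "C * (1 + G) > 0" using C G by simp
  ultimately show ?thesis using d by blast
qed

text \<open>The parameter $\tau_0$ is eliminated by taking it proportional to $\tau$.\<close>

lemma error_proportional:
  assumes "error_bound g"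
  obtains C \<delta> s where "C > 0" "\<delta> > 0" "s > 0"
    "\<And>\<epsilon> \<tau>. 0 < \<epsilon> \<Longrightarrow> \<epsilon> \<le> 1 \<Longrightarrow> 0 < \<tau> \<Longrightarrow> \<tau> \<le> \<delta> \<Longrightarrow>
       err_le \<epsilon> \<tau> (C * (\<epsilon>\<^sup>2 * \<tau>\<^sup>2 + g (s * \<tau>)))"
proof -
  obtain C \<delta> where C: "C > 0" "\<delta> > 0" "\<delta> \<le> 1"
    and err: "\<And>\<tau>0 \<epsilon> \<tau>. 0 < \<tau>0 \<Longrightarrow> \<tau>0 \<le> \<delta> \<Longrightarrow> 0 < \<epsilon> \<Longrightarrow> \<epsilon> \<le> 1 \<Longrightarrow> 0 < \<tau> \<Longrightarrow> \<tau> < \<alpha> * step_bound a b \<tau>0 \<Longrightarrow>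
          err_le \<epsilon> \<tau> (C * (\<epsilon>\<^sup>2 * \<tau>\<^sup>2 + g \<tau>0))"
    using assms by blast
  obtain q where q: "q > 0" "\<And>\<tau>0. 0 < \<tau>0 \<Longrightarrow> \<tau>0 \<le> 1 \<Longrightarrow> q * \<tau>0 \<le> step_bound a b \<tau>0"
    using step_bound_lower by blast
  \<comment> \<open>With this s the lower estimate of the step bound at s \<tau> is 2 \<tau>, so the
    restriction holds strictly.\<close>
  define s where "s = 2 / (\<alpha> * q)"
  have s: "s > 0" using alpha q by (simp add: s_def)
  show ?thesis
  proof (rule that[of C "\<delta> / s" s])
    show "C > 0" "s > 0" "\<delta> / s > 0" using C s by auto
    fix \<epsilon> \<tau> :: real assume e: "0 < \<epsilon>" "\<epsilon> \<le> 1" and tau: "0 < \<tau>" "\<tau> \<le> \<delta> / s"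
    have st: "0 < s * \<tau>" "s * \<tau> \<le> \<delta>" using s tau by (auto simp: field_simps)
    have "\<alpha> * (q * (s * \<tau>)) \<le> \<alpha> * step_bound a b (s * \<tau>)"
      using st C alpha by (intro mult_left_mono q) auto
    moreover have "\<alpha> * (q * (s * \<tau>)) = 2 * \<tau>" using alpha q by (simp add: s_def)
    ultimately have "\<tau> < \<alpha> * step_bound a b (s * \<tau>)" using tau by linarith
    then show "err_le \<epsilon> \<tau> (C * (\<epsilon>\<^sup>2 * \<tau>\<^sup>2 + g (s * \<tau>)))"
      by (intro err st e tau)
  qed
qed

lemma error_of_regularity:
  assumes k: "k \<ge> 1" and D: "\<And>\<epsilon> t. 0 < \<epsilon> \<Longrightarrow> \<epsilon> \<le> 1 \<Longrightarrow> 0 \<le> t \<Longrightarrow> t \<le> T / \<epsilon>\<^sup>2 \<Longrightarrow>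
      l2b (\<lambda>l. of_real (bt l ^ k) * P \<epsilon> t l) D"
  shows "error_bound (\<lambda>\<tau>0. \<tau>0 ^ k)"
proof (rule error_of_tail)
  \<comment> \<open>The inverse of the slope in \<open>mu_tail\<close>: beyond the cutoff \<kappa>
    \<tau>0 times the weight is at least 1.\<close>
  define \<kappa> where "\<kappa> = 3 * (b - a) / (2 * pi)"
  have \<kappa>: "\<kappa> > 0" using ab by (simp add: \<kappa>_def)
  have D0: "0 \<le> D" using l2b_nonneg[OF D[of 1 0]] T by simp
  show "0 \<le> \<kappa> ^ k * D" "0 \<le> (1 :: real)" using \<kappa> D0 by auto
  show "0 \<le> \<tau>0 ^ k \<and> \<tau>0 ^ k \<le> 1 * \<tau>0" if "0 < \<tau>0" "\<tau>0 \<le> 1" for \<tau>0 :: real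
    using that power_decreasing[OF k, of \<tau>0] by simp
  fix \<epsilon> t \<tau>0 :: real
  assume et: "0 < \<epsilon>" "\<epsilon> \<le> 1" "0 \<le> t" "t \<le> T / \<epsilon>\<^sup>2" and t0: "0 < \<tau>0" "\<tau>0 \<le> 1"
  have "l2b (tail \<tau>0 (P \<epsilon> t)) ((\<kappa> * \<tau>0) ^ k * D)"
  proof (rule l2b_tail[OF D[OF et]])
    fix l assume "\<lfloor>1 / (3 * \<tau>0)\<rfloor> < \<bar>l\<bar>"
    from order_trans[OF mu_tail[OF t0(1) this] mu_le_bt]
    have "2 * pi / (3 * (b - a)) / \<tau>0 \<le> bt l" .
    then have "(\<kappa> * \<tau>0) * (2 * pi / (3 * (b - a)) / \<tau>0) \<le> (\<kappa> * \<tau>0) * bt l"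
      using \<kappa> t0 by (intro mult_left_mono) auto
    also have "(\<kappa> * \<tau>0) * (2 * pi / (3 * (b - a)) / \<tau>0) = 1" using t0 ab by (simp add: \<kappa>_def)
    finally have "1 \<le> ((\<kappa> * \<tau>0) * bt l) ^ k" by (rule one_le_power)
    then show "1 \<le> (\<kappa> * \<tau>0) ^ k * bt l ^ k" by (simp add: power_mult_distrib)
  qed (use \<kappa> t0 beta_pos in \<open>auto intro: less_imp_le\<close>)
  then show "l2b (tail \<tau>0 (P \<epsilon> t)) (\<kappa> ^ k * D * \<tau>0 ^ k)"
    by (simp add: power_mult_distrib mult_ac)
qed

text \<open>The time derivative enters psi divided by \<beta>, so its H^m bound is worth m + 1
  weights; this yields the exponent m + 1 of \<tau>0.\<close>

lemma psi_regularity: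
  assumes e: "0 < \<epsilon>" "\<epsilon> \<le> 1" "0 \<le> t" "t \<le> T / \<epsilon>\<^sup>2"
  shows "l2b (\<lambda>l. of_real (bt l ^ (m + 1)) * P \<epsilon> t l) (2 * M)"
proof -
  have "l2b (\<lambda>l. \<i> * (of_real (bt l ^ m) * fc (\<lambda>x. of_real (ut \<epsilon> t x)) l)) M"
    by (rule l2b_dominated[OF reg_ut[OF e]]) (simp add: norm_mult)
  from l2b_diff[OF reg_u[OF e] this] show ?thesis
    by (simp add: solution_psi_def[abs_def] right_diff_distrib mult_ac)
qed

text \<open>Membership in H^infinity carries no bound uniform in \<epsilon> and t. Uniform bounds
  are recovered from the data, which are common to all \<epsilon>: each application of
  \<open>regularity_gain\<close> adds one derivative at a cost controlled by T.\<close>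

lemma psi_smooth:
  assumes smooth: "\<And>k. \<exists>B. l2b (\<lambda>l. of_real (bt l ^ k) * P 1 0 l) B"
  shows "\<exists>D. \<forall>\<epsilon> t. 0 < \<epsilon> \<longrightarrow> \<epsilon> \<le> 1 \<longrightarrow> 0 \<le> t \<longrightarrow> t \<le> T / \<epsilon>\<^sup>2 \<longrightarrow>
      l2b (\<lambda>l. of_real (bt l ^ Suc k) * P \<epsilon> t l) D"
proof (induction k)
  case 0
  show ?case using lower_weight[OF psi_regularity, of _ _ 1] by (auto intro!: exI[of _ "2 * M"])
next
  case (Suc k)
  then obtain D where D: "\<And>\<epsilon> t. 0 < \<epsilon> \<Longrightarrow> \<epsilon> \<le> 1 \<Longrightarrow> 0 \<le> t \<Longrightarrow> t \<le> T / \<epsilon>\<^sup>2 \<Longrightarrow>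
      l2b (\<lambda>l. of_real (bt l ^ Suc k) * P \<epsilon> t l) D" by blast
  obtain D0 where D0: "l2b (\<lambda>l. of_real (bt l ^ Suc (Suc k)) * P 1 0 l) D0" using smooth by blast
  show ?case
  proof (intro exI allI impI)
    fix \<epsilon> t :: real assume e: "0 < \<epsilon>" "\<epsilon> \<le> 1" and t: "0 \<le> t" "t \<le> T / \<epsilon>\<^sup>2"
    have init: "u \<epsilon> 0 x = u 1 0 x" "ut \<epsilon> 0 x = ut 1 0 x" if "x \<in> {a..b}" for x
      using sol[OF e] sol[of 1] that by (auto simp: nkg_solution_def)
    have f0: "fc (\<lambda>x. of_real (u \<epsilon> 0 x)) l = fc (\<lambda>x. of_real (u 1 0 x)) l"
      "fc (\<lambda>x. of_real (ut \<epsilon> 0 x)) l = fc (\<lambda>x. of_real (ut 1 0 x)) l" for l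
      by (intro fc_cong; simp add: init)+
    have P0: "P \<epsilon> 0 = P 1 0" by (rule ext) (simp add: solution_psi_def f0)
    interpret nkg a b \<epsilon> "T / \<epsilon>\<^sup>2" M u0 u1 "u \<epsilon>" "ut \<epsilon>" by (rule nkg[OF e])
    have P: "P \<epsilon> s = psi s" for s by (rule ext) (simp add: solution_psi_def psi_def)
    have eT: "\<epsilon>\<^sup>2 * (T / \<epsilon>\<^sup>2) \<le> T" using e by simp
    have U: "l2b (\<lambda>l. of_real (bt l ^ Suc k) * fc (cu s) l) D" if "0 \<le> s" "s \<le> T / \<epsilon>\<^sup>2" for s
      using l2b_weight_rp[OF D[OF e that]] by (simp only: P rp_psi[OF that])
    from P0 have D0': "l2b (\<lambda>l. of_real (bt l ^ Suc (Suc k)) * psi 0 l) D0" using D0 by (simp only: P[symmetric])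
    from regularity_gain[OF eT U D0' t]
    show "l2b (\<lambda>l. of_real (bt l ^ Suc (Suc k)) * P \<epsilon> t l) (D0 + T * (2 ^ Suc k * (D * (bt_const * M * (bt_const * M)) +
        bt_const * M * (2 ^ Suc k * (D * (bt_const * M) + bt_const * M * D)))))"
      unfolding P .
  qed
qed

lemma error_smooth:
  assumes smooth: "\<And>k. \<exists>B. l2b (\<lambda>l. of_real (bt l ^ k) * P 1 0 l) B"
  shows "error_bound (\<lambda>\<tau>0. \<tau>0 ^ k)"
proof -
  obtain D where "\<And>\<epsilon> t. 0 < \<epsilon> \<Longrightarrow> \<epsilon> \<le> 1 \<Longrightarrow> 0 \<le> t \<Longrightarrow> t \<le> T / \<epsilon>\<^sup>2 \<Longrightarrow>
      l2b (\<lambda>l. of_real (bt l ^ Suc k) * P \<epsilon> t l) D" using psi_smooth[OF smooth] by blast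
  then obtain C \<delta> where C: "C > 0" "\<delta> > 0" "\<delta> \<le> 1"
    and err: "\<And>\<tau>0 \<epsilon> \<tau>. 0 < \<tau>0 \<and> \<tau>0 \<le> \<delta> \<and> 0 < \<epsilon> \<and> \<epsilon> \<le> 1 \<and> 0 < \<tau> \<and> \<tau> < \<alpha> * step_bound a b \<tau>0 \<Longrightarrow>
          err_le \<epsilon> \<tau> (C * (\<epsilon>\<^sup>2 * \<tau>\<^sup>2 + \<tau>0 ^ Suc k))"
    using error_of_regularity[of "Suc k" D] by auto
  have "err_le \<epsilon> \<tau> (C * (\<epsilon>\<^sup>2 * \<tau>\<^sup>2 + \<tau>0 ^ k))"
    if h: "0 < \<tau>0 \<and> \<tau>0 \<le> \<delta> \<and> 0 < \<epsilon> \<and> \<epsilon> \<le> 1 \<and> 0 < \<tau> \<and> \<tau> < \<alpha> * step_bound a b \<tau>0" for \<tau>0 \<epsilon> \<tau>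
  proof (rule strang_error_le_mono[OF err[OF h]])
    have "\<tau>0 ^ Suc k \<le> \<tau>0 ^ k" using h C by (intro power_decreasing) auto
    then show "C * (\<epsilon>\<^sup>2 * \<tau>\<^sup>2 + \<tau>0 ^ Suc k) \<le> C * (\<epsilon>\<^sup>2 * \<tau>\<^sup>2 + \<tau>0 ^ k)"
      using C by (intro mult_left_mono add_left_mono) auto
  qed
  then show ?thesis using C by blast
qed

lemma error_smooth_absorbed:
  assumes smooth: "\<And>k. \<exists>B. l2b (\<lambda>l. of_real (bt l ^ k) * P 1 0 l) B"
  shows "\<exists>C>0. \<exists>\<delta>>0. (\<forall>\<epsilon> \<tau>. 0 < \<epsilon> \<and> \<epsilon> \<le> 1 \<and> 0 < \<tau> \<and> \<tau> \<le> \<delta> \<and> \<tau> ^ N \<le> \<epsilon>\<^sup>2 \<longrightarrow>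
            err_le \<epsilon> \<tau> (C * (\<epsilon>\<^sup>2 * \<tau>\<^sup>2)))"
proof -
  obtain C \<delta> s where C: "C > 0" "\<delta> > 0" "s > 0"
    and err: "\<And>\<epsilon> \<tau>. 0 < \<epsilon> \<Longrightarrow> \<epsilon> \<le> 1 \<Longrightarrow> 0 < \<tau> \<Longrightarrow> \<tau> \<le> \<delta> \<Longrightarrow>
       err_le \<epsilon> \<tau> (C * (\<epsilon>\<^sup>2 * \<tau>\<^sup>2 + (s * \<tau>) ^ (N + 2)))"
    using error_proportional[OF error_smooth[OF smooth, of "N + 2"]] by blast
  have "err_le \<epsilon> \<tau> (C * (1 + s ^ (N + 2)) * (\<epsilon>\<^sup>2 * \<tau>\<^sup>2))"
    if h: "0 < \<epsilon>" "\<epsilon> \<le> 1" "0 < \<tau>" "\<tau> \<le> \<delta>" "\<tau> ^ N \<le> \<epsilon>\<^sup>2" for \<epsilon> \<tau>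
  proof (rule strang_error_le_mono[OF err[OF h(1-4)]])
    \<comment> \<open>Of the N + 2 powers, N are traded for \<epsilon>^2 and two supply the order
      \<tau>^2.\<close>
    have "(s * \<tau>) ^ (N + 2) = s ^ (N + 2) * (\<tau> ^ N * \<tau>\<^sup>2)"
      by (simp only: power_mult_distrib power_add mult_ac)
    also have "\<dots> \<le> s ^ (N + 2) * (\<epsilon>\<^sup>2 * \<tau>\<^sup>2)" using h C by (intro mult_left_mono mult_right_mono) auto
    finally have "\<epsilon>\<^sup>2 * \<tau>\<^sup>2 + (s * \<tau>) ^ (N + 2) \<le> (1 + s ^ (N + 2)) * (\<epsilon>\<^sup>2 * \<tau>\<^sup>2)"
      by (simp add: distrib_right)
    then show "C * (\<epsilon>\<^sup>2 * \<tau>\<^sup>2 + (s * \<tau>) ^ (N + 2)) \<le> C * (1 + s ^ (N + 2)) * (\<epsilon>\<^sup>2 * \<tau>\<^sup>2)"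
      using C by (simp add: mult.assoc)
  qed
  moreover have "C * (1 + s ^ (N + 2)) > 0" using C by (simp add: add_pos_pos)
  ultimately show ?thesis using C by blast
qed

lemma error_analytic:
  assumes \<rho>: "\<rho> > 0" and an: "\<And>\<epsilon> t. 0 < \<epsilon> \<Longrightarrow> \<epsilon> \<le> 1 \<Longrightarrow> 0 \<le> t \<Longrightarrow> t \<le> T / \<epsilon>\<^sup>2 \<Longrightarrow>
      l2b (\<lambda>l. of_real (exp (\<rho> * \<bar>mu a b l\<bar>)) * P \<epsilon> t l) D"
  shows "\<exists>c>0. error_bound (\<lambda>\<tau>0. exp (- c / \<tau>0))"
proof -
  \<comment> \<open>At the first discarded frequency the exponential weight has exponent at least c
    / \<tau>0.\<close>
  define c where "c = \<rho> * (2 * pi / (3 * (b - a)))"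
  have c: "c > 0" using \<rho> ab by (simp add: c_def)
  have D0: "0 \<le> D" using l2b_nonneg[OF an[of 1 0]] T by simp
  have "error_bound (\<lambda>\<tau>0. exp (- c / \<tau>0))"
  proof (rule error_of_tail)
    show "0 \<le> D" by (rule D0)
    show "0 \<le> 1 / c" using c by simp
    show "0 \<le> exp (- c / \<tau>0) \<and> exp (- c / \<tau>0) \<le> 1 / c * \<tau>0" if "0 < \<tau>0" "\<tau>0 \<le> 1" for \<tau>0
    proof -
      have "c / \<tau>0 \<le> exp (c / \<tau>0)" using exp_ge_add_one_self[of "c / \<tau>0"] by linarith
      then have "inverse (exp (c / \<tau>0)) \<le> inverse (c / \<tau>0)" using c that by (intro le_imp_inverse_le) auto
      then show ?thesis by (simp add: exp_minus[symmetric])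
    qed
    fix \<epsilon> t \<tau>0 :: real
    assume et: "0 < \<epsilon>" "\<epsilon> \<le> 1" "0 \<le> t" "t \<le> T / \<epsilon>\<^sup>2" and t0: "0 < \<tau>0" "\<tau>0 \<le> 1"
    have "l2b (tail \<tau>0 (P \<epsilon> t)) (exp (- c / \<tau>0) * D)"
    proof (rule l2b_tail[OF an[OF et]])
      fix l assume "\<lfloor>1 / (3 * \<tau>0)\<rfloor> < \<bar>l\<bar>"
      from mult_left_mono[OF mu_tail[OF t0(1) this], of \<rho>]
      have "c / \<tau>0 \<le> \<rho> * \<bar>mu a b l\<bar>" using \<rho> by (simp add: c_def)
      then have "1 \<le> exp (- c / \<tau>0 + \<rho> * \<bar>mu a b l\<bar>)" by simp
      then show "1 \<le> exp (- c / \<tau>0) * exp (\<rho> * \<bar>mu a b l\<bar>)" unfolding exp_add .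
    qed auto
    then show "l2b (tail \<tau>0 (P \<epsilon> t)) (D * exp (- c / \<tau>0))"
      by (simp add: mult.commute)
  qed
  then show ?thesis using c by blast
qed

lemma error_analytic_absorbed:
  assumes "\<exists>c>0. error_bound (\<lambda>\<tau>0. exp (- c / \<tau>0))"
  shows "\<exists>\<kappa>>0. \<exists>C>0. \<exists>\<delta>>0.
         (\<forall>\<epsilon> \<tau>. 0 < \<epsilon> \<and> \<epsilon> \<le> 1 \<and> 0 < \<tau> \<and> \<tau> \<le> \<delta> \<and> exp (- \<kappa> / \<tau>) \<le> \<epsilon>\<^sup>2 \<longrightarrow>
            err_le \<epsilon> \<tau> (C * (\<epsilon>\<^sup>2 * \<tau>\<^sup>2)))"
proof -
  obtain c where c: "c > 0" and ex: "error_bound (\<lambda>\<tau>0. exp (- c / \<tau>0))"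
    using assms by blast
  obtain C \<delta> s where C: "C > 0" "\<delta> > 0" "s > 0"
    and err: "\<And>\<epsilon> \<tau>. 0 < \<epsilon> \<Longrightarrow> \<epsilon> \<le> 1 \<Longrightarrow> 0 < \<tau> \<Longrightarrow> \<tau> \<le> \<delta> \<Longrightarrow>
       err_le \<epsilon> \<tau> (C * (\<epsilon>\<^sup>2 * \<tau>\<^sup>2 + exp (- c / (s * \<tau>))))"
    using error_proportional[OF ex] by blast
  \<comment> \<open>Half of the available decay rate: exp (- c / (s \<tau>)) is the square of exp (-
    \<kappa> / \<tau>), of which one factor is at most \<epsilon>^2 and the other is O(\<tau>^2)
    because e^x \<ge> x^2 / 2.\<close>
  define \<kappa> where "\<kappa> = c / (2 * s)"
  have \<kappa>: "\<kappa> > 0" using c C by (simp add: \<kappa>_def)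
  have "err_le \<epsilon> \<tau> (C * (1 + 2 / \<kappa>\<^sup>2) * (\<epsilon>\<^sup>2 * \<tau>\<^sup>2))"
    if h: "0 < \<epsilon>" "\<epsilon> \<le> 1" "0 < \<tau>" "\<tau> \<le> \<delta>" "exp (- \<kappa> / \<tau>) \<le> \<epsilon>\<^sup>2" for \<epsilon> \<tau>
  proof (rule strang_error_le_mono[OF err[OF h(1-4)]])
    define x where "x = \<kappa> / \<tau>"
    have x: "x > 0" using \<kappa> h by (simp add: x_def)
    have "x\<^sup>2 / 2 \<le> exp x" using exp_lower_Taylor_quadratic[of x] x by simp
    then have "inverse (exp x) \<le> inverse (x\<^sup>2 / 2)" using x by (intro le_imp_inverse_le) auto
    then have ex: "exp (- x) \<le> 2 / \<kappa>\<^sup>2 * \<tau>\<^sup>2" by (simp add: exp_minus x_def power_divide mult.commute)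
    have "exp (- c / (s * \<tau>)) = exp (- x + - x)"
      using C h by (simp add: x_def \<kappa>_def field_simps)
    also have "\<dots> = exp (- x) * exp (- x)" by (rule exp_add)
    also have "\<dots> \<le> \<epsilon>\<^sup>2 * (2 / \<kappa>\<^sup>2 * \<tau>\<^sup>2)"
      using h(5) ex by (intro mult_mono) (auto simp: x_def)
    finally have "\<epsilon>\<^sup>2 * \<tau>\<^sup>2 + exp (- c / (s * \<tau>)) \<le> (1 + 2 / \<kappa>\<^sup>2) * (\<epsilon>\<^sup>2 * \<tau>\<^sup>2)"
      by (simp add: algebra_simps)
    then show "C * (\<epsilon>\<^sup>2 * \<tau>\<^sup>2 + exp (- c / (s * \<tau>))) \<le> C * (1 + 2 / \<kappa>\<^sup>2) * (\<epsilon>\<^sup>2 * \<tau>\<^sup>2)"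
      using C by (simp add: mult.assoc)
  qed
  moreover have "C * (1 + 2 / \<kappa>\<^sup>2) > 0" using C by (intro mult_pos_pos add_pos_nonneg) auto
  ultimately show ?thesis using C \<kappa> by blast
qed

end

lemma (in interval) norm_divide_bt: "cmod (z / of_real (bt l)) \<le> cmod z"
  using mult_left_mono[OF beta_ge_1[of l] norm_ge_zero[of z]] beta_pos[of l]
  by (simp add: norm_divide divide_le_eq)

lemma (in interval) analytic_ball_l2b:
  assumes "f \<in> analytic_ball a b \<rho> K"
  shows "l2b (\<lambda>l. of_real (exp (\<rho> * \<bar>mu a b l\<bar>)) * fc f l) (sqrt K)"
proof -
  have w: "(cmod (of_real (exp (\<rho> * \<bar>mu a b l\<bar>)) * fc f l))\<^sup>2 = exp (2 * \<rho> * \<bar>mu a b l\<bar>) * (cmod (fc f l))\<^sup>2" for l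
    by (simp add: norm_mult power_mult_distrib exp_double[symmetric] mult.assoc)
  have "(\<lambda>l. (cmod (of_real (exp (\<rho> * \<bar>mu a b l\<bar>)) * fc f l))\<^sup>2) summable_on UNIV"
    using assms unfolding w by (simp add: analytic_ball_def)
  from l2b_of_summable[OF this] show ?thesis
    by (rule l2b_mono) (use assms in \<open>simp only: w analytic_ball_def mem_Collect_eq real_sqrt_le_iff\<close>)
qed

(* The conclusion has three parts: the improved uniform error bound; for solutions in H^infinity,
   the remainder decays faster than any power of tau0 and is absorbed for tau small compared with
   some power of eps, however small; for analytic solutions, the remainder decays exponentially in
   1/tau0 and is absorbed once exp (- kappa / tau) is at most eps^2. *)
theorem theorem2p1:
  fixes a b T \<alpha> M :: real and m :: nat
    and u0 u1 :: "real \<Rightarrow> real"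
    and u ut :: "real \<Rightarrow> real \<Rightarrow> real \<Rightarrow> real"
  assumes ab: "a < b" and T: "T > 0" and m: "m \<ge> 1" and alpha: "0 < \<alpha>" "\<alpha> < 1"
    and sol: "\<And>\<epsilon>. 0 < \<epsilon> \<Longrightarrow> \<epsilon> \<le> 1 \<Longrightarrow> nkg_solution a b \<epsilon> (T / \<epsilon>\<^sup>2) u0 u1 (u \<epsilon>) (ut \<epsilon>)"
    and reg_u: "\<And>\<epsilon> t. 0 < \<epsilon> \<Longrightarrow> \<epsilon> \<le> 1 \<Longrightarrow> 0 \<le> t \<Longrightarrow> t \<le> T / \<epsilon>\<^sup>2 \<Longrightarrow>
        (\<lambda>x. of_real (u \<epsilon> t x)) \<in> hspace a b (m + 1) \<and>
        hnorm a b (m + 1) (\<lambda>x. of_real (u \<epsilon> t x)) \<le> M"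
    and reg_ut: "\<And>\<epsilon> t. 0 < \<epsilon> \<Longrightarrow> \<epsilon> \<le> 1 \<Longrightarrow> 0 \<le> t \<Longrightarrow> t \<le> T / \<epsilon>\<^sup>2 \<Longrightarrow>
        (\<lambda>x. of_real (ut \<epsilon> t x)) \<in> hspace a b m \<and>
        hnorm a b m (\<lambda>x. of_real (ut \<epsilon> t x)) \<le> M"
  shows
    "(\<exists>C>0. \<exists>\<delta>>0. \<delta> \<le> 1 \<and>
       (\<forall>\<tau>0 \<epsilon> \<tau>. 0 < \<tau>0 \<and> \<tau>0 \<le> \<delta> \<and> 0 < \<epsilon> \<and> \<epsilon> \<le> 1 \<and> 0 < \<tau> \<and> \<tau> < \<alpha> * step_bound a b \<tau>0 \<longrightarrow>
          strang_error_le a b T \<epsilon> \<tau> u0 u1 (u \<epsilon>) (ut \<epsilon>) (C * (\<epsilon>\<^sup>2 * \<tau>\<^sup>2 + \<tau>0 ^ (m + 1)))))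
     \<and>
     ((\<forall>\<epsilon> t. 0 < \<epsilon> \<and> \<epsilon> \<le> 1 \<and> 0 \<le> t \<and> t \<le> T / \<epsilon>\<^sup>2 \<longrightarrow>
          (\<lambda>x. of_real (u \<epsilon> t x)) \<in> hspace_inf a b \<and> (\<lambda>x. of_real (ut \<epsilon> t x)) \<in> hspace_inf a b)
      \<longrightarrow>
       (\<forall>k::nat. \<exists>C>0. \<exists>\<delta>>0. \<delta> \<le> 1 \<and>
         (\<forall>\<tau>0 \<epsilon> \<tau>. 0 < \<tau>0 \<and> \<tau>0 \<le> \<delta> \<and> 0 < \<epsilon> \<and> \<epsilon> \<le> 1 \<and> 0 < \<tau> \<and> \<tau> < \<alpha> * step_bound a b \<tau>0 \<longrightarrow>
            strang_error_le a b T \<epsilon> \<tau> u0 u1 (u \<epsilon>) (ut \<epsilon>) (C * (\<epsilon>\<^sup>2 * \<tau>\<^sup>2 + \<tau>0 ^ k)))) \<and>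
       (\<forall>N::nat. N \<ge> 1 \<longrightarrow> (\<exists>C>0. \<exists>\<delta>>0.
         (\<forall>\<epsilon> \<tau>. 0 < \<epsilon> \<and> \<epsilon> \<le> 1 \<and> 0 < \<tau> \<and> \<tau> \<le> \<delta> \<and> \<tau> ^ N \<le> \<epsilon>\<^sup>2 \<longrightarrow>
            strang_error_le a b T \<epsilon> \<tau> u0 u1 (u \<epsilon>) (ut \<epsilon>) (C * (\<epsilon>\<^sup>2 * \<tau>\<^sup>2))))))
     \<and>
     ((\<exists>\<rho>>0. \<exists>K. \<forall>\<epsilon> t. 0 < \<epsilon> \<and> \<epsilon> \<le> 1 \<and> 0 \<le> t \<and> t \<le> T / \<epsilon>\<^sup>2 \<longrightarrow>
          (\<lambda>x. of_real (u \<epsilon> t x)) \<in> analytic_ball a b \<rho> K \<and>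
          (\<lambda>x. of_real (ut \<epsilon> t x)) \<in> analytic_ball a b \<rho> K)
      \<longrightarrow>
       (\<exists>c>0. \<exists>C>0. \<exists>\<delta>>0. \<delta> \<le> 1 \<and>
         (\<forall>\<tau>0 \<epsilon> \<tau>. 0 < \<tau>0 \<and> \<tau>0 \<le> \<delta> \<and> 0 < \<epsilon> \<and> \<epsilon> \<le> 1 \<and> 0 < \<tau> \<and> \<tau> < \<alpha> * step_bound a b \<tau>0 \<longrightarrow>
            strang_error_le a b T \<epsilon> \<tau> u0 u1 (u \<epsilon>) (ut \<epsilon>) (C * (\<epsilon>\<^sup>2 * \<tau>\<^sup>2 + exp (- c / \<tau>0))))) \<and>
       (\<exists>\<kappa>>0. \<exists>C>0. \<exists>\<delta>>0.
         (\<forall>\<epsilon> \<tau>. 0 < \<epsilon> \<and> \<epsilon> \<le> 1 \<and> 0 < \<tau> \<and> \<tau> \<le> \<delta> \<and> exp (- \<kappa> / \<tau>) \<le> \<epsilon>\<^sup>2 \<longrightarrow>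
            strang_error_le a b T \<epsilon> \<tau> u0 u1 (u \<epsilon>) (ut \<epsilon>) (C * (\<epsilon>\<^sup>2 * \<tau>\<^sup>2)))))"
proof -
  interpret interval a b by unfold_locales (rule ab)
  interpret nkg_family a b T \<alpha> M m u0 u1 u ut
  proof
    fix \<epsilon> t :: real assume e: "0 < \<epsilon>" "\<epsilon> \<le> 1" "0 \<le> t" "t \<le> T / \<epsilon>\<^sup>2"
    show "l2b (\<lambda>l. of_real (bt l ^ (m + 1)) * fc (\<lambda>x. of_real (u \<epsilon> t x)) l) M"
      using reg_u[OF e] by (intro hspace_l2b) auto
    show "l2b (\<lambda>l. of_real (bt l ^ m) * fc (\<lambda>x. of_real (ut \<epsilon> t x)) l) M"
      using reg_ut[OF e] by (intro hspace_l2b) auto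
  qed (fact T m alpha sol)+
  have T0: "0 \<le> T / 1\<^sup>2" using T by simp
  show ?thesis
  proof (intro conjI impI allI)
    show "error_bound (\<lambda>\<tau>0. \<tau>0 ^ (m + 1))"
      by (rule error_of_regularity[OF _ psi_regularity]) simp
  next
    assume inf: "\<forall>\<epsilon> t. 0 < \<epsilon> \<and> \<epsilon> \<le> 1 \<and> 0 \<le> t \<and> t \<le> T / \<epsilon>\<^sup>2 \<longrightarrow>
          (\<lambda>x. of_real (u \<epsilon> t x)) \<in> hspace_inf a b \<and> (\<lambda>x. of_real (ut \<epsilon> t x)) \<in> hspace_inf a b"
    \<comment> \<open>Smoothness of the common data is read off from the member \<epsilon> = 1 at
      time 0.\<close>
    then have h: "(\<lambda>x. of_real (u 1 0 x)) \<in> hspace a b k" "(\<lambda>x. of_real (ut 1 0 x)) \<in> hspace a b k" for k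
      using T0 by (auto simp: hspace_inf_def)
    have smooth: "\<exists>B. l2b (\<lambda>l. of_real (bt l ^ k) * solution_psi (u 1 0) (ut 1 0) l) B" for k
    proof -
      have "l2b (\<lambda>l. \<i> * (of_real (bt l ^ k) * fc (\<lambda>x. of_real (ut 1 0 x)) l / of_real (bt l)))
          (hnorm a b k (\<lambda>x. of_real (ut 1 0 x)))"
        by (rule l2b_dominated[OF hspace_l2b[OF h(2) order_refl]])
          (simp only: norm_mult[of "\<i>"] norm_ii mult_1 norm_divide_bt)
      from l2b_diff[OF hspace_l2b[OF h(1) order_refl] this]
      show ?thesis by (auto simp: solution_psi_def[abs_def] right_diff_distrib mult_ac)
    qed
    show "error_bound (\<lambda>\<tau>0. \<tau>0 ^ k)" for k :: nat
      by (rule error_smooth[OF smooth])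
    show "\<exists>C>0. \<exists>\<delta>>0. (\<forall>\<epsilon> \<tau>. 0 < \<epsilon> \<and> \<epsilon> \<le> 1 \<and> 0 < \<tau> \<and> \<tau> \<le> \<delta> \<and> \<tau> ^ N \<le> \<epsilon>\<^sup>2 \<longrightarrow>
            err_le \<epsilon> \<tau> (C * (\<epsilon>\<^sup>2 * \<tau>\<^sup>2)))" for N :: nat
      by (rule error_smooth_absorbed[OF smooth])
  next
    assume "\<exists>\<rho>>0. \<exists>K. \<forall>\<epsilon> t. 0 < \<epsilon> \<and> \<epsilon> \<le> 1 \<and> 0 \<le> t \<and> t \<le> T / \<epsilon>\<^sup>2 \<longrightarrow>
          (\<lambda>x. of_real (u \<epsilon> t x)) \<in> analytic_ball a b \<rho> K \<and>
          (\<lambda>x. of_real (ut \<epsilon> t x)) \<in> analytic_ball a b \<rho> K"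
    then obtain \<rho> K where \<rho>: "\<rho> > 0" and an: "\<And>\<epsilon> t. 0 < \<epsilon> \<Longrightarrow> \<epsilon> \<le> 1 \<Longrightarrow> 0 \<le> t \<Longrightarrow> t \<le> T / \<epsilon>\<^sup>2 \<Longrightarrow>
          (\<lambda>x. of_real (u \<epsilon> t x)) \<in> analytic_ball a b \<rho> K \<and>
          (\<lambda>x. of_real (ut \<epsilon> t x)) \<in> analytic_ball a b \<rho> K" by blast
    have "l2b (\<lambda>l. of_real (exp (\<rho> * \<bar>mu a b l\<bar>)) * solution_psi (u \<epsilon> t) (ut \<epsilon> t) l) (sqrt K + sqrt K)"
      if e: "0 < \<epsilon>" "\<epsilon> \<le> 1" "0 \<le> t" "t \<le> T / \<epsilon>\<^sup>2" for \<epsilon> t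
    proof -
      have "l2b (\<lambda>l. \<i> * (of_real (exp (\<rho> * \<bar>mu a b l\<bar>)) * fc (\<lambda>x. of_real (ut \<epsilon> t x)) l / of_real (bt l))) (sqrt K)"
        by (rule l2b_dominated[OF analytic_ball_l2b[OF conjunct2[OF an[OF e]]]])
          (simp only: norm_mult[of "\<i>"] norm_ii mult_1 norm_divide_bt)
      from l2b_diff[OF analytic_ball_l2b[OF conjunct1[OF an[OF e]]] this]
      show ?thesis by (simp add: solution_psi_def[abs_def] right_diff_distrib mult_ac)
    qed
    note ea = error_analytic[OF \<rho> this]
    show "\<exists>c>0. error_bound (\<lambda>\<tau>0. exp (- c / \<tau>0))"
      by (rule ea)
    show "\<exists>\<kappa>>0. \<exists>C>0. \<exists>\<delta>>0.
         (\<forall>\<epsilon> \<tau>. 0 < \<epsilon> \<and> \<epsilon> \<le> 1 \<and> 0 < \<tau> \<and> \<tau> \<le> \<delta> \<and> exp (- \<kappa> / \<tau>) \<le> \<epsilon>\<^sup>2 \<longrightarrow>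
            err_le \<epsilon> \<tau> (C * (\<epsilon>\<^sup>2 * \<tau>\<^sup>2)))"
      by (rule error_analytic_absorbed[OF ea])
  qed
qed

end
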